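(* Let $0<q\le1$, let $\Omega$ be any domain of $\mathbb{R}^N$, $T\in(0,\infty]$, and let $u$ be any nonnegative weak solution of (E) in $Q_{\Omega,T}$. Then $u$ admits a trace $u_0\in\mathcal{M}^+(\Omega)$, i.e. $\lim_{t\to0}\int_\Omega u(\cdot,t)\psi\,dx=\int_\Omega\psi\,du_0$ for every $\psi\in C_c(\Omega)$.
   Context: Equation (E) is $u_t-\Delta u+|\nabla u|^q=0$, $Q_{\Omega,T}=\Omega\times(0,T)$. A weak solution of (E) in $Q_{\Omega,T}$ is a function $u\in C((0,T);L^1_{loc}(\Omega))\cap L^1_{loc}((0,T);W^{1,1}_{loc}(\Omega))$ with $|\nabla u|^q\in L^1_{loc}(Q_{\Omega,T})$ satisfying (E) in the distribution sense. $\mathcal{M}^+(\Omega)$ is the set of nonnegative Radon measures on $\Omega$. *)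

theory Defs
  imports "HOL-Analysis.Analysis"
begin

definition dirderiv :: "'a::euclidean_space \<Rightarrow> ('a \<Rightarrow> real) \<Rightarrow> 'a \<Rightarrow> real" where
  "dirderiv v f p = deriv (\<lambda>s. f (p + s *\<^sub>R v)) 0"

fun dirderiv_iter :: "'a::euclidean_space list \<Rightarrow> ('a \<Rightarrow> real) \<Rightarrow> 'a \<Rightarrow> real" where
  "dirderiv_iter [] f = f"
| "dirderiv_iter (v # vs) f = dirderiv v (dirderiv_iter vs f)"

definition smooth_fun :: "('a::euclidean_space \<Rightarrow> real) \<Rightarrow> bool" where
  "smooth_fun f \<longleftrightarrow> (\<forall>vs p. dirderiv_iter vs f differentiable (at p))"

definition tsupport :: "('a::topological_space \<Rightarrow> real) \<Rightarrow> 'a set" where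
  "tsupport f = closure {x. f x \<noteq> 0}"

definition test_fun :: "'a::euclidean_space set \<Rightarrow> ('a \<Rightarrow> real) \<Rightarrow> bool" where
  "test_fun U \<phi> \<longleftrightarrow> smooth_fun \<phi> \<and> compact (tsupport \<phi>) \<and> tsupport \<phi> \<subseteq> U"

definition Cc_fun :: "'a::euclidean_space set \<Rightarrow> ('a \<Rightarrow> real) \<Rightarrow> bool" where
  "Cc_fun U \<psi> \<longleftrightarrow> continuous_on UNIV \<psi> \<and> compact (tsupport \<psi>) \<and> tsupport \<psi> \<subseteq> U"

definition tint :: "ereal \<Rightarrow> real set" where
  "tint T = {t. 0 < t \<and> ereal t < T}"

definition cyl :: "'a set \<Rightarrow> ereal \<Rightarrow> ('a \<times> real) set" where
  "cyl \<Omega> T = \<Omega> \<times> tint T"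

definition dt :: "('a::euclidean_space \<times> real \<Rightarrow> real) \<Rightarrow> 'a \<times> real \<Rightarrow> real" where
  "dt \<phi> = dirderiv (0, 1) \<phi>"

definition dxi :: "'a::euclidean_space \<Rightarrow> ('a \<times> real \<Rightarrow> real) \<Rightarrow> 'a \<times> real \<Rightarrow> real" where
  "dxi b \<phi> = dirderiv (b, 0) \<phi>"

definition lapx :: "('a::euclidean_space \<times> real \<Rightarrow> real) \<Rightarrow> 'a \<times> real \<Rightarrow> real" where
  "lapx \<phi> p = (\<Sum>b\<in>Basis. dxi b (dxi b \<phi>) p)"

text \<open>Weak solution of u_t - Lap u + |grad u|^q = 0 in Q = Omega x (0,T).
  u in C((0,T); L^1_loc(Omega)); u in L^1_loc((0,T); W^{1,1}_loc(Omega)) with weak spatial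
  gradient g; |g|^q in L^1_loc(Q); equation in the sense of distributions.\<close>
definition weak_solution :: "real \<Rightarrow> 'a::euclidean_space set \<Rightarrow> ereal \<Rightarrow> ('a \<Rightarrow> real \<Rightarrow> real) \<Rightarrow> bool" where
  "weak_solution q \<Omega> T u \<longleftrightarrow>
     (\<forall>K. compact K \<and> K \<subseteq> \<Omega> \<longrightarrow>
        (\<forall>t\<in>tint T. set_integrable lebesgue K (\<lambda>x. u x t)) \<and>
        (\<forall>t\<in>tint T. ((\<lambda>s. LINT x:K|lebesgue. \<bar>u x s - u x t\<bar>) \<longlongrightarrow> 0) (at t within tint T)))
   \<and> (\<exists>g :: 'a \<Rightarrow> real \<Rightarrow> 'a.
        (\<forall>C. compact C \<and> C \<subseteq> cyl \<Omega> T \<longrightarrow>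
            set_integrable lebesgue C (\<lambda>(x,t). u x t)
          \<and> set_integrable lebesgue C (\<lambda>(x,t). g x t)
          \<and> set_integrable lebesgue C (\<lambda>(x,t). norm (g x t) powr q))
      \<and> (\<forall>\<phi>. test_fun (cyl \<Omega> T) \<phi> \<longrightarrow>
            (\<forall>b\<in>Basis. (LINT p:cyl \<Omega> T|lebesgue. u (fst p) (snd p) * dxi b \<phi> p)
                       = - (LINT p:cyl \<Omega> T|lebesgue. (g (fst p) (snd p) \<bullet> b) * \<phi> p))
          \<and> (LINT p:cyl \<Omega> T|lebesgue.
                 - u (fst p) (snd p) * dt \<phi> p - u (fst p) (snd p) * lapx \<phi> p
                 + norm (g (fst p) (snd p)) powr q * \<phi> p) = 0))"

text \<open>Nonnegative Radon measure on Omega, represented as a Borel measure on the whole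
  space that vanishes outside Omega and is finite on compact subsets of Omega.\<close>
definition radon_on :: "'a::euclidean_space set \<Rightarrow> 'a measure \<Rightarrow> bool" where
  "radon_on \<Omega> \<mu> \<longleftrightarrow> sets \<mu> = sets borel \<and> emeasure \<mu> (UNIV - \<Omega>) = 0
     \<and> (\<forall>K. compact K \<and> K \<subseteq> \<Omega> \<longrightarrow> emeasure \<mu> K < \<infinity>)"

end

theory Submission
  imports Defs "HOL-Probability.Distributions"
begin

text \<open>
  Write F = |grad u|^q. For a test function phi on the domain, the mass X(t) = int u(t) phi satisfies
  X(t1) - X(t2) = int int (F phi - u Lap phi) over the times between t1 and t2, so everything rests
  on bounding X near t = 0.

  Take phi = exp(-1/d) with the depth d = 1 - |x - a|^2 / R^2. Its Laplacian is bounded below by a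
  positive multiple of phi/d^4 minus a multiple of phi, so the term with Lap phi has a good sign up to
  lower order. Since q is at most 1, F is at most 1 + |grad u|, and grad u is estimated in L^1
  linearly: testing with the Gaussian means W of a derivative of a test function theta, averaged over
  scales up to rho (a parametrix of the backward heat operator), gives, for a cutoff zeta,
  int int |grad u| zeta bounded by C/rho int int u zeta + C rho (int int F zeta + boundary terms) plus
  terms with derivatives of zeta. Cutting phi into pieces supported where d is comparable to 2^-k and
  using the scale rho = kappa 4^-k on the k-th piece, where each derivative of the piece costs a factor
  1/d^2, the sum over k bounds int int |grad u| phi by a small multiple of itself and of X(t1), X(t2),
  plus a multiple of int int u phi/d^2 that the Laplacian absorbs. A Gronwall-type argument then bounds
  X, hence the mass of u on compact sets. Consequently X(t) - C t is monotone for every nonnegative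
  test function, so X has a limit; density extends this to continuous functions with compact support,
  and the Riesz representation theorem yields the trace.
\<close>

section \<open>Smooth functions\<close>

lemma has_derivative_imp_dirderiv:
  assumes "(f has_derivative D) (at p)"
  shows "dirderiv v f p = D v"
proof -
  have "((\<lambda>s::real. p + s *\<^sub>R v) has_derivative (\<lambda>s. s *\<^sub>R v)) (at 0)"
    by (auto intro!: derivative_eq_intros)
  then have "((\<lambda>s. f (p + s *\<^sub>R v)) has_derivative (\<lambda>s. D (s *\<^sub>R v))) (at 0)"
    using has_derivative_compose[of "\<lambda>s::real. p + s *\<^sub>R v" _ 0 UNIV f D] assms by simp
  moreover have "D (s *\<^sub>R v) = D v * s" for s
    using assms by (simp add: has_derivative_def bounded_linear.linear linear_simps)
  ultimately have "((\<lambda>s. f (p + s *\<^sub>R v)) has_real_derivative D v) (at 0)"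
    by (simp add: has_field_derivative_def)
  then show ?thesis unfolding dirderiv_def by (rule DERIV_imp_deriv)
qed

lemma has_derivative_dirderiv:
  assumes "f differentiable (at p)"
  shows "(f has_derivative (\<lambda>v. dirderiv v f p)) (at p)"
proof -
  obtain D where D: "(f has_derivative D) (at p)" using assms unfolding differentiable_def ..
  then have "(\<lambda>v. dirderiv v f p) = D" by (simp add: has_derivative_imp_dirderiv[OF D])
  then show ?thesis using D by simp
qed

lemma linear_dirderiv: "f differentiable (at p) \<Longrightarrow> linear (\<lambda>v. dirderiv v f p)"
  by (rule has_derivative_linear[OF has_derivative_dirderiv])

lemma dirderiv_scaleR: "f differentiable (at p) \<Longrightarrow> dirderiv (c *\<^sub>R v) f p = c * dirderiv v f p"
  using linear_scale[OF linear_dirderiv] by (simp only: real_scaleR_def)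

lemma dirderiv_eq_sum_Basis:
  assumes "f differentiable (at p)"
  shows "dirderiv v f p = (\<Sum>b\<in>Basis. (v \<bullet> b) * dirderiv b f p)"
proof -
  have "dirderiv v f p = dirderiv (\<Sum>b\<in>Basis. (v \<bullet> b) *\<^sub>R b) f p"
    by (simp only: euclidean_representation)
  then show ?thesis
    by (simp only: linear_sum[OF linear_dirderiv[OF assms]] dirderiv_scaleR[OF assms])
qed

lemma dirderiv_const: "dirderiv v (\<lambda>x. c) = (\<lambda>x. 0)"
  by (rule ext, rule has_derivative_imp_dirderiv[where D="\<lambda>_. 0"]) simp

lemma dirderiv_inner_left: "dirderiv v (\<lambda>x. x \<bullet> a) = (\<lambda>x. v \<bullet> a)"
  by (rule ext, rule has_derivative_imp_dirderiv[where D="\<lambda>v. v \<bullet> a"])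
    (auto intro!: derivative_eq_intros)

lemma dirderiv_add:
  assumes "\<And>p. f differentiable (at p)" "\<And>p. g differentiable (at p)"
  shows "dirderiv v (\<lambda>x. f x + g x) = (\<lambda>x. dirderiv v f x + dirderiv v g x)"
  by (rule ext, rule has_derivative_imp_dirderiv[where D="\<lambda>v. dirderiv v f x + dirderiv v g x" for x])
    (auto intro!: derivative_eq_intros has_derivative_dirderiv assms)

lemma dirderiv_mult:
  assumes "\<And>p. f differentiable (at p)" "\<And>p. g differentiable (at p)"
  shows "dirderiv v (\<lambda>x. f x * g x) = (\<lambda>x. f x * dirderiv v g x + dirderiv v f x * g x)"
  by (rule ext, rule has_derivative_imp_dirderiv[where D="\<lambda>v. f x * dirderiv v g x + dirderiv v f x * g x" for x])
    (auto intro!: derivative_eq_intros has_derivative_dirderiv assms)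

lemma has_derivative_real_compose:
  assumes "f differentiable (at p)" "(g has_real_derivative g') (at (f p))"
  shows "((\<lambda>x. g (f x)) has_derivative (\<lambda>v. g' * dirderiv v f p)) (at p)"
  using has_derivative_compose[OF has_derivative_dirderiv[OF assms(1)]
      assms(2)[unfolded has_field_derivative_def]] by simp

lemma dirderiv_real_compose:
  assumes "\<And>p. f differentiable (at p)" "\<And>p. (g has_real_derivative g' (f p)) (at (f p))"
  shows "dirderiv v (\<lambda>x. g (f x)) = (\<lambda>x. g' (f x) * dirderiv v f x)"
  by (rule ext, rule has_derivative_imp_dirderiv[where D="\<lambda>v. g' (f x) * dirderiv v f x" for x],
      rule has_derivative_real_compose) (use assms in auto)

lemma DERIV_dirderiv_along_curve:
  assumes f: "f differentiable (at (c s))" and c: "(c has_vector_derivative c') (at s)"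
  shows "((\<lambda>s. f (c s)) has_real_derivative dirderiv c' f (c s)) (at s)"
proof -
  have "((\<lambda>s. f (c s)) has_derivative (\<lambda>r. dirderiv (r *\<^sub>R c') f (c s))) (at s)"
    using has_derivative_compose[OF c[unfolded has_vector_derivative_def] has_derivative_dirderiv[OF f]] .
  moreover have "(\<lambda>r. dirderiv (r *\<^sub>R c') f (c s)) = (*) (dirderiv c' f (c s))"
    by (simp add: fun_eq_iff dirderiv_scaleR[OF f])
  ultimately show ?thesis by (simp add: has_field_derivative_def)
qed

lemma dirderiv_iter_append: "dirderiv_iter (vs @ ws) f = dirderiv_iter vs (dirderiv_iter ws f)"
  by (induction vs) auto

lemma smooth_fun_dirderiv_iter: "smooth_fun f \<Longrightarrow> smooth_fun (dirderiv_iter vs f)"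
  unfolding smooth_fun_def by (metis dirderiv_iter_append)

lemma smooth_fun_dirderiv: "smooth_fun f \<Longrightarrow> smooth_fun (dirderiv v f)"
  using smooth_fun_dirderiv_iter[of f "[v]"] by simp

lemma smooth_fun_differentiable: "smooth_fun f \<Longrightarrow> f differentiable (at p)"
  unfolding smooth_fun_def by (metis dirderiv_iter.simps(1))

lemma smooth_fun_coinduct:
  assumes "S f" and "\<And>g p. S g \<Longrightarrow> g differentiable (at p)" and "\<And>g v. S g \<Longrightarrow> S (dirderiv v g)"
  shows "smooth_fun f"
proof -
  have "S (dirderiv_iter vs f)" for vs by (induction vs) (auto intro: assms)
  then show ?thesis unfolding smooth_fun_def by (blast intro: assms(2))
qed

lemma smooth_fun_continuous_on: "smooth_fun f \<Longrightarrow> continuous_on S f"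
  by (intro continuous_at_imp_continuous_on ballI differentiable_imp_continuous_within
      smooth_fun_differentiable)

definition flat_exp :: "nat \<Rightarrow> real \<Rightarrow> real" where
  "flat_exp n x = (if x \<le> 0 then 0 else exp (- 1 / x) / x ^ n)"

lemma flat_exp_nonneg: "0 \<le> flat_exp n x"
  by (simp add: flat_exp_def)

lemma flat_exp_pos_iff: "0 < flat_exp n x \<longleftrightarrow> 0 < x"
  by (auto simp: flat_exp_def)

lemma flat_exp_0_mono: "x \<le> y \<Longrightarrow> flat_exp 0 x \<le> flat_exp 0 y"
  by (auto simp: flat_exp_def frac_le)

lemma flat_exp_le_square: "flat_exp n x \<le> fact (n + 2) * x\<^sup>2"
proof (cases "x \<le> 0")
  case True then show ?thesis by (simp add: flat_exp_def)
next
  case False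
  have "(\<Sum>k\<in>{n+2}. (1 / x) ^ k /\<^sub>R fact k) \<le> (\<Sum>k. (1 / x) ^ k /\<^sub>R fact k)"
    by (rule sum_le_suminf[OF summable_exp_generic]) (use False in auto)
  then have "(1 / x) ^ (n + 2) / fact (n + 2) \<le> exp (1 / x)"
    by (simp add: exp_def divide_inverse_commute)
  then have "1 / x ^ (n + 2) \<le> fact (n + 2) * exp (1 / x)"
    unfolding pos_divide_le_eq[OF fact_gt_zero] power_one_over by (simp only: mult.commute)
  then have "x\<^sup>2 * exp (- 1 / x) * (1 / x ^ (n + 2)) \<le> x\<^sup>2 * exp (- 1 / x) * (fact (n + 2) * exp (1 / x))"
    by (rule mult_left_mono) simp
  also have "\<dots> = fact (n + 2) * x\<^sup>2"
    by (simp add: mult.left_commute[of "exp _"] flip: exp_add)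
  finally show ?thesis using False by (simp add: flat_exp_def power2_eq_square)
qed

lemma DERIV_flat_exp_0: "(flat_exp n has_real_derivative 0) (at 0)"
proof -
  have "((\<lambda>h. flat_exp n h / h) \<longlongrightarrow> 0) (at 0)"
  proof (rule Lim_null_comparison)
    have "norm (flat_exp n h / h) \<le> fact (n + 2) * \<bar>h\<bar>" for h
    proof (cases "h = 0")
      case False
      have "flat_exp n h / \<bar>h\<bar> \<le> (fact (n + 2) * \<bar>h\<bar>\<^sup>2) / \<bar>h\<bar>"
        by (rule divide_right_mono) (use flat_exp_le_square[of n h] in auto)
      also have "\<dots> = fact (n + 2) * \<bar>h\<bar>"
        using False by (simp only: power2_eq_square times_divide_eq_right[symmetric]) simp
      finally show ?thesis by (simp add: flat_exp_nonneg)
    qed simp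
    then show "\<forall>\<^sub>F h in at 0. norm (flat_exp n h / h) \<le> fact (n + 2) * \<bar>h\<bar>" by simp
    show "((\<lambda>h. fact (n + 2) * \<bar>h\<bar>) \<longlongrightarrow> (0::real)) (at 0)" by (auto intro!: tendsto_eq_intros)
  qed
  then show ?thesis by (simp add: DERIV_def flat_exp_def)
qed

lemma DERIV_flat_exp:
  "(flat_exp n has_real_derivative (flat_exp (n + 2) x - n * flat_exp (n + 1) x)) (at x)"
proof (cases x "0::real" rule: linorder_cases)
  case less
  have "(flat_exp n has_real_derivative 0) (at x)"
    by (rule has_field_derivative_transform_within_open[where f="\<lambda>_. 0" and S="{..<0}"])
      (use less in \<open>auto simp: flat_exp_def\<close>)
  then show ?thesis using less by (simp add: flat_exp_def)
next
  case equal
  then show ?thesis using DERIV_flat_exp_0 by (simp add: flat_exp_def)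
next
  case greater
  have "((\<lambda>x. exp (- 1 / x)) has_real_derivative exp (- 1 / x) * (inverse x)\<^sup>2) (at x)"
    using greater by (auto intro!: derivative_eq_intros simp: power2_eq_square field_simps)
  moreover have "((\<lambda>x. inverse x ^ n) has_real_derivative - (real n * inverse x ^ (n + 1))) (at x)"
    using DERIV_power[OF DERIV_inverse, of x n UNIV] greater
    by (cases n) (auto simp: power2_eq_square mult.assoc)
  ultimately have "((\<lambda>x. exp (- 1 / x) / x ^ n) has_real_derivative
     (exp (- 1 / x) / x ^ (n + 2) - n * (exp (- 1 / x) / x ^ (n + 1)))) (at x)"
    using DERIV_mult greater by (fastforce simp: field_simps power2_eq_square)
  then have "(flat_exp n has_real_derivative
     (exp (- 1 / x) / x ^ (n + 2) - n * (exp (- 1 / x) / x ^ (n + 1)))) (at x)"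
    by (rule has_field_derivative_transform_within_open[where S="{0<..}"])
      (use greater in \<open>auto simp: flat_exp_def\<close>)
  then show ?thesis using greater by (simp add: flat_exp_def)
qed

text \<open>This class is closed under directional derivatives and hence consists of smooth functions.\<close>

inductive smooth_closure :: "('a::euclidean_space \<Rightarrow> real) \<Rightarrow> bool" where
  base: "smooth_fun f \<Longrightarrow> smooth_closure f"
| const: "smooth_closure (\<lambda>x. c)"
| inner: "smooth_closure (\<lambda>x. x \<bullet> a)"
| add: "smooth_closure f \<Longrightarrow> smooth_closure g \<Longrightarrow> smooth_closure (\<lambda>x. f x + g x)"
| mult: "smooth_closure f \<Longrightarrow> smooth_closure g \<Longrightarrow> smooth_closure (\<lambda>x. f x * g x)"
| flat_exp: "smooth_closure f \<Longrightarrow> smooth_closure (\<lambda>x. flat_exp n (f x))"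
| inverse: "smooth_closure f \<Longrightarrow> (\<And>x. f x \<noteq> 0) \<Longrightarrow> smooth_closure (\<lambda>x. inverse (f x))"

lemma smooth_closure_real_compose:
  assumes f: "\<And>p. f differentiable (at p)" "smooth_closure (dirderiv v f)"
    and g: "\<And>p. (g has_real_derivative g' (f p)) (at (f p))" "smooth_closure (\<lambda>x. g' (f x))"
  shows "(\<lambda>x. g (f x)) differentiable (at p)" "smooth_closure (dirderiv v (\<lambda>x. g (f x)))"
proof -
  show "(\<lambda>x. g (f x)) differentiable (at p)"
    using has_derivative_real_compose[OF f(1) g(1)] unfolding differentiable_def by blast
  show "smooth_closure (dirderiv v (\<lambda>x. g (f x)))"
    unfolding dirderiv_real_compose[where g=g and g'=g', OF f(1) g(1)] by (rule smooth_closure.mult[OF g(2) f(2)])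
qed

lemma smooth_closure_dirderiv:
  "smooth_closure f \<Longrightarrow> f differentiable (at p) \<and> smooth_closure (dirderiv v f)"
proof (induction arbitrary: p v rule: smooth_closure.induct)
  case (base f)
  then show ?case
    by (auto intro: smooth_closure.base smooth_fun_dirderiv smooth_fun_differentiable)
next
  case (const c)
  then show ?case by (auto simp: dirderiv_const intro: smooth_closure.const)
next
  case (inner a)
  then show ?case
    by (auto simp: dirderiv_inner_left intro!: smooth_closure.const
        bounded_linear_imp_differentiable bounded_linear_inner_left)
next
  case (add f g)
  then show ?case by (simp add: dirderiv_add smooth_closure.add)
next
  case (mult f g)
  then show ?case by (simp add: dirderiv_mult smooth_closure.intros)
next
  case (flat_exp f n)
  have "smooth_closure (\<lambda>x. flat_exp (n + 2) (f x) + (- real n) * flat_exp (n + 1) (f x))"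
    by (intro smooth_closure.intros flat_exp.hyps)
  then have "smooth_closure (\<lambda>x. flat_exp (n + 2) (f x) - n * flat_exp (n + 1) (f x))" by simp
  then show ?case
    using smooth_closure_real_compose[where f=f and g="flat_exp n", OF _ _ DERIV_flat_exp] flat_exp.IH
    by blast
next
  case (inverse f)
  have "(inverse has_real_derivative (- 1) * (inverse (f p) * inverse (f p))) (at (f p))" for p
    using DERIV_inverse[of "f p" UNIV] inverse.hyps by (simp add: power2_eq_square)
  moreover have "smooth_closure (\<lambda>x. (- 1) * (inverse (f x) * inverse (f x)))"
    by (intro smooth_closure.mult smooth_closure.const smooth_closure.inverse inverse.hyps)
  ultimately show ?case
    using smooth_closure_real_compose[where f=f and g=inverse and g'="\<lambda>y. (- 1) * (inverse y * inverse y)"]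
      inverse.IH by blast
qed

lemma smooth_fun_iff_smooth_closure: "smooth_fun f \<longleftrightarrow> smooth_closure f"
  using smooth_fun_coinduct[of smooth_closure] smooth_closure_dirderiv smooth_closure.base by blast

lemmas smooth_fun_const = smooth_closure.const[folded smooth_fun_iff_smooth_closure]
  and smooth_fun_inner_left = smooth_closure.inner[folded smooth_fun_iff_smooth_closure]
  and smooth_fun_add = smooth_closure.add[folded smooth_fun_iff_smooth_closure]
  and smooth_fun_mult = smooth_closure.mult[folded smooth_fun_iff_smooth_closure]
  and smooth_fun_flat_exp = smooth_closure.flat_exp[folded smooth_fun_iff_smooth_closure]
  and smooth_fun_inverse = smooth_closure.inverse[folded smooth_fun_iff_smooth_closure]

lemma smooth_fun_diff: "smooth_fun f \<Longrightarrow> smooth_fun g \<Longrightarrow> smooth_fun (\<lambda>x. f x - g x)"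
  using smooth_fun_add[OF _ smooth_fun_mult[OF smooth_fun_const[of "-1"]]] by simp

lemma smooth_fun_sum: "(\<And>i. i \<in> I \<Longrightarrow> smooth_fun (f i)) \<Longrightarrow> smooth_fun (\<lambda>x. \<Sum>i\<in>I. f i x)"
  by (induction I rule: infinite_finite_induct) (auto simp: smooth_fun_const smooth_fun_add)

lemma smooth_fun_ident: "smooth_fun (\<lambda>x::real. x)"
  using smooth_fun_inner_left[of "1::real"] by simp

lemmas smooth_fun_intros = smooth_fun_const smooth_fun_inner_left smooth_fun_ident smooth_fun_add
  smooth_fun_diff smooth_fun_mult smooth_fun_flat_exp smooth_fun_sum

lemma real_polynomial_function_smooth: "real_polynomial_function p \<Longrightarrow> smooth_fun p"
proof (induction rule: real_polynomial_function.induct)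
  case (linear f)
  have "f = (\<lambda>x. x \<bullet> adjoint f 1)"
    using adjoint_works[OF bounded_linear.linear[OF linear], of _ 1] by auto
  then show ?case using smooth_fun_inner_left[of "adjoint f 1"] by simp
qed (auto intro: smooth_fun_intros)

lemma
  assumes f: "smooth_fun f" and L: "bounded_linear L"
  shows smooth_fun_linear_compose: "smooth_fun (\<lambda>x. f (L x))"
    and dirderiv_linear_compose: "dirderiv v (\<lambda>x. f (L x)) = (\<lambda>x. dirderiv (L v) f (L x))"
proof -
  have deriv: "((\<lambda>x. g (L x)) has_derivative (\<lambda>v. dirderiv (L v) g (L p))) (at p)"
    if "smooth_fun g" for g p
    using has_derivative_compose[OF bounded_linear_imp_has_derivative[OF L]
        has_derivative_dirderiv[OF smooth_fun_differentiable[OF that]]] .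
  have dirderiv: "dirderiv v (\<lambda>x. g (L x)) = (\<lambda>x. dirderiv (L v) g (L x))" if "smooth_fun g" for g v
    by (rule ext, rule has_derivative_imp_dirderiv[OF deriv[OF that]])
  show "dirderiv v (\<lambda>x. f (L x)) = (\<lambda>x. dirderiv (L v) f (L x))" by (rule dirderiv[OF f])
  show "smooth_fun (\<lambda>x. f (L x))"
  proof (rule smooth_fun_coinduct[where S="\<lambda>h. \<exists>g. smooth_fun g \<and> h = (\<lambda>x. g (L x))"])
    show "\<exists>g. smooth_fun g \<and> (\<lambda>x. f (L x)) = (\<lambda>x. g (L x))" using f by blast
  next
    fix h v assume "\<exists>g. smooth_fun g \<and> h = (\<lambda>x. g (L x))"
    then obtain g where "smooth_fun g" "h = (\<lambda>x. g (L x))" by blast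
    then show "\<exists>g. smooth_fun g \<and> dirderiv v h = (\<lambda>x. g (L x))"
      using dirderiv smooth_fun_dirderiv[of g "L v"] by blast
  qed (use deriv in \<open>auto simp: differentiable_def\<close>)
qed

lemma
  assumes f: "smooth_fun (f :: real \<Rightarrow> real)"
  shows smooth_fun_DERIV: "(f has_real_derivative deriv f x) (at x)"
    and dirderiv_1_eq_deriv: "dirderiv 1 f = deriv f"
proof -
  have DERIV: "(f has_real_derivative dirderiv 1 f x) (at x)" for x
  proof -
    have "(\<lambda>v. dirderiv v f x) = (*) (dirderiv 1 f x)"
    proof
      show "dirderiv v f x = dirderiv 1 f x * v" for v
        using dirderiv_scaleR[OF smooth_fun_differentiable[OF f], of v 1 x]
        by (simp only: real_scaleR_def mult_1_right mult.commute[of v])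
    qed
    then show ?thesis
      using has_derivative_dirderiv[OF smooth_fun_differentiable[OF f], of x]
      by (simp add: has_field_derivative_def)
  qed
  show "dirderiv 1 f = deriv f" by (rule ext, rule DERIV_imp_deriv[OF DERIV, symmetric])
  then show "(f has_real_derivative deriv f x) (at x)" using DERIV by simp
qed

lemma smooth_fun_deriv: "smooth_fun f \<Longrightarrow> smooth_fun (deriv f)"
  using smooth_fun_dirderiv[of f 1] by (simp add: dirderiv_1_eq_deriv)

definition smooth_step :: "real \<Rightarrow> real" where
  "smooth_step y = flat_exp 0 (y - 1 / 2) * inverse (flat_exp 0 (y - 1 / 2) + flat_exp 0 (1 - y))"

lemma smooth_step_denominator_pos: "0 < flat_exp 0 (y - 1 / 2) + flat_exp 0 (1 - y)"
  using flat_exp_nonneg[of 0 "y - 1/2"] flat_exp_nonneg[of 0 "1 - y"]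
    flat_exp_pos_iff[of 0 "y - 1/2"] flat_exp_pos_iff[of 0 "1 - y"]
  by (cases "y < 1") (auto intro: add_pos_nonneg add_nonneg_pos)

lemma smooth_fun_smooth_step:
  assumes "smooth_fun f"
  shows "smooth_fun (\<lambda>x. smooth_step (f x))"
  unfolding smooth_step_def
  by (intro smooth_fun_mult smooth_fun_inverse smooth_fun_intros assms
      less_imp_neq[OF smooth_step_denominator_pos, symmetric])

lemma smooth_step_smooth: "smooth_fun smooth_step"
  using smooth_fun_smooth_step[OF smooth_fun_ident] by simp

lemma smooth_step_eq_0: "y \<le> 1 / 2 \<Longrightarrow> smooth_step y = 0"
  by (simp add: smooth_step_def flat_exp_def)

lemma smooth_step_eq_1: "1 \<le> y \<Longrightarrow> smooth_step y = 1"
  by (simp add: smooth_step_def flat_exp_def)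

lemma mono_smooth_step: "mono smooth_step"
proof (rule monoI)
  fix x y :: real assume "x \<le> y"
  then have "flat_exp 0 (x - 1/2) * flat_exp 0 (1 - y) \<le> flat_exp 0 (y - 1/2) * flat_exp 0 (1 - x)"
    by (intro mult_mono flat_exp_0_mono flat_exp_nonneg) auto
  then show "smooth_step x \<le> smooth_step y"
    unfolding smooth_step_def divide_inverse[symmetric]
    using smooth_step_denominator_pos[of x] smooth_step_denominator_pos[of y]
    by (simp add: pos_divide_le_eq pos_le_divide_eq algebra_simps)
qed

lemma smooth_step_bounds: "0 \<le> smooth_step y" "smooth_step y \<le> 1"
  using monoD[OF mono_smooth_step, of "min y 0" y] monoD[OF mono_smooth_step, of y "max y 1"]
    smooth_step_eq_0[of "min y 0"] smooth_step_eq_1[of "max y 1"] by simp_all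

lemma DERIV_smooth_step: "(smooth_step has_real_derivative deriv smooth_step x) (at x)"
  by (rule smooth_fun_DERIV[OF smooth_step_smooth])

lemma deriv_smooth_step_nonneg: "0 \<le> deriv smooth_step x"
  by (rule mono_on_imp_deriv_nonneg[OF _ DERIV_smooth_step, of UNIV])
    (use mono_smooth_step in auto)

lemma deriv_smooth_step_eq_0:
  assumes "x \<le> 1 / 2 \<or> 1 \<le> x"
  shows "deriv smooth_step x = 0"
  using assms
proof
  assume "x \<le> 1 / 2"
  then show ?thesis
    by (intro DERIV_local_min[OF DERIV_smooth_step zero_less_one]) (simp add: smooth_step_eq_0 smooth_step_bounds)
next
  assume "1 \<le> x"
  then show ?thesis
    by (intro DERIV_local_max[OF DERIV_smooth_step zero_less_one]) (simp add: smooth_step_eq_1 smooth_step_bounds)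
qed

section \<open>Test functions\<close>

definition supported_in :: "'a::topological_space set \<Rightarrow> ('a \<Rightarrow> real) \<Rightarrow> bool" where
  "supported_in U f \<longleftrightarrow> (\<exists>K. compact K \<and> K \<subseteq> U \<and> (\<forall>x. x \<notin> K \<longrightarrow> f x = 0))"

lemma supported_inE:
  assumes "supported_in U f"
  obtains K where "compact K" "K \<subseteq> U" "\<And>x. x \<notin> K \<Longrightarrow> f x = 0"
  using assms that unfolding supported_in_def by blast

lemma supported_inI: "compact K \<Longrightarrow> K \<subseteq> U \<Longrightarrow> (\<And>x. x \<notin> K \<Longrightarrow> f x = 0) \<Longrightarrow> supported_in U f"
  unfolding supported_in_def by blast

lemma not_in_tsupport: "x \<notin> tsupport f \<Longrightarrow> f x = 0"
  unfolding tsupport_def using closure_subset[of "{x. f x \<noteq> 0}"] by blast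

lemma supported_in_iff_tsupport:
  fixes f :: "'a::t2_space \<Rightarrow> real"
  shows "supported_in U f \<longleftrightarrow> compact (tsupport f) \<and> tsupport f \<subseteq> U"
proof
  assume "supported_in U f"
  then obtain K where K: "compact K" "K \<subseteq> U" "\<And>x. x \<notin> K \<Longrightarrow> f x = 0" by (rule supported_inE) blast
  then have "tsupport f \<subseteq> K"
    unfolding tsupport_def by (intro closure_minimal) (auto simp: compact_imp_closed)
  moreover have "closed (tsupport f)" by (simp add: tsupport_def)
  ultimately show "compact (tsupport f) \<and> tsupport f \<subseteq> U"
    using K compact_Int_closed[of K "tsupport f"] by (auto simp: Int_absorb1)
qed (auto intro: supported_inI not_in_tsupport)

lemma test_fun_iff: "test_fun U f \<longleftrightarrow> smooth_fun f \<and> supported_in U f"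
  by (simp add: test_fun_def supported_in_iff_tsupport)

lemma Cc_fun_iff: "Cc_fun U f \<longleftrightarrow> continuous_on UNIV f \<and> supported_in U f"
  by (simp add: Cc_fun_def supported_in_iff_tsupport)

lemma supported_in_eq_0: "supported_in U f \<Longrightarrow> x \<notin> U \<Longrightarrow> f x = 0"
  unfolding supported_in_def by blast

lemma supported_in_mono: "supported_in U f \<Longrightarrow> U \<subseteq> V \<Longrightarrow> supported_in V f"
  unfolding supported_in_def by blast

lemma supported_in_dominated: "supported_in U f \<Longrightarrow> (\<And>x. f x = 0 \<Longrightarrow> g x = 0) \<Longrightarrow> supported_in U g"
  unfolding supported_in_def by blast

lemma supported_in_zero: "supported_in U (\<lambda>x. 0)"
  by (rule supported_inI[of "{}"]) auto

lemma supported_in_add: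
  assumes "supported_in U f" "supported_in U g"
  shows "supported_in U (\<lambda>x. f x + g x)"
proof -
  obtain K L where "compact K" "K \<subseteq> U" "\<And>x. x \<notin> K \<Longrightarrow> f x = 0"
    "compact L" "L \<subseteq> U" "\<And>x. x \<notin> L \<Longrightarrow> g x = 0"
    using assms unfolding supported_in_def by metis
  then show ?thesis by (intro supported_inI[of "K \<union> L"]) auto
qed

lemma supported_in_dirderiv:
  assumes "supported_in U f"
  shows "supported_in U (dirderiv v f)"
proof -
  obtain K where K: "compact K" "K \<subseteq> U" "\<And>x. x \<notin> K \<Longrightarrow> f x = 0" using assms by (rule supported_inE) blast
  have "dirderiv v f x = 0" if "x \<notin> K" for x
  proof (rule has_derivative_imp_dirderiv)
    show "(f has_derivative (\<lambda>_. 0)) (at x)"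
      by (rule has_derivative_transform_within_open[where f="\<lambda>_. 0" and s="- K"])
        (use that K in \<open>auto simp: compact_imp_closed\<close>)
  qed
  with K(1,2) show ?thesis by (rule supported_inI)
qed

lemma test_fun_smooth: "test_fun U f \<Longrightarrow> smooth_fun f"
  by (simp add: test_fun_def)

lemma test_fun_differentiable: "test_fun U f \<Longrightarrow> f differentiable (at p)"
  by (rule smooth_fun_differentiable[OF test_fun_smooth])

lemma test_fun_mono: "test_fun U f \<Longrightarrow> U \<subseteq> V \<Longrightarrow> test_fun V f"
  by (auto simp: test_fun_def)

lemma test_fun_zero: "test_fun U (\<lambda>x. 0)"
  by (simp add: test_fun_iff smooth_fun_const supported_in_zero)

lemma test_fun_mult: "test_fun U f \<Longrightarrow> smooth_fun g \<Longrightarrow> test_fun U (\<lambda>x. f x * g x)"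
  by (auto simp: test_fun_iff intro: smooth_fun_mult supported_in_dominated)

lemma test_fun_cmult: "test_fun U f \<Longrightarrow> test_fun U (\<lambda>x. c * f x)"
  using test_fun_mult[OF _ smooth_fun_const[of c]] by (simp add: mult.commute)

lemma test_fun_add: "test_fun U f \<Longrightarrow> test_fun U g \<Longrightarrow> test_fun U (\<lambda>x. f x + g x)"
  by (auto simp: test_fun_iff intro: smooth_fun_add supported_in_add)

lemma test_fun_sum: "(\<And>i. i \<in> I \<Longrightarrow> test_fun U (f i)) \<Longrightarrow> test_fun U (\<lambda>x. \<Sum>i\<in>I. f i x)"
  by (induction I rule: infinite_finite_induct) (auto simp: test_fun_zero test_fun_add)

lemma test_fun_dirderiv: "test_fun U f \<Longrightarrow> test_fun U (dirderiv v f)"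
  by (simp add: test_fun_iff smooth_fun_dirderiv supported_in_dirderiv)

lemma test_fun_imp_Cc_fun: "test_fun U f \<Longrightarrow> Cc_fun U f"
  by (simp add: test_fun_iff Cc_fun_iff smooth_fun_continuous_on)

lemma Cc_fun_continuous_on: "Cc_fun U f \<Longrightarrow> continuous_on S f"
  unfolding Cc_fun_def using continuous_on_subset[of UNIV f S] by auto

lemma Cc_fun_measurable: "Cc_fun U f \<Longrightarrow> f \<in> borel_measurable borel"
  by (rule borel_measurable_continuous_onI[OF Cc_fun_continuous_on])

lemma Cc_fun_mono: "Cc_fun U f \<Longrightarrow> U \<subseteq> V \<Longrightarrow> Cc_fun V f"
  by (auto simp: Cc_fun_def)

lemma Cc_fun_dominated:
  "Cc_fun U f \<Longrightarrow> continuous_on UNIV g \<Longrightarrow> (\<And>x. f x = 0 \<Longrightarrow> g x = 0) \<Longrightarrow> Cc_fun U g"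
  by (auto simp: Cc_fun_iff intro: supported_in_dominated)

lemma Cc_fun_zero: "Cc_fun U (\<lambda>x. 0)"
  by (simp add: Cc_fun_iff supported_in_zero)

lemma Cc_fun_add: "Cc_fun U f \<Longrightarrow> Cc_fun U g \<Longrightarrow> Cc_fun U (\<lambda>x. f x + g x)"
  by (auto simp: Cc_fun_iff intro: continuous_on_add supported_in_add)

lemma Cc_fun_cmult: "Cc_fun U f \<Longrightarrow> Cc_fun U (\<lambda>x. c * f x)"
  by (auto simp: Cc_fun_iff intro: continuous_on_mult_left supported_in_dominated)

lemma Cc_fun_abs: "Cc_fun U f \<Longrightarrow> Cc_fun U (\<lambda>x. \<bar>f x\<bar>)"
  by (auto simp: Cc_fun_iff intro: continuous_on_rabs supported_in_dominated)

lemma Cc_fun_sum: "(\<And>i. i \<in> I \<Longrightarrow> Cc_fun U (f i)) \<Longrightarrow> Cc_fun U (\<lambda>x. \<Sum>i\<in>I. f i x)"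
  by (induction I rule: infinite_finite_induct) (auto simp: Cc_fun_zero Cc_fun_add)

lemma Cc_fun_bounded:
  assumes "Cc_fun U f"
  obtains B where "0 < B" "\<And>x. \<bar>f x\<bar> \<le> B"
proof -
  have "compact (f ` tsupport f)"
    using assms by (intro compact_continuous_image Cc_fun_continuous_on) (auto simp: Cc_fun_def)
  then obtain B where B: "0 < B" "\<And>y. y \<in> f ` tsupport f \<Longrightarrow> \<bar>y\<bar> \<le> B"
    using bounded_pos[of "f ` tsupport f"] compact_imp_bounded[of "f ` tsupport f"] by auto
  have "\<bar>f x\<bar> \<le> B" for x
    by (cases "x \<in> tsupport f") (use B not_in_tsupport[of x f] in auto)
  then show ?thesis using B(1) that by blast
qed

lemma test_fun_bounded:
  assumes "test_fun U f"
  obtains B where "0 < B" "\<And>x. \<bar>f x\<bar> \<le> B"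
  using Cc_fun_bounded[OF test_fun_imp_Cc_fun[OF assms]] by blast

definition ball_depth :: "'a::euclidean_space \<Rightarrow> real \<Rightarrow> 'a \<Rightarrow> real" where
  "ball_depth a R x = 1 - (x - a) \<bullet> (x - a) / R\<^sup>2"

definition ball_bump :: "nat \<Rightarrow> 'a::euclidean_space \<Rightarrow> real \<Rightarrow> 'a \<Rightarrow> real" where
  "ball_bump n a R x = flat_exp n (ball_depth a R x)"

lemma ball_depth_le_1: "ball_depth a R x \<le> 1"
  by (simp add: ball_depth_def)

lemma ball_depth_pos_iff: "0 < R \<Longrightarrow> 0 < ball_depth a R x \<longleftrightarrow> dist a x < R"
  using power_mono_iff[of R "norm (x - a)" 2]
  by (simp add: ball_depth_def dist_norm norm_minus_commute[of a x] power2_norm_eq_inner[symmetric] flip: not_le)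

lemma smooth_fun_ball_depth: "smooth_fun (ball_depth a R)"
proof -
  have "ball_depth a R x = 1 - (\<Sum>b\<in>Basis. (x \<bullet> b - a \<bullet> b) * (x \<bullet> b - a \<bullet> b)) * (1 / R\<^sup>2)" for x
    unfolding ball_depth_def by (subst euclidean_inner) (simp add: inner_diff_left)
  then have "ball_depth a R = (\<lambda>x. 1 - (\<Sum>b\<in>Basis. (x \<bullet> b - a \<bullet> b) * (x \<bullet> b - a \<bullet> b)) * (1 / R\<^sup>2))"
    by (rule ext)
  then show ?thesis by (simp only:) (intro smooth_fun_intros)
qed

lemma smooth_fun_ball_bump: "smooth_fun (ball_bump n a R)"
  unfolding ball_bump_def[abs_def] by (intro smooth_fun_flat_exp smooth_fun_ball_depth)

lemma ball_bump_nonneg: "0 \<le> ball_bump n a R x"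
  by (simp add: ball_bump_def flat_exp_nonneg)

lemma ball_bump_pos_iff: "0 < R \<Longrightarrow> 0 < ball_bump n a R x \<longleftrightarrow> dist a x < R"
  by (simp add: ball_bump_def flat_exp_pos_iff ball_depth_pos_iff)

lemma ball_bump_eq_0: "0 < R \<Longrightarrow> x \<notin> cball a R \<Longrightarrow> ball_bump n a R x = 0"
  using ball_bump_pos_iff[of R n a x] ball_bump_nonneg[of n a R x] by (simp add: less_le)

lemma test_fun_ball_bump: "0 < R \<Longrightarrow> cball a R \<subseteq> U \<Longrightarrow> test_fun U (ball_bump n a R)"
  unfolding test_fun_iff
  by (auto intro!: smooth_fun_ball_bump supported_inI[of "cball a R"] ball_bump_eq_0)

lemma continuous_pos_imp_ge_on_compact:
  fixes f :: "'a::topological_space \<Rightarrow> real"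
  assumes "compact K" "continuous_on K f" "\<And>x. x \<in> K \<Longrightarrow> 0 < f x"
  obtains m where "0 < m" "\<And>x. x \<in> K \<Longrightarrow> m \<le> f x"
proof (cases "K = {}")
  case True
  then show ?thesis using that[of 1] by simp
next
  case False
  then show ?thesis using continuous_attains_inf[OF assms(1) _ assms(2)] assms(3) that by blast
qed

lemma ball_bumps_ge_1_on_compact:
  fixes K :: "'a::euclidean_space set"
  assumes K: "compact K" "K \<subseteq> U" and U: "open U"
  obtains A r c where "finite A" "\<And>a. a \<in> A \<Longrightarrow> 0 < r a \<and> cball a (r a) \<subseteq> U" "0 < c"
    "\<And>x. x \<in> K \<Longrightarrow> 1 \<le> c * (\<Sum>a\<in>A. ball_bump 0 a (r a) x)"
proof -
  have "\<forall>x\<in>K. \<exists>r>0. cball x r \<subseteq> U" using K(2) U open_contains_cball by blast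
  then obtain r where r: "\<And>x. x \<in> K \<Longrightarrow> 0 < r x \<and> cball x (r x) \<subseteq> U" by metis
  obtain A where A: "A \<subseteq> K" "finite A" "K \<subseteq> (\<Union>x\<in>A. ball x (r x))"
    by (rule compactE_image[OF K(1), of K "\<lambda>x. ball x (r x)"]) (use r in force)+
  let ?s = "\<lambda>x. \<Sum>a\<in>A. ball_bump 0 a (r a) x"
  have pos: "0 < ?s x" if "x \<in> K" for x
  proof -
    obtain a where "a \<in> A" "dist a x < r a" using A(3) \<open>x \<in> K\<close> by auto
    then show ?thesis
      using A r by (intro sum_pos2[of A a] ball_bump_nonneg) (auto simp: ball_bump_pos_iff)
  qed
  have "continuous_on K ?s"
    by (intro smooth_fun_continuous_on smooth_fun_sum smooth_fun_ball_bump)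
  then obtain m where m: "0 < m" "\<And>x. x \<in> K \<Longrightarrow> m \<le> ?s x"
    using continuous_pos_imp_ge_on_compact[OF K(1)] pos by blast
  show ?thesis
    by (rule that[of A r "1 / m"]) (use A r m in auto)
qed

lemma test_fun_cutoff:
  fixes K :: "'a::euclidean_space set"
  assumes K: "compact K" "K \<subseteq> U" and U: "open U"
  obtains \<eta> V where "test_fun U \<eta>" "\<And>x. 0 \<le> \<eta> x" "\<And>x. \<eta> x \<le> 1"
    "open V" "K \<subseteq> V" "\<And>x. x \<in> V \<Longrightarrow> \<eta> x = 1"
proof -
  obtain A r c where A: "finite A" "\<And>a. a \<in> A \<Longrightarrow> 0 < r a \<and> cball a (r a) \<subseteq> U"
    and c: "0 < c" "\<And>x. x \<in> K \<Longrightarrow> 1 \<le> c * (\<Sum>a\<in>A. ball_bump 0 a (r a) x)"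
    using ball_bumps_ge_1_on_compact[OF K U] by blast
  define h where "h x = 2 * c * (\<Sum>a\<in>A. ball_bump 0 a (r a) x)" for x
  have h: "test_fun U h"
    unfolding h_def by (intro test_fun_cmult test_fun_sum test_fun_ball_bump) (use A in auto)
  show ?thesis
  proof (rule that[of "\<lambda>x. smooth_step (h x)" "{x. 1 < h x}"])
    show "test_fun U (\<lambda>x. smooth_step (h x))"
      using h by (auto simp: test_fun_iff smooth_step_eq_0 intro: smooth_fun_smooth_step supported_in_dominated)
    show "open {x. 1 < h x}"
      by (intro open_Collect_less continuous_intros smooth_fun_continuous_on test_fun_smooth[OF h])
    show "K \<subseteq> {x. 1 < h x}"
    proof
      show "x \<in> {x. 1 < h x}" if "x \<in> K" for x using c(2)[OF that] by (simp add: h_def)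
    qed
  qed (auto simp: smooth_step_bounds smooth_step_eq_1)
qed

lemma test_fun_dense:
  fixes \<psi> :: "'a::euclidean_space \<Rightarrow> real"
  assumes \<psi>: "Cc_fun U \<psi>" and U: "open U" and e: "0 < e"
  obtains \<theta> where "test_fun U \<theta>" "\<And>x. \<bar>\<theta> x - \<psi> x\<bar> \<le> e"
proof -
  have "compact (tsupport \<psi>)" "tsupport \<psi> \<subseteq> U" using \<psi> by (auto simp: Cc_fun_def)
  then obtain \<eta> V where \<eta>: "test_fun U \<eta>" "\<And>x. 0 \<le> \<eta> x" "\<And>x. \<eta> x \<le> 1"
    and V: "open V" "tsupport \<psi> \<subseteq> V" "\<And>x. x \<in> V \<Longrightarrow> \<eta> x = 1"
    by (rule test_fun_cutoff[OF _ _ U]) blast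
  have \<eta>\<psi>: "\<eta> x * \<psi> x = \<psi> x" for x
    using V(2) V(3)[of x] not_in_tsupport[of x \<psi>] by (cases "x \<in> tsupport \<psi>") auto
  have compact: "compact (tsupport \<eta>)" using \<eta>(1) by (simp add: test_fun_def)
  obtain p where p: "polynomial_function p" "\<And>x. x \<in> tsupport \<eta> \<Longrightarrow> \<bar>\<psi> x - p x\<bar> < e"
    using Stone_Weierstrass_polynomial_function[OF compact Cc_fun_continuous_on[OF \<psi>] e] by auto
  show ?thesis
  proof (rule that[of "\<lambda>x. \<eta> x * p x"])
    show "test_fun U (\<lambda>x. \<eta> x * p x)"
      using p(1) by (intro test_fun_mult \<eta>(1) real_polynomial_function_smooth)
        (simp add: real_polynomial_function_eq)
    show "\<bar>\<eta> x * p x - \<psi> x\<bar> \<le> e" for x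
    proof (cases "x \<in> tsupport \<eta>")
      case True
      have "\<bar>\<eta> x * p x - \<psi> x\<bar> = \<eta> x * \<bar>\<psi> x - p x\<bar>"
        by (subst \<eta>\<psi>[of x, symmetric]) (simp add: abs_mult \<eta>(2) abs_minus_commute flip: right_diff_distrib)
      also have "\<dots> \<le> 1 * e" using p(2)[OF True] \<eta>(2,3)[of x] by (intro mult_mono) auto
      finally show ?thesis by simp
    next
      case False
      then show ?thesis using \<eta>\<psi>[of x] e by (simp add: not_in_tsupport)
    qed
  qed
qed

lemma AE_tendsto_Cc_fun:
  fixes f :: "'a::euclidean_space \<Rightarrow> real"
  assumes f: "f \<in> borel_measurable lebesgue" "\<And>x. \<bar>f x\<bar> \<le> 1"
  obtains \<psi> where "\<And>n. Cc_fun UNIV (\<psi> n)" "\<And>n x. \<bar>\<psi> n x\<bar> \<le> 1"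
    "AE x in lebesgue. (\<lambda>n. \<psi> n x) \<longlonglongrightarrow> f x"
proof -
  have "f measurable_on UNIV"
    by (rule lebesgue_measurable_imp_measurable_on[OF f(1)]) simp
  then obtain N s where N: "negligible N" and s: "\<And>n::nat. continuous_on UNIV (s n)"
    and s_lim: "\<And>x. x \<notin> N \<Longrightarrow> (\<lambda>n. s n x) \<longlonglongrightarrow> f x"
    unfolding measurable_on_def by auto
  define \<psi> where "\<psi> n x = max (-1) (min 1 (s n x)) * max 0 (min 1 (real n + 1 - norm x))" for n x
  have "(\<lambda>n. \<psi> n x) \<longlonglongrightarrow> f x" if "x \<notin> N" for x
  proof -
    have "\<forall>\<^sub>F n in sequentially. max 0 (min 1 (real n + 1 - norm x)) = 1"
      using eventually_ge_at_top[of "nat \<lceil>norm x\<rceil>"]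
    proof eventually_elim
      case (elim n)
      then have "norm x \<le> real n" by linarith
      then show ?case by simp
    qed
    then have "(\<lambda>n. \<psi> n x) \<longlonglongrightarrow> max (-1) (min 1 (f x)) * 1"
      unfolding \<psi>_def by (intro tendsto_intros s_lim that tendsto_eventually)
    moreover have "max (-1) (min 1 (f x)) = f x" using f(2)[of x] by linarith
    ultimately show ?thesis by simp
  qed
  then have "AE x in lebesgue. (\<lambda>n. \<psi> n x) \<longlonglongrightarrow> f x"
    using N by (intro AE_I'[of N]) (auto simp: negligible_iff_null_sets)
  moreover have "\<bar>\<psi> n x\<bar> \<le> 1" for n x
    unfolding \<psi>_def abs_mult by (intro mult_le_one) auto
  moreover have "supported_in UNIV (\<psi> n)" for n
    by (rule supported_inI[of "cball 0 (real n + 1)"]) (auto simp: \<psi>_def max_def)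
  then have "Cc_fun UNIV (\<psi> n)" for n
    unfolding Cc_fun_iff \<psi>_def by (intro conjI continuous_intros s)
  ultimately show ?thesis by (intro that)
qed

lemma AE_tendsto_test_fun:
  fixes f :: "'a::euclidean_space \<Rightarrow> real"
  assumes f: "f \<in> borel_measurable lebesgue" "\<And>x. \<bar>f x\<bar> \<le> 1"
  obtains \<theta> where "\<And>n. test_fun UNIV (\<theta> n)" "\<And>n x. \<bar>\<theta> n x\<bar> \<le> 1"
    "AE x in lebesgue. (\<lambda>n. \<theta> n x) \<longlonglongrightarrow> f x"
proof -
  obtain \<psi> where \<psi>: "\<And>n. Cc_fun UNIV (\<psi> n)" "\<And>n x. \<bar>\<psi> n x\<bar> \<le> 1"
    and \<psi>_lim: "AE x in lebesgue. (\<lambda>n. \<psi> n x) \<longlonglongrightarrow> f x"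
    by (rule AE_tendsto_Cc_fun[OF f]) blast
  define e where "e n = 1 / (real n + 1)" for n
  have e: "0 < e n" "e n \<le> 1" for n by (auto simp: e_def)
  have e_lim: "e \<longlonglongrightarrow> 0"
    using LIMSEQ_inverse_real_of_nat by (simp add: e_def[abs_def] inverse_eq_divide add.commute)
  have "\<exists>\<theta>. test_fun UNIV \<theta> \<and> (\<forall>x. \<bar>\<theta> x - (1 - e n) * \<psi> n x\<bar> \<le> e n)" for n
    using test_fun_dense[OF Cc_fun_cmult[OF \<psi>(1)] open_UNIV e(1)] by blast
  then obtain \<theta> where \<theta>: "\<And>n. test_fun UNIV (\<theta> n)" "\<And>n x. \<bar>\<theta> n x - (1 - e n) * \<psi> n x\<bar> \<le> e n" by metis
  show ?thesis
  proof (rule that[of \<theta>])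
    fix n x
    have "\<bar>(1 - e n) * \<psi> n x\<bar> \<le> 1 - e n"
      using \<psi>(2)[of n x] e(2)[of n] by (simp add: abs_mult mult_left_le)
    then show "\<bar>\<theta> n x\<bar> \<le> 1" using \<theta>(2)[of n x] by linarith
  next
    show "AE x in lebesgue. (\<lambda>n. \<theta> n x) \<longlonglongrightarrow> f x"
      using \<psi>_lim
    proof eventually_elim
      case (elim x)
      have "(\<lambda>n. \<theta> n x - (1 - e n) * \<psi> n x) \<longlonglongrightarrow> 0"
        using \<theta>(2) by (intro Lim_null_comparison[OF _ e_lim]) simp
      moreover have "(\<lambda>n. (1 - e n) * \<psi> n x) \<longlonglongrightarrow> (1 - 0) * f x"
        by (intro tendsto_intros e_lim elim)
      ultimately show ?case using tendsto_add by fastforce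
    qed
  qed (rule \<theta>)
qed

lemma integral_abs_le_test_fun:
  fixes w :: "'a::euclidean_space \<Rightarrow> real"
  assumes w: "integrable lebesgue w"
    and B: "\<And>\<theta>. test_fun UNIV \<theta> \<Longrightarrow> (\<And>x. \<bar>\<theta> x\<bar> \<le> 1) \<Longrightarrow> (\<integral>x. w x * \<theta> x \<partial>lebesgue) \<le> B"
  shows "(\<integral>x. \<bar>w x\<bar> \<partial>lebesgue) \<le> B"
proof -
  have [measurable]: "w \<in> borel_measurable lebesgue" using w by auto
  have "(\<lambda>x. sgn (w x)) \<in> borel_measurable lebesgue" by measurable
  then obtain \<theta> where \<theta>: "\<And>n. test_fun UNIV (\<theta> n)" "\<And>n x. \<bar>\<theta> n x\<bar> \<le> 1"
    and lim: "AE x in lebesgue. (\<lambda>n. \<theta> n x) \<longlonglongrightarrow> sgn (w x)"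
    by (rule AE_tendsto_test_fun) (auto simp: sgn_real_def)
  have [measurable]: "\<theta> n \<in> borel_measurable lebesgue" for n
    using Cc_fun_measurable[OF test_fun_imp_Cc_fun[OF \<theta>(1)]] by (intro measurable_completion) simp
  have "(\<lambda>n. \<integral>x. w x * \<theta> n x \<partial>lebesgue) \<longlonglongrightarrow> (\<integral>x. \<bar>w x\<bar> \<partial>lebesgue)"
  proof (rule integral_dominated_convergence[where w="\<lambda>x. \<bar>w x\<bar>"])
    show "AE x in lebesgue. (\<lambda>n. w x * \<theta> n x) \<longlonglongrightarrow> \<bar>w x\<bar>"
      using lim by eventually_elim (auto simp: abs_sgn intro: tendsto_mult)
    show "AE x in lebesgue. norm (w x * \<theta> n x) \<le> \<bar>w x\<bar>" for n
      using \<theta>(2)[of n] by (intro AE_I2) (simp add: abs_mult mult_left_le)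
  qed (use w in auto)
  then show ?thesis using B[OF \<theta>(1,2)] by (intro LIMSEQ_le_const2) auto
qed

section \<open>Averages of test functions\<close>

lemma has_derivative_if_quadratic_remainder:
  fixes f :: "'a::real_normed_vector \<Rightarrow> 'b::real_normed_vector"
  assumes "bounded_linear D" and le: "\<And>y. norm (f y - f p - D (y - p)) \<le> C * (norm (y - p))\<^sup>2"
  shows "(f has_derivative D) (at p)"
proof (rule has_derivativeI_sandwich[OF zero_less_one assms(1)])
  show "norm (f y - f p - D (y - p)) / norm (y - p) \<le> C * norm (y - p)" if "y \<noteq> p" for y
    using le[of y] that by (simp add: pos_divide_le_eq power2_eq_square mult.assoc)
  have "((\<lambda>y. C * norm (y - p)) \<longlongrightarrow> C * norm (p - p)) (at p)" by (intro tendsto_intros)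
  then show "((\<lambda>y. C * norm (y - p)) \<longlongrightarrow> 0) (at p)" by simp
qed

lemma abs_sum_Basis_le:
  fixes v :: "'a::euclidean_space" and c d :: "'a \<Rightarrow> real"
  assumes "\<And>b. b \<in> Basis \<Longrightarrow> \<bar>c b\<bar> \<le> d b"
  shows "\<bar>\<Sum>b\<in>Basis. (v \<bullet> b) * c b\<bar> \<le> (\<Sum>b\<in>Basis. d b) * norm v"
proof -
  have "\<bar>\<Sum>b\<in>Basis. (v \<bullet> b) * c b\<bar> \<le> (\<Sum>b\<in>Basis. \<bar>(v \<bullet> b) * c b\<bar>)" by (rule sum_abs)
  also have "\<dots> \<le> (\<Sum>b\<in>Basis. d b * norm v)"
    unfolding abs_mult mult.commute[of "\<bar>_ \<bullet> _\<bar>"]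
    by (intro sum_mono mult_mono assms Basis_le_norm) (auto intro: order_trans[OF abs_ge_zero assms])
  finally show ?thesis by (simp add: sum_distrib_right)
qed

lemma test_fun_dirderiv_bounded:
  assumes h: "test_fun U h"
  obtains B where "0 \<le> B" "\<And>v x. \<bar>dirderiv v h x\<bar> \<le> B * norm v"
proof -
  have "\<exists>B>0. \<forall>x. \<bar>dirderiv b h x\<bar> \<le> B" for b
    by (rule test_fun_bounded[OF test_fun_dirderiv[OF h, of b]]) blast
  then obtain B where B: "\<And>b. 0 < B b" "\<And>b x. \<bar>dirderiv b h x\<bar> \<le> B b" by metis
  show ?thesis
  proof (rule that[of "\<Sum>b\<in>Basis. B b"])
    show "0 \<le> (\<Sum>b\<in>Basis. B b)" by (intro sum_nonneg less_imp_le[OF B(1)])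
    show "\<bar>dirderiv v h x\<bar> \<le> (\<Sum>b\<in>Basis. B b) * norm v" for v x
      unfolding dirderiv_eq_sum_Basis[OF test_fun_differentiable[OF h], of v]
      by (rule abs_sum_Basis_le[OF B(2)])
  qed
qed

lemma test_fun_dirderiv_Lipschitz:
  assumes h: "test_fun U h"
  obtains L where "0 \<le> L" "\<And>v x y. \<bar>dirderiv v h x - dirderiv v h y\<bar> \<le> L * norm (x - y) * norm v"
proof -
  have "\<exists>L\<ge>0. \<forall>x y. \<bar>dirderiv b h x - dirderiv b h y\<bar> \<le> L * norm (x - y)" for b
  proof -
    have h': "test_fun U (dirderiv b h)" by (rule test_fun_dirderiv[OF h])
    obtain B where B: "0 \<le> B" "\<And>v x. \<bar>dirderiv v (dirderiv b h) x\<bar> \<le> B * norm v"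
      by (rule test_fun_dirderiv_bounded[OF h']) blast
    have "norm (dirderiv b h x - dirderiv b h y) \<le> B * norm (x - y)" for x y
      using B by (intro differentiable_bound[of UNIV] has_derivative_dirderiv test_fun_differentiable[OF h'] onorm_le)
        (auto intro: has_derivative_dirderiv test_fun_differentiable[OF h'])
    then show ?thesis using B(1) by auto
  qed
  then obtain L where L: "\<And>b. 0 \<le> L b"
    "\<And>b x y. \<bar>dirderiv b h x - dirderiv b h y\<bar> \<le> L b * norm (x - y)" by metis
  show ?thesis
  proof (rule that[of "\<Sum>b\<in>Basis. L b"])
    show "0 \<le> (\<Sum>b\<in>Basis. L b)" by (intro sum_nonneg L(1))
    fix v x y
    have "dirderiv v h x - dirderiv v h y = (\<Sum>b\<in>Basis. (v \<bullet> b) * (dirderiv b h x - dirderiv b h y))"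
      unfolding dirderiv_eq_sum_Basis[OF test_fun_differentiable[OF h], of v]
      by (simp add: sum_subtractf right_diff_distrib)
    also have "\<bar>\<dots>\<bar> \<le> (\<Sum>b\<in>Basis. L b * norm (x - y)) * norm v" by (rule abs_sum_Basis_le[OF L(2)])
    finally show "\<bar>dirderiv v h x - dirderiv v h y\<bar> \<le> (\<Sum>b\<in>Basis. L b) * norm (x - y) * norm v"
      by (simp add: sum_distrib_right)
  qed
qed

lemma test_fun_quadratic_remainder:
  assumes h: "test_fun U h"
  obtains C where "0 \<le> C" "\<And>y v. \<bar>h (y + v) - h y - dirderiv v h y\<bar> \<le> C * (norm v)\<^sup>2"
proof -
  obtain L where L: "0 \<le> L" "\<And>v x y. \<bar>dirderiv v h x - dirderiv v h y\<bar> \<le> L * norm (x - y) * norm v"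
    by (rule test_fun_dirderiv_Lipschitz[OF h]) blast
  have "norm (h (y + v) - h y - dirderiv (y + v - y) h y) \<le> norm (y + v - y) * (L * norm v)" for y v
  proof (rule differentiable_bound_linearization[where S="cball y (norm v)" and f'="\<lambda>x v. dirderiv v h x"])
    show "(h has_derivative (\<lambda>v. dirderiv v h x)) (at x within cball y (norm v))" for x
      by (rule has_derivative_at_withinI[OF has_derivative_dirderiv[OF test_fun_differentiable[OF h]]])
    fix x assume x: "x \<in> cball y (norm v)"
    have "L * norm (x - y) * norm w \<le> L * norm v * norm w" for w
      using x L(1) by (intro mult_mono) (auto simp: dist_norm norm_minus_commute)
    then show "onorm ((\<lambda>v. dirderiv v h x) - (\<lambda>v. dirderiv v h y)) \<le> L * norm v"
      using L(2) by (intro onorm_le) (fastforce intro: order_trans)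
  qed (auto simp: dist_norm mult_left_le_one_le)
  then show ?thesis using that[OF L(1)] by (simp add: power2_eq_square mult_ac)
qed

definition average ::
  "'c measure \<Rightarrow> ('c \<Rightarrow> real) \<Rightarrow> ('c \<Rightarrow> 'b::euclidean_space) \<Rightarrow> ('b \<Rightarrow> real) \<Rightarrow> 'b \<Rightarrow> real" where
  "average M k l h p = (\<integral>\<omega>. k \<omega> * h (p + l \<omega>) \<partial>M)"

context
  fixes M :: "'c measure" and k :: "'c \<Rightarrow> real" and l :: "'c \<Rightarrow> 'b::euclidean_space"
  assumes k: "integrable M k" and l[measurable]: "l \<in> borel_measurable M"
begin

lemma average_integrable:
  assumes h: "test_fun U h"
  shows "integrable M (\<lambda>\<omega>. k \<omega> * h (p + l \<omega>))"
proof -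
  obtain B where B: "0 < B" "\<And>x. \<bar>h x\<bar> \<le> B" by (rule test_fun_bounded[OF h]) blast
  have [measurable]: "h \<in> borel_measurable borel" "k \<in> borel_measurable M"
    using Cc_fun_measurable[OF test_fun_imp_Cc_fun[OF h]] k by auto
  show ?thesis
  proof (rule Bochner_Integration.integrable_bound[of _ "\<lambda>\<omega>. B * k \<omega>"])
    show "AE x in M. norm (k x * h (p + l x)) \<le> norm (B * k x)"
      using B by (intro AE_I2) (simp add: abs_mult mult.commute[of B] mult_left_mono)
  qed (use k in auto)
qed

lemma average_add:
  "test_fun U h \<Longrightarrow> test_fun U h' \<Longrightarrow>
    average M k l (\<lambda>x. h x + h' x) p = average M k l h p + average M k l h' p"
  unfolding average_def using average_integrable by (simp add: distrib_left)

lemma average_cmult: "average M k l (\<lambda>x. c * h x) p = c * average M k l h p"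
  unfolding average_def by (simp add: mult.left_commute[of _ c])

lemma average_sum:
  assumes "\<And>i. i \<in> I \<Longrightarrow> test_fun U (h i)"
  shows "average M k l (\<lambda>x. \<Sum>i\<in>I. h i x) p = (\<Sum>i\<in>I. average M k l (h i) p)"
  using assms
proof (induction I rule: infinite_finite_induct)
  case (insert i I)
  then show ?case using average_add[of U "h i" "\<lambda>x. \<Sum>i\<in>I. h i x"] by (simp add: test_fun_sum)
qed (simp_all add: average_def)

lemma average_has_derivative:
  assumes h: "test_fun U h"
  shows "(average M k l h has_derivative (\<lambda>v. average M k l (dirderiv v h) p)) (at p)"
proof -
  let ?A = "\<lambda>v. average M k l (dirderiv v h) p"
  obtain C where C: "0 \<le> C" "\<And>y v. \<bar>h (y + v) - h y - dirderiv v h y\<bar> \<le> C * (norm v)\<^sup>2"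
    by (rule test_fun_quadratic_remainder[OF h]) blast
  have A_eq: "?A = (\<lambda>v. \<Sum>b\<in>Basis. (v \<bullet> b) * average M k l (dirderiv b h) p)"
  proof
    fix v
    have "dirderiv v h = (\<lambda>x. \<Sum>b\<in>Basis. (v \<bullet> b) * dirderiv b h x)"
      by (rule ext, rule dirderiv_eq_sum_Basis[OF test_fun_differentiable[OF h]])
    then show "?A v = (\<Sum>b\<in>Basis. (v \<bullet> b) * average M k l (dirderiv b h) p)"
      using average_sum[of Basis U "\<lambda>b x. (v \<bullet> b) * dirderiv b h x"]
      by (simp add: average_cmult test_fun_cmult test_fun_dirderiv[OF h])
  qed
  have "norm (average M k l h y - average M k l h p - ?A (y - p)) \<le> (\<integral>\<omega>. \<bar>k \<omega>\<bar> \<partial>M) * C * (norm (y - p))\<^sup>2" for y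
  proof -
    let ?F = "\<lambda>\<omega>. k \<omega> * h (y + l \<omega>) - k \<omega> * h (p + l \<omega>) - k \<omega> * dirderiv (y - p) h (p + l \<omega>)"
    have F: "integrable M ?F"
      by (intro Bochner_Integration.integrable_diff average_integrable[OF h]
        average_integrable[OF test_fun_dirderiv[OF h]])
    have "average M k l h y - average M k l h p - ?A (y - p) = (\<integral>\<omega>. ?F \<omega> \<partial>M)"
      unfolding average_def using average_integrable[OF h] average_integrable[OF test_fun_dirderiv[OF h]] by simp
    also have "norm \<dots> \<le> (\<integral>\<omega>. \<bar>k \<omega>\<bar> * (C * (norm (y - p))\<^sup>2) \<partial>M)"
    proof (rule order_trans[OF integral_norm_bound integral_mono])
      show "integrable M (\<lambda>\<omega>. norm (?F \<omega>))" using F by (rule integrable_norm)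
      fix \<omega>
      have "?F \<omega> = k \<omega> * (h ((p + l \<omega>) + (y - p)) - h (p + l \<omega>) - dirderiv (y - p) h (p + l \<omega>))"
        by (simp add: algebra_simps)
      also have "norm \<dots> \<le> \<bar>k \<omega>\<bar> * (C * (norm (y - p))\<^sup>2)"
        unfolding real_norm_def abs_mult by (intro mult_left_mono C) auto
      finally show "norm (?F \<omega>) \<le> \<bar>k \<omega>\<bar> * (C * (norm (y - p))\<^sup>2)" .
    qed (use k in auto)
    finally show ?thesis by (simp add: mult.assoc)
  qed
  moreover have "bounded_linear ?A"
    unfolding A_eq by (intro bounded_linear_sum bounded_linear_mult_const bounded_linear_inner_left)
  ultimately show ?thesis by (intro has_derivative_if_quadratic_remainder)
qed

lemma dirderiv_average: "test_fun U h \<Longrightarrow> dirderiv v (average M k l h) = average M k l (dirderiv v h)"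
  by (rule ext, rule has_derivative_imp_dirderiv[OF average_has_derivative])

lemma smooth_fun_average:
  assumes h: "test_fun U h"
  shows "smooth_fun (average M k l h)"
proof (rule smooth_fun_coinduct[where S="\<lambda>g. \<exists>h. test_fun U h \<and> g = average M k l h"])
  show "\<exists>h'. test_fun U h' \<and> average M k l h = average M k l h'" using h by blast
qed (auto simp: differentiable_def dirderiv_average
    intro: average_has_derivative test_fun_dirderiv)

end

section \<open>The standard Gaussian\<close>

lemma integrable_lborel_prod:
  fixes f :: "'a::euclidean_space \<Rightarrow> real \<Rightarrow> real"
  assumes f: "\<And>b. b \<in> Basis \<Longrightarrow> integrable lborel (f b)"
  shows "integrable lborel (\<lambda>z. \<Prod>b\<in>Basis. f b (z \<bullet> b))"
proof (rule integrableI_bounded)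
  have [measurable]: "f b \<in> borel_measurable borel" if "b \<in> Basis" for b using f[OF that] by simp
  show "(\<lambda>z. \<Prod>b\<in>Basis. f b (z \<bullet> b)) \<in> borel_measurable lborel" by measurable
  have "(\<integral>\<^sup>+z. ennreal (norm (\<Prod>b\<in>Basis. f b (z \<bullet> b))) \<partial>(lborel :: 'a measure)) =
      (\<integral>\<^sup>+z. (\<Prod>b\<in>Basis. ennreal \<bar>f b (z \<bullet> b)\<bar>) \<partial>(lborel :: 'a measure))"
    by (simp add: abs_prod prod_ennreal)
  also have "\<dots> = (\<Prod>b\<in>(Basis :: 'a set). \<integral>\<^sup>+x. ennreal \<bar>f b x\<bar> \<partial>lborel)"
    by (rule nn_integral_lborel_prod) auto
  also have "\<dots> < \<infinity>"
    using f by (simp add: integrable_iff_bounded less_top[symmetric] ennreal_prod_eq_top)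
  finally show "(\<integral>\<^sup>+z. ennreal (norm (\<Prod>b\<in>Basis. f b (z \<bullet> b))) \<partial>(lborel :: 'a measure)) < \<infinity>" .
qed

definition gauss :: "'a::euclidean_space \<Rightarrow> real" where
  "gauss z = (\<Prod>b\<in>Basis. std_normal_density (z \<bullet> b))"

definition gauss_moment :: "'a::euclidean_space itself \<Rightarrow> real" where
  "gauss_moment _ = (\<integral>z. norm z * gauss z \<partial>(lborel :: 'a measure))"

lemma gauss_nonneg: "0 \<le> gauss z"
  by (simp add: gauss_def prod_nonneg)

lemma gauss_eq_exp:
  "gauss (z :: 'a::euclidean_space) = exp (- (z \<bullet> z) / 2) / sqrt (2 * pi) ^ DIM('a)"
proof -
  have "(\<Sum>b\<in>Basis. - (z \<bullet> b)\<^sup>2 / 2) = - (z \<bullet> z) / 2"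
    by (subst euclidean_inner) (simp add: power2_eq_square sum_negf sum_divide_distrib)
  then show ?thesis
    unfolding gauss_def std_normal_density_def prod.distrib
    by (simp add: exp_sum[symmetric] power_one_over)
qed

lemma gauss_continuous_on: "continuous_on S gauss"
  unfolding gauss_eq_exp[abs_def] by (intro continuous_intros) auto

lemma gauss_measurable [measurable]: "gauss \<in> borel_measurable borel"
  by (rule borel_measurable_continuous_onI[OF gauss_continuous_on])

lemma integrable_gauss: "integrable lborel gauss"
  unfolding gauss_def[abs_def] by (rule integrable_lborel_prod) simp

lemma integral_gauss: "(\<integral>z. gauss z \<partial>lborel) = 1"
proof -
  have "(\<integral>\<^sup>+x. ennreal (std_normal_density x) \<partial>lborel) = 1"
    by (subst nn_integral_eq_integral) auto
  then have "(\<integral>\<^sup>+z. ennreal (gauss z) \<partial>(lborel :: 'a measure)) = 1"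
    using nn_integral_lborel_prod[where f="\<lambda>b::'a. \<lambda>x. ennreal (std_normal_density x)"]
    by (simp add: gauss_def prod_ennreal)
  then show ?thesis
    by (simp add: integral_eq_nn_integral gauss_nonneg)
qed

lemma integrable_inner_gauss:
  assumes b: "b \<in> Basis"
  shows "integrable lborel (\<lambda>z. (z \<bullet> b) * gauss z)"
proof -
  let ?f = "\<lambda>c x. if c = b then x * std_normal_density x else std_normal_density x"
  have "integrable lborel (?f c)" for c
    using integrable_std_normal_moment[of 1] by (cases "c = b") (simp_all add: mult.commute)
  then have "integrable lborel (\<lambda>z. \<Prod>c\<in>Basis. ?f c (z \<bullet> c))" by (rule integrable_lborel_prod)
  moreover have "(\<Prod>c\<in>Basis. ?f c (z \<bullet> c)) = (z \<bullet> b) * gauss z" for z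
    unfolding gauss_def using b by (simp add: prod.remove[OF finite_Basis b] mult.assoc)
  ultimately show ?thesis by simp
qed

lemma integrable_norm_gauss: "integrable lborel (\<lambda>z::'a::euclidean_space. norm z * gauss z)"
proof (rule Bochner_Integration.integrable_bound)
  show "integrable lborel (\<lambda>z::'a. \<Sum>b\<in>Basis. \<bar>(z \<bullet> b) * gauss z\<bar>)"
    by (intro Bochner_Integration.integrable_sum integrable_abs integrable_inner_gauss)
  show "AE z in lborel. norm (norm z * gauss z) \<le> norm (\<Sum>b\<in>Basis. \<bar>(z \<bullet> b) * gauss z\<bar>)"
    using mult_right_mono[OF norm_le_l1 gauss_nonneg]
    by (intro AE_I2) (simp add: abs_mult gauss_nonneg sum_nonneg sum_distrib_right[symmetric])
qed measurable

lemma gauss_moment_nonneg: "0 \<le> gauss_moment TYPE('a::euclidean_space)"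
  unfolding gauss_moment_def by (rule integral_nonneg_AE) (simp add: gauss_nonneg)

lemma DERIV_gauss_along_line:
  "((\<lambda>s. gauss (z + s *\<^sub>R b)) has_real_derivative - ((z + s *\<^sub>R b) \<bullet> b) * gauss (z + s *\<^sub>R b)) (at s)"
proof -
  have "((\<lambda>s. - ((z + s *\<^sub>R b) \<bullet> (z + s *\<^sub>R b)) / 2) has_real_derivative - ((z + s *\<^sub>R b) \<bullet> b)) (at s)"
    unfolding has_field_derivative_def
    by (rule derivative_eq_intros refl)+ (auto simp: inner_commute fun_eq_iff field_simps)
  from DERIV_cdivide[OF DERIV_chain2[OF DERIV_exp this]]
  show ?thesis unfolding gauss_eq_exp by (simp add: mult.commute)
qed

section \<open>A parametrix for the backward heat operator\<close>

lemma lborel_integral_translate: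
  fixes F :: "'a::euclidean_space \<Rightarrow> real"
  assumes [measurable]: "F \<in> borel_measurable borel"
  shows "(\<integral>z. F (z + c) \<partial>lborel) = (\<integral>z. F z \<partial>lborel)"
proof -
  have "(\<integral>z. F z \<partial>lborel) = (\<integral>z. F z \<partial>distr lborel borel ((+) c))" by (simp only: lborel_distr_plus)
  also have "\<dots> = (\<integral>z. F (c + z) \<partial>lborel)" by (subst integral_distr) auto
  finally show ?thesis by (simp add: add.commute)
qed

lemma lborel_integrable_translate:
  fixes F :: "'a::euclidean_space \<Rightarrow> real"
  assumes F: "integrable lborel F"
  shows "integrable lborel (\<lambda>z. F (z + c))"
proof -
  have [measurable]: "F \<in> borel_measurable borel" using F by simp
  have "integrable (distr lborel borel ((+) c)) F" using F by (simp only: lborel_distr_plus)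
  then show ?thesis by (subst (asm) integrable_distr_eq) (auto simp: add.commute)
qed

lemma integral_derivative_along_line_eq_0:
  fixes F F' :: "'a::euclidean_space \<Rightarrow> real"
  assumes F: "integrable lborel F" and F': "integrable lborel F'" "continuous_on UNIV F'"
    and DERIV: "\<And>z s. ((\<lambda>s. F (z + s *\<^sub>R b)) has_real_derivative F' (z + s *\<^sub>R b)) (at s)"
  shows "(\<integral>z. F' z \<partial>lborel) = 0"
proof -
  have [measurable]: "F \<in> borel_measurable borel" "F' \<in> borel_measurable borel" using F F' by auto
  let ?f = "\<lambda>s z. indicator {0..1} s * F' (z + s *\<^sub>R b)"
  have FTC: "(\<integral>s. ?f s z \<partial>lborel) = F (z + b) - F z" for z
  proof -
    have "(\<integral>s. indicator {0..1} s *\<^sub>R F' (z + s *\<^sub>R b) \<partial>lborel) = F (z + 1 *\<^sub>R b) - F (z + 0 *\<^sub>R b)"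
    proof (rule integral_FTC_atLeastAtMost)
      show "((\<lambda>s. F (z + s *\<^sub>R b)) has_vector_derivative F' (z + s *\<^sub>R b)) (at s within {0..1})" for s
        using DERIV by (simp add: has_real_derivative_iff_has_vector_derivative[symmetric]
            has_field_derivative_at_within)
      show "continuous_on {0..1} (\<lambda>s. F' (z + s *\<^sub>R b))"
        by (intro continuous_on_compose2[OF F'(2)] continuous_intros) auto
    qed simp
    then show ?thesis by simp
  qed
  have "integrable (lborel \<Otimes>\<^sub>M lborel) (case_prod ?f)"
  proof (rule lborel_pair.Fubini_integrable)
    have "(\<integral>z. norm (?f s z) \<partial>lborel) = indicator {0..1} s * (\<integral>z. \<bar>F' z\<bar> \<partial>lborel)" for s
      using lborel_integral_translate[of "\<lambda>z. \<bar>F' z\<bar>" "s *\<^sub>R b"] by (simp add: abs_mult)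
    then show "integrable lborel (\<lambda>s. \<integral>z. norm (case (s, z) of (s, z) \<Rightarrow> ?f s z) \<partial>lborel)"
      by (simp add: integrable_mult_left)
    show "AE s in lborel. integrable lborel (\<lambda>z. case (s, z) of (s, z) \<Rightarrow> ?f s z)"
      using lborel_integrable_translate[OF F'(1)] by simp
  qed measurable
  from lborel_pair.Fubini_integral[OF this]
  have "(\<integral>z. F (z + b) - F z \<partial>lborel) = (\<integral>s. indicator {0..1} (s::real) * (\<integral>z. F' z \<partial>lborel) \<partial>lborel)"
    by (simp add: FTC lborel_integral_translate)
  moreover have "(\<integral>z. F (z + b) - F z \<partial>lborel) = 0"
    using F lborel_integrable_translate[OF F] by (simp add: lborel_integral_translate)
  ultimately show ?thesis by (simp add: content_real)
qed

lemma integrable_lborel_pair_mult_bounded: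
  fixes f :: "'a::euclidean_space \<Rightarrow> real" and g :: "'b::euclidean_space \<Rightarrow> real"
  assumes f: "integrable lborel f" and g: "integrable lborel g"
    and m: "m \<in> borel_measurable borel" and B: "\<And>p. \<bar>m p\<bar> \<le> B"
  shows "integrable (lborel \<Otimes>\<^sub>M lborel) (\<lambda>(x, y). f x * g y * m (x, y))"
proof (rule Bochner_Integration.integrable_bound[of _ "\<lambda>(x, y). B * (f x * g y)"])
  have [measurable]: "f \<in> borel_measurable borel" "g \<in> borel_measurable borel" using f g by auto
  have [measurable]: "m \<in> borel_measurable (lborel \<Otimes>\<^sub>M lborel)" using m by (simp add: lborel_prod)
  show "integrable (lborel \<Otimes>\<^sub>M lborel) (\<lambda>(x, y). B * (f x * g y))"
    by (rule lborel_pair.Fubini_integrable) (use f g in \<open>auto simp: abs_mult\<close>)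
  show "(\<lambda>(x, y). f x * g y * m (x, y)) \<in> borel_measurable (lborel \<Otimes>\<^sub>M lborel)" by measurable
  have "\<bar>m p\<bar> \<le> \<bar>B\<bar>" for p using B[of p] by linarith
  then show "AE p in lborel \<Otimes>\<^sub>M lborel. norm (case p of (x, y) \<Rightarrow> f x * g y * m (x, y))
      \<le> norm (case p of (x, y) \<Rightarrow> B * (f x * g y))"
    by (intro AE_I2) (auto simp: abs_mult mult.commute[of "\<bar>B\<bar>"] intro!: mult_left_mono)
qed

lemma test_fun_dt: "test_fun U h \<Longrightarrow> test_fun U (dt h)"
  unfolding dt_def by (rule test_fun_dirderiv)

lemma test_fun_dxi: "test_fun U h \<Longrightarrow> test_fun U (dxi b h)"
  unfolding dxi_def by (rule test_fun_dirderiv)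

lemma test_fun_lapx: "test_fun U h \<Longrightarrow> test_fun U (lapx h)"
  unfolding lapx_def[abs_def] by (intro test_fun_sum test_fun_dxi)

lemma dirderiv_Pair:
  assumes "h differentiable (at p)"
  shows "dirderiv (z, r) h p = (\<Sum>b\<in>Basis. (z \<bullet> b) * dxi b h p) + r * dt h p"
proof -
  have "(z, r) = (\<Sum>b\<in>Basis. (z \<bullet> b) *\<^sub>R (b, 0)) + r *\<^sub>R (0, 1)"
    by (simp add: scaleR_Pair sum_prod euclidean_representation)
  then show ?thesis
    unfolding dxi_def dt_def
    by (simp only: linear_add[OF linear_dirderiv[OF assms]] linear_sum[OF linear_dirderiv[OF assms]]
        dirderiv_scaleR[OF assms])
qed

text \<open>If Z is a standard Gaussian vector, the mean of h over p + (r Z, r^2/2) solves the backward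
  heat equation in p up to the factor r: its derivative in r is r times the mean of dt h + lapx h.\<close>

definition heat_shift :: "'a::euclidean_space \<times> real \<Rightarrow> 'a \<times> real" where
  "heat_shift = (\<lambda>(z, r). (r *\<^sub>R z, r\<^sup>2 / 2))"

definition gauss_mean :: "real \<Rightarrow> ('a::euclidean_space \<times> real \<Rightarrow> real) \<Rightarrow> 'a \<times> real \<Rightarrow> real" where
  "gauss_mean r = average lborel gauss (\<lambda>z. heat_shift (z, r))"

definition heat_weight :: "real \<Rightarrow> 'a::euclidean_space \<times> real \<Rightarrow> real" where
  "heat_weight \<rho> = (\<lambda>(z, r). gauss z * (r * indicator {0..\<rho>} r))"

definition heat_potential :: "real \<Rightarrow> ('a::euclidean_space \<times> real \<Rightarrow> real) \<Rightarrow> 'a \<times> real \<Rightarrow> real" where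
  "heat_potential \<rho> = average lborel (heat_weight \<rho>) heat_shift"

lemma heat_shift_measurable [measurable]: "heat_shift \<in> borel_measurable borel"
proof (rule borel_measurable_continuous_onI)
  show "continuous_on UNIV (heat_shift :: 'a \<times> real \<Rightarrow> 'a \<times> real)"
    unfolding heat_shift_def split_beta' by (intro continuous_intros) auto
qed

lemma heat_shift_slice_measurable: "(\<lambda>z. heat_shift (z, r)) \<in> borel_measurable lborel"
  unfolding heat_shift_def split by measurable

lemmas gauss_mean_integrable =
  average_integrable[OF integrable_gauss heat_shift_slice_measurable]

lemma integrable_indicator_Icc:
  "integrable lborel (\<lambda>r::real. indicator {0..\<rho>} r :: real)"
  "integrable lborel (\<lambda>r::real. r * indicator {0..\<rho>} r)"
  using borel_integrable_atLeastAtMost'[of 0 \<rho> "\<lambda>_. 1 :: real"] borel_integrable_atLeastAtMost'[of 0 \<rho> "\<lambda>r::real. r"]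
  by (simp_all add: set_integrable_def continuous_on_id mult.commute)

lemma integrable_gauss_shift:
  assumes f: "integrable lborel f" and g: "integrable lborel g" and h: "test_fun U h"
  shows "integrable (lborel \<Otimes>\<^sub>M lborel) (\<lambda>(z, r). f z * g r * h (p + heat_shift (z, r)))"
proof -
  obtain B where B: "\<And>x. \<bar>h x\<bar> \<le> B" by (rule test_fun_bounded[OF h]) blast
  have [measurable]: "h \<in> borel_measurable borel" by (rule Cc_fun_measurable[OF test_fun_imp_Cc_fun[OF h]])
  show ?thesis by (rule integrable_lborel_pair_mult_bounded[OF f g _ B]) measurable
qed

lemma integrable_heat_weight: "integrable lborel (heat_weight \<rho>)"
  using integrable_lborel_pair_mult_bounded[OF integrable_gauss integrable_indicator_Icc(2), of "\<lambda>_. 1" 1 \<rho>]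
  by (simp add: heat_weight_def lborel_prod)

lemma heat_potential_eq:
  assumes h: "test_fun U h"
  shows "heat_potential \<rho> h p = (\<integral>r. indicator {0..\<rho>} r * (r * gauss_mean r h p) \<partial>lborel)"
proof -
  have "heat_potential \<rho> h p = integral\<^sup>L (lborel \<Otimes>\<^sub>M lborel)
      (\<lambda>(z, r). gauss z * (r * indicator {0..\<rho>} r) * h (p + heat_shift (z, r)))"
    unfolding heat_potential_def average_def heat_weight_def lborel_prod by (simp add: split_beta')
  also have "\<dots> = (\<integral>r. (\<integral>z. gauss z * (r * indicator {0..\<rho>} r) * h (p + heat_shift (z, r)) \<partial>lborel) \<partial>lborel)"
    by (rule lborel_pair.integral_snd[OF integrable_gauss_shift[OF integrable_gauss
      integrable_indicator_Icc(2) h], symmetric])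
  also have "\<dots> = (\<integral>r. indicator {0..\<rho>} r * (r * gauss_mean r h p) \<partial>lborel)"
    unfolding gauss_mean_def average_def integral_mult_right_zero[symmetric] by (simp only: mult_ac)
  finally show ?thesis .
qed

lemma gauss_mean_integration_by_parts:
  fixes h :: "'a::euclidean_space \<times> real \<Rightarrow> real"
  assumes h: "test_fun U h" and b: "b \<in> Basis"
  shows "(\<integral>z. (z \<bullet> b) * gauss z * h (p + heat_shift (z, r)) \<partial>lborel) = r * gauss_mean r (dxi b h) p"
proof -
  let ?q = "\<lambda>z. p + heat_shift (z, r)"
  let ?F = "\<lambda>z. gauss z * h (?q z)" and ?G = "\<lambda>z. gauss z * dxi b h (?q z)"
    and ?H = "\<lambda>z. (z \<bullet> b) * gauss z * h (?q z)"
  have G: "integrable lborel ?G" by (rule gauss_mean_integrable[OF test_fun_dxi[OF h]])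
  have H: "integrable lborel ?H"
    by (rule average_integrable[OF integrable_inner_gauss[OF b] heat_shift_slice_measurable h])
  have "(\<integral>z. r * ?G z - ?H z \<partial>lborel) = 0"
  proof (rule integral_derivative_along_line_eq_0[where F="?F" and b=b])
    show "integrable lborel ?F" by (rule gauss_mean_integrable[OF h])
    show "integrable lborel (\<lambda>z. r * ?G z - ?H z)" using G H by simp
    show "continuous_on UNIV (\<lambda>z. r * ?G z - ?H z)"
      unfolding heat_shift_def split
      by (intro continuous_intros gauss_continuous_on
          continuous_on_compose2[OF smooth_fun_continuous_on[OF test_fun_smooth[OF h], of UNIV]]
          continuous_on_compose2[OF smooth_fun_continuous_on[OF
            test_fun_smooth[OF test_fun_dxi[OF h]], of UNIV]]) auto
    fix z s
    have "((\<lambda>s. ?q (z + s *\<^sub>R b)) has_vector_derivative r *\<^sub>R (b, 0)) (at s)"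
      unfolding has_vector_derivative_def heat_shift_def split
      by (rule derivative_eq_intros refl)+ (auto simp: scaleR_Pair algebra_simps)
    from DERIV_mult[OF DERIV_gauss_along_line DERIV_dirderiv_along_curve[OF test_fun_differentiable[OF h] this]]
    show "((\<lambda>s. ?F (z + s *\<^sub>R b)) has_real_derivative (r * ?G (z + s *\<^sub>R b) - ?H (z + s *\<^sub>R b))) (at s)"
      unfolding dirderiv_scaleR[OF test_fun_differentiable[OF h]] dxi_def by (simp add: algebra_simps)
  qed
  then show ?thesis using G H by (simp add: gauss_mean_def average_def)
qed

lemma gauss_mean_dirderiv:
  fixes h :: "'a::euclidean_space \<times> real \<Rightarrow> real"
  assumes h: "test_fun U h"
  shows "(\<integral>z. gauss z * dirderiv (z, r) h (p + heat_shift (z, r)) \<partial>lborel)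
    = r * gauss_mean r (\<lambda>p. dt h p + lapx h p) p"
proof -
  let ?q = "\<lambda>z. p + heat_shift (z, r)"
  have "(\<integral>z. gauss z * dirderiv (z, r) h (?q z) \<partial>lborel) =
      (\<integral>z. (\<Sum>b\<in>Basis. (z \<bullet> b) * gauss z * dxi b h (?q z)) + r * (gauss z * dt h (?q z)) \<partial>lborel)"
    unfolding dirderiv_Pair[OF test_fun_differentiable[OF h]]
    by (simp only: distrib_left sum_distrib_left mult_ac)
  also have "\<dots> = (\<Sum>b\<in>Basis. \<integral>z. (z \<bullet> b) * gauss z * dxi b h (?q z) \<partial>lborel) + r * gauss_mean r (dt h) p"
    using average_integrable[OF integrable_inner_gauss heat_shift_slice_measurable test_fun_dxi[OF h]]
      gauss_mean_integrable[OF test_fun_dt[OF h]]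
    by (simp add: gauss_mean_def average_def Bochner_Integration.integral_add Bochner_Integration.integral_sum)
  also have "(\<Sum>b\<in>Basis. \<integral>z. (z \<bullet> b) * gauss z * dxi b h (?q z) \<partial>lborel) = r * gauss_mean r (lapx h) p"
    unfolding lapx_def[abs_def] gauss_mean_def
    by (subst average_sum[OF integrable_gauss heat_shift_slice_measurable test_fun_dxi[OF test_fun_dxi[OF h]]])
      (simp add: gauss_mean_integration_by_parts[OF test_fun_dxi[OF h]] gauss_mean_def sum_distrib_left)
  finally show ?thesis
    unfolding gauss_mean_def
      average_add[OF integrable_gauss heat_shift_slice_measurable test_fun_dt[OF h] test_fun_lapx[OF h]]
    by (simp add: algebra_simps)
qed

lemma integral_dirderiv_heat_shift:
  fixes h :: "'a::euclidean_space \<times> real \<Rightarrow> real"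
  assumes h: "test_fun U h" and \<rho>: "0 \<le> \<rho>"
  shows "(\<integral>r. indicator {0..\<rho>} r * dirderiv (z, r) h (p + heat_shift (z, r)) \<partial>lborel)
    = h (p + heat_shift (z, \<rho>)) - h p"
proof -
  let ?q = "\<lambda>r. p + heat_shift (z, r)"
  have "(\<integral>r. indicator {0..\<rho>} r *\<^sub>R dirderiv (z, r) h (?q r) \<partial>lborel) = h (?q \<rho>) - h (?q 0)"
  proof (rule integral_FTC_atLeastAtMost[OF \<rho>])
    fix r :: real
    have "(?q has_vector_derivative (z, r)) (at r)"
      unfolding has_vector_derivative_def heat_shift_def split
      by (rule derivative_eq_intros refl)+ (auto simp: scaleR_Pair)
    from DERIV_dirderiv_along_curve[OF test_fun_differentiable[OF h] this]
    show "((\<lambda>r. h (?q r)) has_vector_derivative dirderiv (z, r) h (?q r)) (at r within {0..\<rho>})"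
      by (simp add: has_real_derivative_iff_has_vector_derivative[symmetric] has_field_derivative_at_within)
  next
    have cont: "continuous_on UNIV (dxi b h)" "continuous_on UNIV (dt h)" for b
      using h by (auto intro: smooth_fun_continuous_on test_fun_smooth test_fun_dxi test_fun_dt)
    show "continuous_on {0..\<rho>} (\<lambda>r. dirderiv (z, r) h (?q r))"
      unfolding dirderiv_Pair[OF test_fun_differentiable[OF h]] heat_shift_def split
      by (intro continuous_intros continuous_on_compose2[OF cont(1)] continuous_on_compose2[OF cont(2)]) auto
  qed
  then show ?thesis by (simp add: heat_shift_def zero_prod_def[symmetric])
qed

lemma heat_potential_heat_operator:
  fixes h :: "'a::euclidean_space \<times> real \<Rightarrow> real"
  assumes h: "test_fun U h" and \<rho>: "0 \<le> \<rho>"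
  shows "heat_potential \<rho> (\<lambda>p. dt h p + lapx h p) p = gauss_mean \<rho> h p - h p"
proof -
  let ?I = "\<lambda>r. indicator {0..\<rho>} r :: real"
  let ?f = "\<lambda>z r. gauss z * (?I r * dirderiv (z, r) h (p + heat_shift (z, r)))"
  have "integrable (lborel \<Otimes>\<^sub>M lborel) (\<lambda>(z, r). gauss z * (r * ?I r) * dt h (p + heat_shift (z, r)))"
    "b \<in> Basis \<Longrightarrow> integrable (lborel \<Otimes>\<^sub>M lborel) (\<lambda>(z, r). ((z \<bullet> b) * gauss z) * ?I r
        * dxi b h (p + heat_shift (z, r)))" for b
    using integrable_gauss_shift[OF integrable_gauss integrable_indicator_Icc(2) test_fun_dt[OF h]]
      integrable_gauss_shift[OF integrable_inner_gauss integrable_indicator_Icc(1) test_fun_dxi[OF h]] by auto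
  moreover have "?f z r = (\<Sum>b\<in>Basis. ((z \<bullet> b) * gauss z) * ?I r * dxi b h (p + heat_shift (z, r))) +
      gauss z * (r * ?I r) * dt h (p + heat_shift (z, r))" for z r
    by (subst dirderiv_Pair[OF test_fun_differentiable[OF h]]) (simp add: algebra_simps sum_distrib_left)
  ultimately have f: "integrable (lborel \<Otimes>\<^sub>M lborel) (case_prod ?f)"
    by (simp add: split_beta')
  have "gauss_mean \<rho> h p - h p = (\<integral>z. gauss z * (h (p + heat_shift (z, \<rho>)) - h p) \<partial>lborel)"
    using gauss_mean_integrable[OF h] integrable_gauss[where 'a='a] integral_gauss[where 'a='a]
    by (simp add: gauss_mean_def average_def right_diff_distrib)
  also have "\<dots> = (\<integral>z. (\<integral>r. ?f z r \<partial>lborel) \<partial>lborel)"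
    by (simp add: integral_dirderiv_heat_shift[OF h \<rho>])
  also have "\<dots> = (\<integral>r. (\<integral>z. ?f z r \<partial>lborel) \<partial>lborel)"
    by (rule lborel_pair.Fubini_integral[OF f, symmetric])
  also have "\<dots> = (\<integral>r. ?I r * (\<integral>z. gauss z * dirderiv (z, r) h (p + heat_shift (z, r)) \<partial>lborel) \<partial>lborel)"
    unfolding integral_mult_right_zero[symmetric] by (simp only: mult_ac)
  also have "\<dots> = heat_potential \<rho> (\<lambda>p. dt h p + lapx h p) p"
    unfolding gauss_mean_dirderiv[OF h] by (rule heat_potential_eq[OF
      test_fun_add[OF test_fun_dt[OF h] test_fun_lapx[OF h]], symmetric])
  finally show ?thesis by simp
qed

lemma heat_operator_heat_potential:
  assumes h: "test_fun U h"
  shows "dt (heat_potential \<rho> h) p + lapx (heat_potential \<rho> h) p = heat_potential \<rho> (\<lambda>p. dt h p + lapx h p) p"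
proof -
  have hs: "heat_shift \<in> borel_measurable lborel" by simp
  note commute = dirderiv_average[OF integrable_heat_weight hs]
  show ?thesis
    unfolding heat_potential_def
      average_add[OF integrable_heat_weight hs test_fun_dt[OF h] test_fun_lapx[OF h]]
    unfolding lapx_def[abs_def] average_sum[OF integrable_heat_weight hs test_fun_dxi[OF test_fun_dxi[OF h]]]
    by (simp add: dt_def dxi_def commute[OF h] commute[OF test_fun_dirderiv[OF h]])
qed

context
  fixes b :: "'a::euclidean_space" and \<theta> :: "'a \<times> real \<Rightarrow> real" and U
  assumes b: "b \<in> Basis" and \<theta>: "test_fun U \<theta>" "\<And>p. \<bar>\<theta> p\<bar> \<le> 1"
begin

lemma abs_gauss_mean_dxi_le: "\<bar>r * gauss_mean r (dxi b \<theta>) p\<bar> \<le> gauss_moment TYPE('a)"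
proof -
  have "\<bar>\<integral>z. (z \<bullet> b) * gauss z * \<theta> (p + heat_shift (z, r)) \<partial>lborel\<bar> \<le>
      (\<integral>z. \<bar>(z \<bullet> b) * gauss z * \<theta> (p + heat_shift (z, r))\<bar> \<partial>lborel)"
    by (rule integral_abs_bound)
  also have "\<dots> \<le> (\<integral>z. norm z * gauss z \<partial>(lborel::'a measure))"
  proof (rule integral_mono'[OF integrable_norm_gauss])
    fix z :: 'a
    have "\<bar>z \<bullet> b\<bar> * gauss z * \<bar>\<theta> (p + heat_shift (z, r))\<bar> \<le> norm z * gauss z * 1"
      by (intro mult_mono \<theta> Basis_le_norm b gauss_nonneg mult_nonneg_nonneg) auto
    then show "\<bar>(z \<bullet> b) * gauss z * \<theta> (p + heat_shift (z, r))\<bar> \<le> norm z * gauss z"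
      by (simp add: abs_mult gauss_nonneg)
  qed (simp add: gauss_nonneg)
  finally show ?thesis unfolding gauss_mean_integration_by_parts[OF \<theta>(1) b] gauss_moment_def .
qed

lemma abs_heat_potential_dxi_le:
  assumes \<rho>: "0 \<le> \<rho>"
  shows "\<bar>heat_potential \<rho> (dxi b \<theta>) p\<bar> \<le> gauss_moment TYPE('a) * \<rho>"
proof -
  have "\<bar>heat_potential \<rho> (dxi b \<theta>) p\<bar> \<le> (\<integral>r. \<bar>indicator {0..\<rho>} r * (r * gauss_mean r (dxi b \<theta>) p)\<bar> \<partial>lborel)"
    unfolding heat_potential_eq[OF test_fun_dxi[OF \<theta>(1)]] by (rule integral_abs_bound)
  also have "\<dots> \<le> (\<integral>r. indicator {0..\<rho>} r * gauss_moment TYPE('a) \<partial>lborel)"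
  proof (rule integral_mono')
    show "integrable lborel (\<lambda>r. indicator {0..\<rho>} r * gauss_moment TYPE('a))"
      by (intro integrable_mult_left integrable_indicator_Icc)
    show "\<bar>indicator {0..\<rho>} r * (r * gauss_mean r (dxi b \<theta>) p)\<bar> \<le> indicator {0..\<rho>} r * gauss_moment TYPE('a)" for r
      unfolding abs_mult[of "indicator _ _"] using abs_gauss_mean_dxi_le[of r p] by (auto simp: indicator_def)
  qed (simp add: gauss_moment_nonneg)
  also have "\<dots> = gauss_moment TYPE('a) * \<rho>" using \<rho> by (simp add: content_real)
  finally show ?thesis .
qed

lemma heat_parametrix:
  assumes \<rho>: "0 < \<rho>"
  obtains W V where "smooth_fun W" "smooth_fun V"
    "\<And>p. \<bar>W p\<bar> \<le> gauss_moment TYPE('a) * \<rho>" "\<And>p. \<bar>V p\<bar> \<le> gauss_moment TYPE('a) / \<rho>"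
    "\<And>p. dt W p + lapx W p = V p - dxi b \<theta> p"
proof (rule that[of "heat_potential \<rho> (dxi b \<theta>)" "gauss_mean \<rho> (dxi b \<theta>)"])
  note h = test_fun_dxi[OF \<theta>(1), where b=b]
  show "smooth_fun (heat_potential \<rho> (dxi b \<theta>))"
    unfolding heat_potential_def by (rule smooth_fun_average[OF integrable_heat_weight _ h]) simp
  show "smooth_fun (gauss_mean \<rho> (dxi b \<theta>))"
    unfolding gauss_mean_def by (rule smooth_fun_average[OF integrable_gauss heat_shift_slice_measurable h])
  fix p
  show "\<bar>heat_potential \<rho> (dxi b \<theta>) p\<bar> \<le> gauss_moment TYPE('a) * \<rho>"
    by (rule abs_heat_potential_dxi_le) (use \<rho> in simp)
  show "\<bar>gauss_mean \<rho> (dxi b \<theta>) p\<bar> \<le> gauss_moment TYPE('a) / \<rho>"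
    using abs_gauss_mean_dxi_le[of \<rho> p] \<rho> by (simp add: abs_mult pos_le_divide_eq mult.commute)
  show "dt (heat_potential \<rho> (dxi b \<theta>)) p + lapx (heat_potential \<rho> (dxi b \<theta>)) p
      = gauss_mean \<rho> (dxi b \<theta>) p - dxi b \<theta> p"
    unfolding heat_operator_heat_potential[OF h] by (rule heat_potential_heat_operator[OF h]) (use \<rho> in simp)
qed

end

section \<open>The Riesz representation theorem for open subsets of Euclidean space\<close>

lemma Cc_fun_split:
  fixes f :: "'a::euclidean_space \<Rightarrow> real"
  assumes f: "Cc_fun (A \<union> B) f" and "open A" "open B"
  obtains \<eta> where "\<And>x. 0 \<le> \<eta> x" "\<And>x. \<eta> x \<le> 1" "Cc_fun A (\<lambda>x. \<eta> x * f x)" "Cc_fun B (\<lambda>x. (1 - \<eta> x) * f x)"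
proof -
  obtain K where K: "compact K" "K \<subseteq> A \<union> B" "\<And>x. x \<notin> K \<Longrightarrow> f x = 0"
    using f by (auto simp: Cc_fun_iff elim: supported_inE)
  have "compact (K - B)" "K - B \<subseteq> A" using K \<open>open B\<close> by (auto intro: compact_diff)
  then obtain \<eta> V where \<eta>: "test_fun A \<eta>" "\<And>x. 0 \<le> \<eta> x" "\<And>x. \<eta> x \<le> 1"
    and V: "open V" "K - B \<subseteq> V" "\<And>x. x \<in> V \<Longrightarrow> \<eta> x = 1"
    by (rule test_fun_cutoff[OF _ _ \<open>open A\<close>]) blast
  have cont: "continuous_on UNIV f" "continuous_on UNIV \<eta>"
    using f \<eta>(1) by (auto intro: Cc_fun_continuous_on test_fun_imp_Cc_fun)
  show ?thesis
  proof (rule that[of \<eta>])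
    show "Cc_fun A (\<lambda>x. \<eta> x * f x)"
      using test_fun_imp_Cc_fun[OF \<eta>(1)] by (rule Cc_fun_dominated) (auto intro!: continuous_intros cont)
    have "supported_in B (\<lambda>x. (1 - \<eta> x) * f x)"
      using K V by (intro supported_inI[of "K - V"]) (auto intro: compact_diff)
    then show "Cc_fun B (\<lambda>x. (1 - \<eta> x) * f x)"
      by (auto simp: Cc_fun_iff intro!: continuous_intros cont)
  qed (rule \<eta>)+
qed

locale positive_functional =
  fixes U :: "'a::euclidean_space set" and \<Lambda> :: "('a \<Rightarrow> real) \<Rightarrow> real"
  assumes open_U: "open U"
    and add: "Cc_fun U f \<Longrightarrow> Cc_fun U g \<Longrightarrow> \<Lambda> (\<lambda>x. f x + g x) = \<Lambda> f + \<Lambda> g"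
    and scale: "Cc_fun U f \<Longrightarrow> \<Lambda> (\<lambda>x. c * f x) = c * \<Lambda> f"
    and nonneg: "Cc_fun U f \<Longrightarrow> (\<And>x. 0 \<le> f x) \<Longrightarrow> 0 \<le> \<Lambda> f"
begin

lemma zero: "\<Lambda> (\<lambda>x. 0) = 0"
  using scale[OF Cc_fun_zero, of 0] by simp

lemma sum: "(\<And>i. i \<in> I \<Longrightarrow> Cc_fun U (f i)) \<Longrightarrow> \<Lambda> (\<lambda>x. \<Sum>i\<in>I. f i x) = (\<Sum>i\<in>I. \<Lambda> (f i))"
  by (induction I rule: infinite_finite_induct) (auto simp: zero add Cc_fun_sum)

lemma mono:
  assumes f: "Cc_fun U f" and g: "Cc_fun U g" and le: "\<And>x. f x \<le> g x"
  shows "\<Lambda> f \<le> \<Lambda> g"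
proof -
  have "0 \<le> \<Lambda> (\<lambda>x. g x + (-1) * f x)"
    by (rule nonneg[OF Cc_fun_add[OF g Cc_fun_cmult[OF f]]]) (use le in simp)
  then show ?thesis unfolding add[OF g Cc_fun_cmult[OF f]] scale[OF f] by simp
qed

definition below :: "'a set \<Rightarrow> ('a \<Rightarrow> real) set" where
  "below V = {f. Cc_fun (U \<inter> V) f \<and> (\<forall>x. 0 \<le> f x \<and> f x \<le> 1)}"

definition open_mass :: "'a set \<Rightarrow> ennreal" where
  "open_mass V = (SUP f\<in>below V. ennreal (\<Lambda> f))"

definition outer :: "'a set \<Rightarrow> ennreal" where
  "outer A = (INF V\<in>{V. open V \<and> A \<subseteq> V}. open_mass V)"

lemma belowD:
  assumes "f \<in> below V"
  shows "Cc_fun U f" "Cc_fun (U \<inter> V) f" "0 \<le> f x" "f x \<le> 1" "x \<notin> V \<Longrightarrow> f x = 0"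
  using assms supported_in_eq_0[of "U \<inter> V" f x] by (auto simp: below_def Cc_fun_iff intro: supported_in_mono)

lemma zero_in_below: "(\<lambda>x. 0) \<in> below V"
  by (simp add: below_def Cc_fun_zero)

lemma functional_le_open_mass: "f \<in> below V \<Longrightarrow> ennreal (\<Lambda> f) \<le> open_mass V"
  unfolding open_mass_def by (rule SUP_upper)

lemma open_mass_mono: "V \<subseteq> W \<Longrightarrow> open_mass V \<le> open_mass W"
  unfolding open_mass_def by (intro SUP_subset_mono) (auto simp: below_def intro: Cc_fun_mono)

lemma open_mass_empty: "open_mass {} = 0"
proof -
  have "ennreal (\<Lambda> f) \<le> 0" if "f \<in> below {}" for f
  proof -
    have "f = (\<lambda>x. 0)" using belowD(5)[OF that] by auto
    then show ?thesis by (simp add: zero)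
  qed
  then have "open_mass {} \<le> 0" unfolding open_mass_def by (rule SUP_least)
  then show ?thesis by simp
qed

lemma open_mass_Un:
  assumes V: "open V" and W: "open W"
  shows "open_mass (V \<union> W) \<le> open_mass V + open_mass W"
  unfolding open_mass_def[of "V \<union> W"]
proof (rule SUP_least)
  fix f assume f: "f \<in> below (V \<union> W)"
  then have "Cc_fun (U \<inter> V \<union> U \<inter> W) f" by (simp add: below_def Int_Un_distrib)
  then obtain \<eta> where \<eta>: "\<And>x. 0 \<le> \<eta> x" "\<And>x. \<eta> x \<le> 1"
    and split: "Cc_fun (U \<inter> V) (\<lambda>x. \<eta> x * f x)" "Cc_fun (U \<inter> W) (\<lambda>x. (1 - \<eta> x) * f x)"
    using open_U V W by (blast intro: Cc_fun_split open_Int)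
  have V': "(\<lambda>x. \<eta> x * f x) \<in> below V" and W': "(\<lambda>x. (1 - \<eta> x) * f x) \<in> below W"
    using split \<eta> belowD(3,4)[OF f] by (auto simp: below_def intro!: mult_le_one)
  have "f = (\<lambda>x. \<eta> x * f x + (1 - \<eta> x) * f x)" by (simp add: algebra_simps)
  then have "\<Lambda> f = \<Lambda> (\<lambda>x. \<eta> x * f x) + \<Lambda> (\<lambda>x. (1 - \<eta> x) * f x)"
    using add[OF belowD(1)[OF V'] belowD(1)[OF W']] by simp
  then have "ennreal (\<Lambda> f) = ennreal (\<Lambda> (\<lambda>x. \<eta> x * f x)) + ennreal (\<Lambda> (\<lambda>x. (1 - \<eta> x) * f x))"
    using nonneg[OF belowD(1,3)[OF V']] nonneg[OF belowD(1,3)[OF W']] by simp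
  also have "\<dots> \<le> open_mass V + open_mass W"
    by (intro add_mono functional_le_open_mass V' W')
  finally show "ennreal (\<Lambda> f) \<le> open_mass V + open_mass W" .
qed

lemma open_mass_UN:
  fixes V :: "nat \<Rightarrow> 'a set"
  assumes V: "\<And>i. open (V i)"
  shows "open_mass (\<Union>i. V i) \<le> (\<Sum>i. open_mass (V i))"
  unfolding open_mass_def[of "\<Union>i. V i"]
proof (rule SUP_least)
  fix f assume f: "f \<in> below (\<Union>i. V i)"
  then have K: "compact (tsupport f)" "tsupport f \<subseteq> U" "tsupport f \<subseteq> (\<Union>i. V i)"
    by (auto simp: below_def Cc_fun_def)
  obtain I where I: "finite I" "tsupport f \<subseteq> (\<Union>i\<in>I. V i)"
    by (rule compactE_image[OF K(1), of UNIV V]) (use V K in auto)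
  then obtain n where "I \<subseteq> {..<n}" using finite_nat_iff_bounded by blast
  with I(2) have n: "tsupport f \<subseteq> (\<Union>i<n. V i)" by auto
  have "open_mass (\<Union>i<n. V i) \<le> (\<Sum>i<n. open_mass (V i))" for n
  proof (induction n)
    case (Suc n)
    have "open_mass (\<Union>i<Suc n. V i) \<le> open_mass (\<Union>i<n. V i) + open_mass (V n)"
      using open_mass_Un[of "\<Union>i<n. V i" "V n"] V by (auto simp: lessThan_Suc Un_commute)
    then show ?case using Suc by (auto intro: order_trans add_right_mono)
  qed (simp add: open_mass_empty)
  moreover have "f \<in> below (\<Union>i<n. V i)"
    using f K n by (auto simp: below_def Cc_fun_def)
  ultimately have "ennreal (\<Lambda> f) \<le> (\<Sum>i<n. open_mass (V i))"
    using functional_le_open_mass order_trans by blast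
  also have "\<dots> \<le> (\<Sum>i. open_mass (V i))" by (rule sum_le_suminf) auto
  finally show "ennreal (\<Lambda> f) \<le> (\<Sum>i. open_mass (V i))" .
qed

lemma outer_open: "open V \<Longrightarrow> outer V = open_mass V"
  unfolding outer_def by (intro antisym INF_lower INF_greatest) (auto intro: open_mass_mono)

lemma outer_mono: "A \<subseteq> B \<Longrightarrow> outer A \<le> outer B"
  unfolding outer_def by (rule INF_superset_mono) auto

lemma outer_UN:
  fixes A :: "nat \<Rightarrow> 'a set"
  shows "outer (\<Union>i. A i) \<le> (\<Sum>i. outer (A i))"
proof (rule ennreal_le_epsilon)
  fix e :: real assume e: "0 < e" and fin: "(\<Sum>i. outer (A i)) < top"
  have "outer (A i) < outer (A i) + e * (1/2)^Suc i" for i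
    using fin e by (auto simp add: less_top dest!: ennreal_suminf_lessD)
  then have "\<exists>V. open V \<and> A i \<subseteq> V \<and> open_mass V < outer (A i) + e * (1/2)^Suc i" for i
    unfolding outer_def INF_less_iff by blast
  then obtain V where V: "\<And>i. open (V i)" "\<And>i. A i \<subseteq> V i"
    "\<And>i. open_mass (V i) < outer (A i) + e * (1/2)^Suc i" by metis
  have "outer (\<Union>i. A i) \<le> outer (\<Union>i. V i)" by (rule outer_mono) (use V(2) in blast)
  also have "\<dots> = open_mass (\<Union>i. V i)" by (rule outer_open) (use V(1) in blast)
  also have "\<dots> \<le> (\<Sum>i. open_mass (V i))" by (rule open_mass_UN[OF V(1)])
  also have "\<dots> \<le> (\<Sum>i. outer (A i) + e * (1/2) ^ Suc i)"
    by (intro suminf_le less_imp_le V(3)) auto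
  also have "\<dots> = (\<Sum>i. outer (A i)) + (\<Sum>i. ennreal e * ennreal ((1/2) ^ Suc i))"
    using e by (subst suminf_add[symmetric])
      (auto simp del: ennreal_suminf_cmult simp add: ennreal_mult[symmetric])
  also have "\<dots> = (\<Sum>i. outer (A i)) + e"
    unfolding ennreal_suminf_cmult
    by (subst suminf_ennreal_eq[OF zero_le_power power_half_series]) auto
  finally show "outer (\<Union>i. A i) \<le> (\<Sum>i. outer (A i)) + ennreal e" .
qed

lemma outer_measure_space: "outer_measure_space (Pow UNIV) outer"
  unfolding outer_measure_space_def positive_def increasing_def countably_subadditive_def
  using outer_open[of "{}"] open_mass_empty outer_mono outer_UN by auto

lemma outer_disjoint_Un: "A \<inter> B = {} \<Longrightarrow> outer (A \<union> B) \<le> outer A + outer B"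
  using ring_of_sets.countably_subadditive_subadditive[OF ring_of_sets_Pow, of UNIV outer] outer_measure_space
  by (auto simp: outer_measure_space_def subadditive_def)

lemma functional_plus_outer_le_open_mass:
  assumes f: "f \<in> below (V \<inter> W)" and W: "open W"
  shows "ennreal (\<Lambda> f) + outer (W - V) \<le> open_mass W"
proof -
  have K: "compact (tsupport f)" "tsupport f \<subseteq> U \<inter> (V \<inter> W)"
    using f by (auto simp: below_def Cc_fun_def)
  have "open (W - tsupport f)" using W compact_imp_closed[OF K(1)] by (rule open_Diff)
  then have "outer (W - V) \<le> open_mass (W - tsupport f)"
    using outer_mono[of "W - V" "W - tsupport f"] K(2) by (auto simp: outer_open)
  then have "ennreal (\<Lambda> f) + outer (W - V) \<le> ennreal (\<Lambda> f) + (SUP g\<in>below (W - tsupport f). ennreal (\<Lambda> g))"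
    unfolding open_mass_def by (rule add_left_mono)
  also have "\<dots> = (SUP g\<in>below (W - tsupport f). ennreal (\<Lambda> f) + ennreal (\<Lambda> g))"
    using zero_in_below by (subst ennreal_SUP_add_right) auto
  also have "\<dots> \<le> open_mass W"
  proof (rule SUP_least)
    fix g assume g: "g \<in> below (W - tsupport f)"
    have "(\<lambda>x. f x + g x) \<in> below W"
      unfolding below_def
    proof (intro CollectI conjI allI Cc_fun_add)
      show "Cc_fun (U \<inter> W) f" "Cc_fun (U \<inter> W) g"
        using belowD(2)[OF f] belowD(2)[OF g] by (auto intro: Cc_fun_mono)
      fix x
      show "0 \<le> f x + g x" using belowD(3)[OF f, of x] belowD(3)[OF g, of x] by simp
      show "f x + g x \<le> 1"
        using belowD(4)[OF f, of x] belowD(4,5)[OF g, of x] not_in_tsupport[of x f]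
        by (cases "x \<in> tsupport f") auto
    qed
    from functional_le_open_mass[OF this]
    show "ennreal (\<Lambda> f) + ennreal (\<Lambda> g) \<le> open_mass W"
      using nonneg[OF belowD(1,3)[OF f]] nonneg[OF belowD(1,3)[OF g]] add[OF belowD(1)[OF f] belowD(1)[OF g]]
      by simp
  qed
  finally show ?thesis .
qed

lemma open_in_lambda_system:
  assumes V: "open V"
  shows "V \<in> lambda_system UNIV (Pow UNIV) outer"
  unfolding lambda_system_def
proof (intro CollectI conjI ballI antisym)
  fix A :: "'a set"
  show "outer (V \<inter> A) + outer ((UNIV - V) \<inter> A) \<le> outer A"
    unfolding outer_def[of A]
  proof (rule INF_greatest)
    fix W assume "W \<in> {W. open W \<and> A \<subseteq> W}"
    then have W: "open W" "A \<subseteq> W" by auto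
    have "outer (V \<inter> A) \<le> open_mass (V \<inter> W)"
      using outer_mono[of "V \<inter> A" "V \<inter> W"] W V by (simp add: outer_open open_Int le_infI2)
    moreover have "outer ((UNIV - V) \<inter> A) \<le> outer (W - V)"
      using W by (intro outer_mono) auto
    moreover have "open_mass (V \<inter> W) + outer (W - V) \<le> open_mass W"
    proof -
      have "open_mass (V \<inter> W) + outer (W - V) = (SUP f\<in>below (V \<inter> W). ennreal (\<Lambda> f) + outer (W - V))"
        unfolding open_mass_def using zero_in_below by (subst ennreal_SUP_add_left) auto
      also have "\<dots> \<le> open_mass W" by (intro SUP_least functional_plus_outer_le_open_mass W)
      finally show ?thesis .
    qed
    ultimately show "outer (V \<inter> A) + outer ((UNIV - V) \<inter> A) \<le> open_mass W"
      by (meson add_mono order_trans)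
  qed
  have "V \<inter> A \<union> (UNIV - V) \<inter> A = A" by auto
  then show "outer A \<le> outer (V \<inter> A) + outer ((UNIV - V) \<inter> A)"
    using outer_disjoint_Un[of "V \<inter> A" "(UNIV - V) \<inter> A"] by (simp only:) auto
qed simp

definition riesz :: "'a measure" where
  "riesz = measure_of UNIV (sets borel) outer"

lemma sets_riesz [simp, measurable_cong]: "sets riesz = sets borel"
  unfolding riesz_def using sets.sigma_sets_eq[of "borel::'a measure"]
  by (simp_all add: sets_measure_of)

lemma emeasure_riesz:
  assumes "A \<in> sets borel"
  shows "emeasure riesz A = outer A"
proof -
  have caratheodory: "measure_space UNIV (lambda_system UNIV (Pow UNIV) outer) outer"
    by (rule sigma_algebra.caratheodory_lemma[OF sigma_algebra_Pow outer_measure_space])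
  then have "sigma_algebra UNIV (lambda_system UNIV (Pow UNIV) outer)"
    by (simp add: measure_space_def)
  then have "sets borel \<subseteq> lambda_system UNIV (Pow UNIV) outer"
    unfolding borel_def sets_measure_of[OF subset_UNIV[of "{S. open S}", unfolded Pow_UNIV[symmetric]]]
    by (rule sigma_algebra.sigma_sets_subset) (use open_in_lambda_system in auto)
  then have "measure_space UNIV (sets borel) outer"
    using measure_down[OF caratheodory] sets.sigma_algebra_axioms[of borel] by simp
  then show ?thesis
    unfolding riesz_def measure_space_def using assms by (intro emeasure_measure_of_sigma) auto
qed

lemma functional_le_emeasure_riesz: "open V \<Longrightarrow> f \<in> below V \<Longrightarrow> ennreal (\<Lambda> f) \<le> emeasure riesz V"
  by (simp add: emeasure_riesz outer_open functional_le_open_mass)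

lemma emeasure_riesz_le_functional:
  assumes f: "Cc_fun U f" "\<And>x. 0 \<le> f x" and V: "open V" "\<And>x. x \<in> V \<Longrightarrow> 1 \<le> f x"
  shows "emeasure riesz V \<le> ennreal (\<Lambda> f)"
proof -
  have "ennreal (\<Lambda> g) \<le> ennreal (\<Lambda> f)" if g: "g \<in> below V" for g
  proof (intro ennreal_leI mono belowD(1)[OF g] f(1))
    show "g x \<le> f x" for x
      using belowD(4,5)[OF g, of x] f(2)[of x] V(2)[of x] by (cases "x \<in> V") auto
  qed
  then show ?thesis using V by (simp add: emeasure_riesz outer_open open_mass_def SUP_least)
qed

lemma riesz_finite_neighbourhood:
  assumes K: "compact K" "K \<subseteq> U"
  obtains V where "open V" "K \<subseteq> V" "emeasure riesz V < \<infinity>"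
proof -
  obtain \<eta> V where \<eta>: "test_fun U \<eta>" "\<And>x. 0 \<le> \<eta> x" "\<And>x. \<eta> x \<le> 1"
    and V: "open V" "K \<subseteq> V" "\<And>x. x \<in> V \<Longrightarrow> \<eta> x = 1"
    by (rule test_fun_cutoff[OF K open_U]) blast
  have "emeasure riesz V \<le> ennreal (\<Lambda> \<eta>)"
    using V by (intro emeasure_riesz_le_functional test_fun_imp_Cc_fun[OF \<eta>(1)] \<eta>(2)) auto
  then show ?thesis using that[OF V(1,2)] by (simp add: le_less_trans[OF _ ennreal_less_top])
qed

lemma emeasure_riesz_compact:
  assumes "compact K" "K \<subseteq> U"
  shows "emeasure riesz K < \<infinity>"
proof -
  obtain V where "open V" "K \<subseteq> V" "emeasure riesz V < \<infinity>" by (rule riesz_finite_neighbourhood[OF assms])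
  then show ?thesis using emeasure_mono[of K V riesz] by (auto intro: le_less_trans)
qed

lemma integrable_riesz:
  assumes f: "Cc_fun U f"
  shows "integrable riesz f"
proof -
  obtain B where B: "0 < B" "\<And>x. \<bar>f x\<bar> \<le> B" by (rule Cc_fun_bounded[OF f]) blast
  have K: "compact (tsupport f)" "tsupport f \<subseteq> U" using f by (auto simp: Cc_fun_def)
  show ?thesis
  proof (rule Bochner_Integration.integrable_bound)
    show "integrable riesz (\<lambda>x. B * indicator (tsupport f) x)"
      using emeasure_riesz_compact[OF K] borel_compact[OF K(1)]
      by (intro integrable_mult_right integrable_real_indicator) auto
    show "f \<in> borel_measurable riesz"
      using Cc_fun_measurable[OF f] by (simp add: measurable_cong_sets[OF sets_riesz refl])
    show "AE x in riesz. norm (f x) \<le> norm (B * indicator (tsupport f) x)"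
      using B not_in_tsupport[of _ f] by (intro AE_I2) (auto simp: indicator_def)
  qed
qed

lemma sum_unit_slices:
  assumes "0 \<le> t" "t \<le> real n"
  shows "(\<Sum>k<n. max 0 (min 1 (t - real k))) = t"
proof -
  have "(\<Sum>k<n. max 0 (min 1 (t - real k))) = max 0 (min (real n) t)"
    by (induction n) (auto simp: max_def min_def)
  then show ?thesis using assms by simp
qed

lemma riesz_integral_unit_slice:
  fixes k :: nat
  assumes f: "Cc_fun U f" and V: "open V" "tsupport f \<subseteq> V" "emeasure riesz V < \<infinity>"
  defines "g \<equiv> (\<lambda>x. max 0 (min 1 (f x - real k)))" and "A \<equiv> (\<lambda>k. {x \<in> V. real k - 1 < f x})"
  shows "Cc_fun U g" "\<bar>(\<integral>x. g x \<partial>riesz) - \<Lambda> g\<bar> \<le> measure riesz (A k) - measure riesz (A (k + 2))"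
proof -
  have cont: "continuous_on S f" for S by (rule Cc_fun_continuous_on[OF f])
  have A: "open (A j)" for j
    unfolding A_def Collect_conj_eq Collect_mem_eq using V(1)
    by (intro open_Int open_Collect_less continuous_intros cont) auto
  have A_fin: "emeasure riesz (A j) < \<infinity>" for j
    using V emeasure_mono[of "A j" V riesz] by (auto simp: A_def intro: le_less_trans)
  show g: "Cc_fun U g"
    unfolding g_def by (rule Cc_fun_dominated[OF f]) (auto intro!: continuous_intros cont)
  have g_below: "g \<in> below (A k)"
  proof -
    have "closed {x. real k \<le> f x}" by (intro closed_Collect_le continuous_intros cont)
    moreover have "compact (tsupport f)" "tsupport f \<subseteq> U" using f by (auto simp: Cc_fun_def)
    moreover have "g x = 0" if "x \<notin> tsupport f \<inter> {x. real k \<le> f x}" for x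
      using that not_in_tsupport[of x f] by (auto simp: g_def)
    ultimately have "supported_in (U \<inter> A k) g"
      using V(2) by (intro supported_inI[of "tsupport f \<inter> {x. real k \<le> f x}"]) (auto simp: A_def compact_Int_closed)
    then show ?thesis
      using g by (auto simp: below_def Cc_fun_iff g_def)
  qed
  have g_ge_1: "1 \<le> g x" if "x \<in> A (k + 2)" for x using that by (simp add: A_def g_def)
  have measure_eq: "emeasure riesz (A j) = ennreal (measure riesz (A j))" for j
    using A_fin[of j] by (intro emeasure_eq_ennreal_measure) auto
  have integrable_A: "integrable riesz (\<lambda>x. indicator (A j) x :: real)" for j
    using A A_fin by (intro integrable_real_indicator) auto
  have "\<Lambda> g \<le> measure riesz (A k)"
    using functional_le_emeasure_riesz[OF A g_below] measure_nonneg by (simp add: measure_eq)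
  moreover have "measure riesz (A (k + 2)) \<le> \<Lambda> g"
    using emeasure_riesz_le_functional[OF g belowD(3)[OF g_below] A g_ge_1] nonneg[OF g belowD(3)[OF g_below]]
    by (simp add: measure_eq)
  moreover have "(\<integral>x. g x \<partial>riesz) \<le> (\<integral>x. indicator (A k) x \<partial>riesz)"
    by (intro integral_mono integrable_riesz g integrable_A)
      (use belowD(4,5)[OF g_below] in \<open>auto simp: indicator_def\<close>)
  moreover have "(\<integral>x. indicator (A (k + 2)) x \<partial>riesz) \<le> (\<integral>x. g x \<partial>riesz)"
    by (intro integral_mono integrable_riesz g integrable_A)
      (use belowD(3)[OF g_below] g_ge_1 in \<open>auto simp: indicator_def\<close>)
  ultimately show "\<bar>(\<integral>x. g x \<partial>riesz) - \<Lambda> g\<bar> \<le> measure riesz (A k) - measure riesz (A (k + 2))"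
    using A by simp
qed

lemma riesz_integral_approx:
  assumes f: "Cc_fun U f" "\<And>x. 0 \<le> f x" and V: "open V" "tsupport f \<subseteq> V" "emeasure riesz V < \<infinity>"
  shows "\<bar>(\<integral>x. f x \<partial>riesz) - \<Lambda> f\<bar> \<le> 2 * measure riesz V"
proof -
  obtain B where "\<And>x. \<bar>f x\<bar> \<le> B" by (rule Cc_fun_bounded[OF f(1)]) blast
  then have n: "f x \<le> real (nat \<lceil>B\<rceil>)" for x by (meson abs_le_D1 order_trans real_nat_ceiling_ge)
  define n where "n = nat \<lceil>B\<rceil>"
  define g where "g k x = max 0 (min 1 (f x - real k))" for k :: nat and x
  define m where "m k = measure riesz {x \<in> V. real k - 1 < f x}" for k :: nat
  have g: "Cc_fun U (g k)" and slice: "\<bar>(\<integral>x. g k x \<partial>riesz) - \<Lambda> (g k)\<bar> \<le> m k - m (k + 2)" for k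
    using riesz_integral_unit_slice[OF f(1) V, of k] unfolding g_def m_def by auto
  have f_eq: "f = (\<lambda>x. \<Sum>k<n. g k x)"
    unfolding g_def n_def using sum_unit_slices[OF f(2) n] by simp
  have "\<bar>(\<integral>x. f x \<partial>riesz) - \<Lambda> f\<bar> = \<bar>\<Sum>k<n. (\<integral>x. g k x \<partial>riesz) - \<Lambda> (g k)\<bar>"
    unfolding f_eq sum[OF g] using integrable_riesz[OF g] by (simp add: sum_subtractf)
  also have "\<dots> \<le> (\<Sum>k<n. m k - m (k + 2))"
    by (rule order_trans[OF sum_abs sum_mono[OF slice]])
  also have "\<dots> = m 0 + m 1 - m n - m (n + 1)" by (induction n) auto
  also have "\<dots> \<le> 2 * measure riesz V"
  proof -
    have "open {x. real k - 1 < f x}" for k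
      by (intro open_Collect_less continuous_intros Cc_fun_continuous_on[OF f(1)])
    then have "m k \<le> measure riesz V" "0 \<le> m k" for k
      unfolding m_def Collect_conj_eq Collect_mem_eq using V
      by (auto intro!: measure_mono_fmeasurable simp: fmeasurable_def)
    from this(1)[of 0] this(1)[of 1] this(2)[of n] this(2)[of "n + 1"] show ?thesis by linarith
  qed
  finally show ?thesis .
qed

lemma riesz_integral_nonneg:
  assumes f: "Cc_fun U f" "\<And>x. 0 \<le> f x"
  shows "(\<integral>x. f x \<partial>riesz) = \<Lambda> f"
proof -
  obtain V where V: "open V" "tsupport f \<subseteq> V" "emeasure riesz V < \<infinity>"
    by (rule riesz_finite_neighbourhood[of "tsupport f"]) (use f(1) in \<open>auto simp: Cc_fun_def\<close>)
  have "real n * \<bar>(\<integral>x. f x \<partial>riesz) - \<Lambda> f\<bar> \<le> 2 * measure riesz V" if "0 < n" for n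
  proof -
    have "tsupport (\<lambda>x. real n * f x) = tsupport f" using that by (simp add: tsupport_def)
    then have "\<bar>(\<integral>x. real n * f x \<partial>riesz) - \<Lambda> (\<lambda>x. real n * f x)\<bar> \<le> 2 * measure riesz V"
      using f V by (intro riesz_integral_approx Cc_fun_cmult) auto
    then show ?thesis by (simp add: scale[OF f(1)] abs_mult flip: right_diff_distrib)
  qed
  then have "\<bar>(\<integral>x. f x \<partial>riesz) - \<Lambda> f\<bar> = 0" by (intro real_archimedian_rdiv_eq_0) auto
  then show ?thesis by simp
qed

lemma riesz_integral:
  assumes f: "Cc_fun U f"
  shows "(\<integral>x. f x \<partial>riesz) = \<Lambda> f"
proof -
  have pos: "Cc_fun U (\<lambda>x. max 0 (f x))" and neg: "Cc_fun U (\<lambda>x. max 0 (- f x))"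
    by (rule Cc_fun_dominated[OF f]; auto intro!: continuous_intros Cc_fun_continuous_on[OF f])+
  have f_eq: "f = (\<lambda>x. max 0 (f x) + (- 1) * max 0 (- f x))" by (auto simp: max_def)
  have "\<Lambda> f = \<Lambda> (\<lambda>x. max 0 (f x)) + (- 1) * \<Lambda> (\<lambda>x. max 0 (- f x))"
    by (subst f_eq) (simp only: add[OF pos Cc_fun_cmult[OF neg]] scale[OF neg])
  moreover have "(\<integral>x. f x \<partial>riesz) = (\<integral>x. max 0 (f x) \<partial>riesz) + (- 1) * (\<integral>x. max 0 (- f x) \<partial>riesz)"
    by (subst f_eq, subst Bochner_Integration.integral_add)
      (use integrable_riesz[OF pos] integrable_riesz[OF neg] in auto)
  ultimately show ?thesis
    using riesz_integral_nonneg[OF pos] riesz_integral_nonneg[OF neg] by simp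
qed

theorem riesz_representation:
  "\<exists>\<mu>. radon_on U \<mu> \<and> (\<forall>f. Cc_fun U f \<longrightarrow> (\<integral>x. f x \<partial>\<mu>) = \<Lambda> f)"
proof (intro exI[of _ "density riesz (indicator U)"] conjI allI impI)
  have U: "U \<in> sets borel" using open_U by simp
  have emeasure: "emeasure (density riesz (indicator U)) A = emeasure riesz (U \<inter> A)" if "A \<in> sets borel" for A
    using that U by (subst emeasure_density) (auto simp: indicator_inter_arith[symmetric])
  show "radon_on U (density riesz (indicator U))"
    unfolding radon_on_def
  proof (intro conjI allI impI)
    show "emeasure (density riesz (indicator U)) (UNIV - U) = 0"
      using U by (subst emeasure) auto
    show "emeasure (density riesz (indicator U)) K < \<infinity>" if "compact K \<and> K \<subseteq> U" for K
      using that emeasure_riesz_compact[of K] by (subst emeasure) (auto simp: compact_imp_closed Int_absorb1)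
  qed simp
  fix f assume f: "Cc_fun U f"
  then have "(\<integral>x. f x \<partial>density riesz (\<lambda>x. ennreal (indicator U x))) = (\<integral>x. indicator U x * f x \<partial>riesz)"
    using U integrable_riesz by (subst integral_density) auto
  also have "(\<lambda>x. indicator U x * f x) = f"
    using f supported_in_eq_0[of U f] by (auto simp: Cc_fun_iff indicator_def fun_eq_iff)
  finally show "(\<integral>x. f x \<partial>density riesz (indicator U)) = \<Lambda> f"
    by (simp add: riesz_integral[OF f] ennreal_indicator)
qed

end

section \<open>Local integrability and integration over slices\<close>

definition locally_integrable :: "'a::euclidean_space set \<Rightarrow> ('a \<Rightarrow> real) \<Rightarrow> bool" where
  "locally_integrable S F \<longleftrightarrow> (\<forall>K. compact K \<longrightarrow> K \<subseteq> S \<longrightarrow> set_integrable lebesgue K F)"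

lemma locally_integrable_abs: "locally_integrable S F \<Longrightarrow> locally_integrable S (\<lambda>p. \<bar>F p\<bar>)"
  unfolding locally_integrable_def by (auto intro: set_integrable_abs)

lemma locally_integrable_add:
  "locally_integrable S F \<Longrightarrow> locally_integrable S G \<Longrightarrow> locally_integrable S (\<lambda>p. F p + G p)"
  unfolding locally_integrable_def by (auto intro: set_integral_add)

lemma locally_integrable_const: "locally_integrable S (\<lambda>p. c)"
  unfolding locally_integrable_def
proof (intro allI impI)
  fix K :: "'a set" assume "compact K"
  then have "K \<in> lmeasurable" by (rule lmeasurable_compact)
  then have "integrable lebesgue (indicator K :: 'a \<Rightarrow> real)"
    by (intro integrable_real_indicator) (auto simp: fmeasurable_def)
  then show "set_integrable lebesgue K (\<lambda>p. c)" by (simp add: set_integrable_def)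
qed

lemma locally_integrable_sum:
  "(\<And>i. i \<in> I \<Longrightarrow> locally_integrable S (F i)) \<Longrightarrow> locally_integrable S (\<lambda>p. \<Sum>i\<in>I. F i p)"
  by (induction I rule: infinite_finite_induct) (auto simp: locally_integrable_const locally_integrable_add)

lemma integrable_mult_locally_integrable:
  assumes F: "locally_integrable S F" and w: "w \<in> borel_measurable lebesgue" "\<And>x. \<bar>w x\<bar> \<le> B" "supported_in S w"
  shows "integrable lebesgue (\<lambda>x. F x * w x)"
proof -
  obtain K where K: "compact K" "K \<subseteq> S" "\<And>x. x \<notin> K \<Longrightarrow> w x = 0" using w(3) by (rule supported_inE) blast
  have FK: "integrable lebesgue (\<lambda>x. indicator K x * F x)"
    using F K by (simp add: locally_integrable_def set_integrable_def)
  have "integrable lebesgue (\<lambda>x. indicator K x * F x * w x)"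
  proof (rule Bochner_Integration.integrable_bound[OF integrable_mult_right[OF FK, of B]])
    show "(\<lambda>x. indicator K x * F x * w x) \<in> borel_measurable lebesgue"
      using borel_measurable_integrable[OF FK] w(1) by (rule borel_measurable_times)
    have "\<bar>w x\<bar> \<le> \<bar>B\<bar>" for x using w(2)[of x] by linarith
    then show "AE x in lebesgue. norm (indicator K x * F x * w x) \<le> norm (B * (indicator K x * F x))"
      by (intro AE_I2) (simp add: abs_mult mult.commute[of "\<bar>B\<bar>"] mult_left_mono)
  qed
  moreover have "(\<lambda>x. indicator K x * F x * w x) = (\<lambda>x. F x * w x)"
    using K(3) by (auto simp: indicator_def fun_eq_iff)
  ultimately show ?thesis by simp
qed

lemma integrable_mult_Cc_fun:
  assumes F: "locally_integrable S F" and w: "Cc_fun S w"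
  shows "integrable lebesgue (\<lambda>x. F x * w x)"
proof -
  obtain B where B: "\<And>x. \<bar>w x\<bar> \<le> B" by (rule Cc_fun_bounded[OF w]) blast
  show ?thesis
    using F _ B
  proof (rule integrable_mult_locally_integrable)
    show "w \<in> borel_measurable lebesgue" using Cc_fun_measurable[OF w] by (intro measurable_completion) simp
    show "supported_in S w" using w by (simp add: Cc_fun_iff)
  qed
qed

lemma abs_integral_mult_le:
  fixes F w m :: "'a \<Rightarrow> real"
  assumes Fw: "integrable M (\<lambda>p. F p * w p)" and B: "\<And>p. \<bar>m p\<bar> \<le> B"
  shows "\<bar>\<integral>p. F p * (w p * m p) \<partial>M\<bar> \<le> B * (\<integral>p. \<bar>F p\<bar> * \<bar>w p\<bar> \<partial>M)"
proof -
  have B_nonneg: "0 \<le> B" using B[of undefined] by linarith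
  have "\<bar>\<integral>p. F p * (w p * m p) \<partial>M\<bar> \<le> (\<integral>p. \<bar>F p * (w p * m p)\<bar> \<partial>M)" by (rule integral_abs_bound)
  also have "\<dots> \<le> (\<integral>p. B * (\<bar>F p\<bar> * \<bar>w p\<bar>) \<partial>M)"
  proof (rule integral_mono')
    show "integrable M (\<lambda>p. B * (\<bar>F p\<bar> * \<bar>w p\<bar>))"
      using integrable_abs[OF Fw] by (simp add: abs_mult)
    show "\<bar>F p * (w p * m p)\<bar> \<le> B * (\<bar>F p\<bar> * \<bar>w p\<bar>)" for p
      using mult_left_mono[OF B[of p], of "\<bar>F p\<bar> * \<bar>w p\<bar>"] by (simp add: abs_mult mult_ac)
  qed (simp add: B_nonneg)
  finally show ?thesis by simp
qed

lemma AE_lborel_slices: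
  assumes N: "N \<in> null_sets (lborel :: ('a::euclidean_space \<times> real) measure)"
  shows "AE t in lborel. AE x in lborel. (x, t) \<notin> N"
proof -
  have N': "N \<in> null_sets (lborel \<Otimes>\<^sub>M lborel)" unfolding lborel_prod by (rule N)
  have "AE x in lborel. AE t in lborel. (x, t) \<notin> N" by (rule lborel_pair.AE_pair[OF AE_not_in[OF N']])
  moreover have "{p \<in> space (lborel \<Otimes>\<^sub>M lborel). (fst p, snd p) \<notin> N} \<in> sets (lborel \<Otimes>\<^sub>M lborel)"
    using sets.compl_sets[OF null_setsD2[OF N']] by (simp add: set_diff_eq Collect_conj_eq)
  ultimately show ?thesis using lborel_pair.AE_commute[of "\<lambda>x t. (x, t) \<notin> N"] by simp
qed

lemma lebesgue_borel_representative:
  fixes F :: "'a::euclidean_space \<times> real \<Rightarrow> real"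
  assumes "F \<in> borel_measurable lebesgue"
  obtains F' where "F' \<in> borel_measurable borel" "AE p in lebesgue. F p = F' p"
    "AE t in lborel. AE x in lborel. F (x, t) = F' (x, t)"
proof -
  obtain F' where F': "F' \<in> borel_measurable lborel" "AE p in lborel. F p = F' p"
    using completion_ex_borel_measurable_real[OF assms] by blast
  from F'(2) obtain N where "{p \<in> space lborel. F p \<noteq> F' p} \<subseteq> N"
    "emeasure lborel N = 0" "N \<in> sets lborel"
    by (rule AE_E)
  then have N: "N \<in> null_sets lborel" "{p. F p \<noteq> F' p} \<subseteq> N" by auto
  have "AE t in lborel. AE x in lborel. F (x, t) = F' (x, t)"
    using AE_lborel_slices[OF N(1)]
    by (rule eventually_mono) (use N(2) in \<open>auto elim!: eventually_mono\<close>)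
  moreover have "AE p in lebesgue. F p = F' p" using F'(2) by (rule AE_completion)
  ultimately show ?thesis using F'(1) that by simp
qed

lemma AE_lebesgue_eq_if_slices_eq:
  fixes F G :: "'a::euclidean_space \<times> real \<Rightarrow> real"
  assumes F: "F \<in> borel_measurable lebesgue" and G: "G \<in> borel_measurable lebesgue"
    and slices_eq: "\<And>t. AE x in lebesgue. F (x, t) = G (x, t)"
  shows "AE p in lebesgue. F p = G p"
proof -
  obtain F' where F': "F' \<in> borel_measurable borel" "AE p in lebesgue. F p = F' p"
    "AE t in lborel. AE x in lborel. F (x, t) = F' (x, t)"
    by (rule lebesgue_borel_representative[OF F]) blast
  obtain G' where G': "G' \<in> borel_measurable borel" "AE p in lebesgue. G p = G' p"
    "AE t in lborel. AE x in lborel. G (x, t) = G' (x, t)"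
    by (rule lebesgue_borel_representative[OF G]) blast
  have "AE t in lborel. AE x in lborel. F' (x, t) = G' (x, t)"
    using F'(3) G'(3)
  proof eventually_elim
    case (elim t)
    moreover have "AE x in lborel. F (x, t) = G (x, t)"
      using slices_eq[of t] by (simp add: AE_completion_iff)
    ultimately show ?case by eventually_elim simp
  qed
  moreover have "{p \<in> space (lborel \<Otimes>\<^sub>M lborel). F' p = G' p} \<in> sets (lborel \<Otimes>\<^sub>M lborel)"
    using F'(1) G'(1) unfolding lborel_prod by measurable
  ultimately have "AE p in lborel \<Otimes>\<^sub>M lborel. F' p = G' p"
    using lborel_pair.AE_commute[of "\<lambda>x t. F' (x, t) = G' (x, t)"]
    by (intro lborel_pair.AE_pair_measure) simp_all
  then have "AE p in lebesgue. F' p = G' p" unfolding lborel_prod by (rule AE_completion)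
  with F'(2) G'(2) show ?thesis by eventually_elim simp
qed

lemma
  fixes F :: "'a::euclidean_space \<times> real \<Rightarrow> real"
  assumes F: "integrable lebesgue F" and slice: "\<And>t. (\<lambda>x. F (x, t)) \<in> borel_measurable lebesgue"
    and Y: "Y \<in> borel_measurable borel" "\<And>t. (\<integral>x. F (x, t) \<partial>lebesgue) = Y t"
  shows lebesgue_integral_slices: "(\<integral>p. F p \<partial>lebesgue) = (\<integral>t. Y t \<partial>lborel)"
    and integrable_lebesgue_slices: "integrable lborel Y"
proof -
  obtain F' where F': "F' \<in> borel_measurable borel" "AE p in lebesgue. F p = F' p"
    "AE t in lborel. AE x in lborel. F (x, t) = F' (x, t)"
    by (rule lebesgue_borel_representative[OF borel_measurable_integrable[OF F]]) blast
  have F'_lebesgue: "F' \<in> borel_measurable lebesgue"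
    using F'(1) by (intro measurable_completion) simp
  have "integrable lebesgue F'"
    using F F'(2) F'_lebesgue by (subst integrable_cong_AE[of F' lebesgue F]) auto
  then have "integrable lborel F'" using F'(1) by (subst (asm) integrable_completion) auto
  then have pair: "integrable (lborel \<Otimes>\<^sub>M lborel) (\<lambda>(x, t). F' (x, t))" by (simp add: lborel_prod)
  have slice_eq: "AE t in lborel. (\<integral>x. F' (x, t) \<partial>lborel) = Y t"
    using F'(3)
  proof eventually_elim
    case (elim t)
    have slice': "(\<lambda>x. F' (x, t)) \<in> borel_measurable borel" using F'(1) by measurable
    then have "(\<integral>x. F' (x, t) \<partial>lborel) = (\<integral>x. F' (x, t) \<partial>lebesgue)"
      by (subst integral_completion) auto
    also have "\<dots> = (\<integral>x. F (x, t) \<partial>lebesgue)"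
    proof (rule integral_cong_AE)
      show "(\<lambda>x. F' (x, t)) \<in> borel_measurable lebesgue" using slice' by (intro measurable_completion) simp
      show "AE x in lebesgue. F' (x, t) = F (x, t)"
        using elim by (intro AE_completion) (auto elim: eventually_mono)
    qed (rule slice)
    finally show ?case using Y(2) by simp
  qed
  have slice_integrable: "integrable lborel (\<lambda>t. \<integral>x. F' (x, t) \<partial>lborel)"
    using lborel_pair.integrable_snd[OF pair] by simp
  then show "integrable lborel Y"
    using slice_eq Y(1) by (subst integrable_cong_AE[where g="\<lambda>t. \<integral>x. F' (x, t) \<partial>lborel"])
      (auto elim: eventually_mono)
  have "(\<integral>p. F p \<partial>lebesgue) = (\<integral>p. F' p \<partial>lebesgue)"
    using F'(2) F'_lebesgue F by (intro integral_cong_AE) auto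
  also have "\<dots> = (\<integral>p. F' p \<partial>lborel)" using F'(1) by (subst integral_completion) auto
  also have "\<dots> = (\<integral>t. \<integral>x. F' (x, t) \<partial>lborel \<partial>lborel)"
    using lborel_pair.integral_snd[OF pair] by (simp add: lborel_prod)
  also have "\<dots> = (\<integral>t. Y t \<partial>lborel)"
    using slice_eq Y(1) borel_measurable_integrable[OF slice_integrable] by (intro integral_cong_AE) auto
  finally show "(\<integral>p. F p \<partial>lebesgue) = (\<integral>t. Y t \<partial>lborel)" .
qed

section \<open>Cutoffs in time\<close>

definition time_step :: "real \<Rightarrow> real \<Rightarrow> real \<Rightarrow> real" where
  "time_step n \<tau> t = smooth_step (n * (t - \<tau>))"

definition time_kernel :: "real \<Rightarrow> real \<Rightarrow> real \<Rightarrow> real" where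
  "time_kernel n \<tau> t = n * deriv smooth_step (n * (t - \<tau>))"

definition time_cutoff :: "real \<Rightarrow> real \<Rightarrow> real \<Rightarrow> real \<Rightarrow> real" where
  "time_cutoff n t1 t2 t = time_step n t1 t - time_step n t2 t"

lemma smooth_fun_time_cutoff: "smooth_fun (time_cutoff n t1 t2)"
  unfolding time_cutoff_def[abs_def] time_step_def
  by (intro smooth_fun_diff smooth_fun_smooth_step smooth_fun_intros)

lemma deriv_time_cutoff: "deriv (time_cutoff n t1 t2) = (\<lambda>t. time_kernel n t1 t - time_kernel n t2 t)"
proof
  fix t
  have "(time_step n \<tau> has_real_derivative time_kernel n \<tau> t) (at t)" for \<tau>
  proof -
    have "((\<lambda>t. n * (t - \<tau>)) has_real_derivative n) (at t)" by (auto intro!: derivative_eq_intros)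
    from DERIV_chain2[OF DERIV_smooth_step this] show ?thesis
      by (simp add: time_step_def[abs_def] time_kernel_def mult.commute)
  qed
  then show "deriv (time_cutoff n t1 t2) t = time_kernel n t1 t - time_kernel n t2 t"
    unfolding time_cutoff_def[abs_def] by (intro DERIV_imp_deriv DERIV_diff)
qed

lemma time_kernel_nonneg: "0 \<le> n \<Longrightarrow> 0 \<le> time_kernel n \<tau> t"
  by (simp add: time_kernel_def deriv_smooth_step_nonneg)

lemma time_kernel_continuous_on: "continuous_on S (time_kernel n \<tau>)"
  unfolding time_kernel_def[abs_def]
  by (intro continuous_intros
      continuous_on_compose2[OF smooth_fun_continuous_on[OF smooth_fun_deriv[OF smooth_step_smooth], of UNIV]]) auto

context
  fixes n :: real
  assumes n: "0 < n"
begin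

lemma time_step_eq_0: "t \<le> \<tau> \<Longrightarrow> time_step n \<tau> t = 0"
  using mult_nonneg_nonpos[of n "t - \<tau>"] n by (simp add: time_step_def smooth_step_eq_0)

lemma time_step_eq_1: "\<tau> + 1 / n \<le> t \<Longrightarrow> time_step n \<tau> t = 1"
  using n by (simp add: time_step_def smooth_step_eq_1 field_simps)

lemma time_kernel_eq_0: "t \<notin> {\<tau>..\<tau> + 1 / n} \<Longrightarrow> time_kernel n \<tau> t = 0"
  using n mult_nonneg_nonpos[of n "t - \<tau>"] pos_divide_le_eq[of n 1 "t - \<tau>"]
  by (cases "t \<le> \<tau>") (auto simp: time_kernel_def mult.commute intro!: deriv_smooth_step_eq_0)

context
  fixes t1 t2 :: real
  assumes t12: "t1 \<le> t2"
begin

lemma time_cutoff_bounds: "0 \<le> time_cutoff n t1 t2 t" "time_cutoff n t1 t2 t \<le> 1"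
  using monoD[OF mono_smooth_step, of "n * (t - t2)" "n * (t - t1)"] n t12
    smooth_step_bounds[of "n * (t - t1)"] smooth_step_bounds[of "n * (t - t2)"]
  by (auto simp: time_cutoff_def time_step_def mult_left_mono)

lemma time_cutoff_eq_0:
  assumes "t \<notin> {t1..t2 + 1 / n}"
  shows "time_cutoff n t1 t2 t = 0"
proof (cases "t \<le> t1")
  case True
  then show ?thesis using t12 by (simp add: time_cutoff_def time_step_eq_0)
next
  case False
  then have "t1 + 1 / n \<le> t" "t2 + 1 / n \<le> t" using assms t12 by auto
  then show ?thesis by (simp add: time_cutoff_def time_step_eq_1)
qed

end

end

lemma time_cutoff_tendsto:
  assumes n: "filterlim n at_top sequentially" and t12: "t1 \<le> t2"
  shows "(\<lambda>k. time_cutoff (n k) t1 t2 t) \<longlonglongrightarrow> indicator {t1<..t2} t"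
proof -
  have "(\<lambda>k. time_step (n k) \<tau> t) \<longlonglongrightarrow> (if \<tau> < t then 1 else 0)" for \<tau>
  proof (rule tendsto_eventually)
    show "\<forall>\<^sub>F k in sequentially. time_step (n k) \<tau> t = (if \<tau> < t then 1 else 0)"
      using filterlim_at_top_dense[THEN iffD1, OF n, rule_format, of 0]
        filterlim_at_top_dense[THEN iffD1, OF n, rule_format, of "1 / (t - \<tau>)"]
    proof eventually_elim
      case (elim k)
      then show ?case
        by (auto simp: field_simps intro!: time_step_eq_0 time_step_eq_1)
    qed
  qed
  from tendsto_diff[OF this this, of t1 t2] show ?thesis
    unfolding time_cutoff_def by (rule tendsto_eq_rhs) (use t12 in \<open>auto simp: indicator_def\<close>)
qed

lemma deriv_smooth_step_measurable [measurable]: "deriv smooth_step \<in> borel_measurable borel"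
  by (intro borel_measurable_continuous_onI smooth_fun_continuous_on smooth_fun_deriv smooth_step_smooth)

lemma integral_deriv_smooth_step: "(\<integral>r. deriv smooth_step r \<partial>lborel) = 1"
proof -
  have "(\<integral>r. indicator {0..1} r *\<^sub>R deriv smooth_step r \<partial>lborel) = smooth_step 1 - smooth_step 0"
    by (rule integral_FTC_atLeastAtMost)
      (auto intro!: smooth_fun_continuous_on smooth_fun_deriv smooth_step_smooth
        has_field_derivative_at_within DERIV_smooth_step
        simp: has_real_derivative_iff_has_vector_derivative[symmetric])
  moreover have "(\<lambda>r. indicator {0..1} r *\<^sub>R deriv smooth_step r) = deriv smooth_step"
  proof
    show "indicator {0..1} r *\<^sub>R deriv smooth_step r = deriv smooth_step r" for r
      using deriv_smooth_step_eq_0[of r] by (cases "r \<in> {0..1}") auto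
  qed
  ultimately show ?thesis by (simp add: smooth_step_eq_0 smooth_step_eq_1)
qed

lemma integral_mult_time_kernel:
  assumes n: "0 < n"
  shows "(\<integral>t. X t * time_kernel n \<tau> t \<partial>lborel) = (\<integral>r. X (\<tau> + r / n) * deriv smooth_step r \<partial>lborel)"
proof -
  have "(\<integral>t. X t * time_kernel n \<tau> t \<partial>lborel) =
      (1 / n) * (\<integral>r. n * (X (\<tau> + r / n) * deriv smooth_step r) \<partial>lborel)"
    using lborel_integral_real_affine[of "1 / n" "\<lambda>t. X t * time_kernel n \<tau> t" \<tau>] n
    by (simp add: time_kernel_def mult.left_commute)
  then show ?thesis using n by simp
qed

lemma integral_mult_time_kernel_tendsto:
  fixes X :: "real \<Rightarrow> real"
  assumes n: "filterlim n at_top sequentially" "\<And>k. N \<le> n k" and N: "0 < N"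
    and X: "X \<in> borel_measurable borel" "continuous_on {\<tau>..\<tau> + 1 / N} X"
  shows "(\<lambda>k. \<integral>t. X t * time_kernel (n k) \<tau> t \<partial>lborel) \<longlonglongrightarrow> X \<tau>"
proof -
  let ?w = "deriv smooth_step"
  have n_pos: "0 < n k" for k using n(2)[of k] N by linarith
  have in_interval: "\<tau> + r / n k \<in> {\<tau>..\<tau> + 1 / N}" if "?w r \<noteq> 0" for r k
  proof -
    have "0 \<le> r" "r \<le> 1" using that deriv_smooth_step_eq_0[of r] by linarith+
    then show ?thesis using n(2)[of k] n_pos[of k] N by (auto intro: frac_le)
  qed
  have "compact (X ` {\<tau>..\<tau> + 1 / N})" by (rule compact_continuous_image[OF X(2) compact_Icc])
  then obtain B where B: "0 < B" "\<And>y. y \<in> X ` {\<tau>..\<tau> + 1 / N} \<Longrightarrow> \<bar>y\<bar> \<le> B"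
    using bounded_pos[of "X ` {\<tau>..\<tau> + 1 / N}"] compact_imp_bounded[of "X ` {\<tau>..\<tau> + 1 / N}"] by auto
  have "integrable lborel ?w"
    using integral_deriv_smooth_step not_integrable_integral_eq[of lborel ?w] by fastforce
  then have Bw: "integrable lborel (\<lambda>r. B * ?w r)" by simp
  have "(\<lambda>k. \<integral>r. X (\<tau> + r / n k) * ?w r \<partial>lborel) \<longlonglongrightarrow> (\<integral>r. X \<tau> * ?w r \<partial>lborel)"
  proof (rule integral_dominated_convergence[OF _ _ Bw])
    have "norm (X (\<tau> + r / n k) * ?w r) \<le> B * ?w r" for r k
      using B(2) in_interval[of r k] deriv_smooth_step_nonneg[of r]
      by (cases "?w r = 0") (auto simp: abs_mult intro!: mult_right_mono)
    then show "AE r in lborel. norm (X (\<tau> + r / n k) * ?w r) \<le> B * ?w r" for k by simp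
    have "(\<lambda>k. X (\<tau> + r / n k) * ?w r) \<longlonglongrightarrow> X \<tau> * ?w r" for r
    proof (cases "?w r = 0")
      case False
      have "(\<lambda>k. \<tau> + r / n k) \<longlonglongrightarrow> \<tau> + 0"
        by (intro tendsto_add tendsto_const tendsto_divide_0[OF tendsto_const
          filterlim_at_top_imp_at_infinity[OF n(1)]])
      then have "(\<lambda>k. X (\<tau> + r / n k)) \<longlonglongrightarrow> X \<tau>"
        using N in_interval[OF False] by (intro continuous_on_tendsto_compose[OF X(2)]) auto
      then show ?thesis by (intro tendsto_intros)
    qed simp
    then show "AE r in lborel. (\<lambda>k. X (\<tau> + r / n k) * ?w r) \<longlonglongrightarrow> X \<tau> * ?w r" by simp
  qed (use X(1) in measurable)
  then show ?thesis by (simp add: integral_mult_time_kernel[OF n_pos] integral_deriv_smooth_step)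
qed

section \<open>Products of functions of space and of time\<close>

definition lap :: "('a::euclidean_space \<Rightarrow> real) \<Rightarrow> 'a \<Rightarrow> real" where
  "lap \<phi> x = (\<Sum>b\<in>Basis. dirderiv b (dirderiv b \<phi>) x)"

lemma test_fun_lap: "test_fun U \<phi> \<Longrightarrow> test_fun U (lap \<phi>)"
  unfolding lap_def[abs_def] by (intro test_fun_sum test_fun_dirderiv)

lemma dt_mult: "smooth_fun w \<Longrightarrow> smooth_fun h \<Longrightarrow> dt (\<lambda>p. w p * h p) = (\<lambda>p. w p * dt h p + dt w p * h p)"
  unfolding dt_def by (intro dirderiv_mult smooth_fun_differentiable)

lemma dxi_mult: "smooth_fun w \<Longrightarrow> smooth_fun h \<Longrightarrow> dxi b (\<lambda>p. w p * h p) = (\<lambda>p. w p * dxi b h p + dxi b w p * h p)"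
  unfolding dxi_def by (intro dirderiv_mult smooth_fun_differentiable)

lemma smooth_fun_dxi: "smooth_fun w \<Longrightarrow> smooth_fun (dxi b w)"
  unfolding dxi_def by (rule smooth_fun_dirderiv)

lemma lapx_mult:
  assumes w: "smooth_fun w" and h: "smooth_fun h"
  shows "lapx (\<lambda>p. w p * h p) p = w p * lapx h p + 2 * (\<Sum>b\<in>Basis. dxi b w p * dxi b h p) + lapx w p * h p"
proof -
  have "dxi b (dxi b (\<lambda>p. w p * h p)) p = w p * dxi b (dxi b h) p + 2 * (dxi b w p * dxi b h p)
      + dxi b (dxi b w) p * h p" for b
  proof -
    have "dxi b (dxi b (\<lambda>p. w p * h p)) = dxi b (\<lambda>p. w p * dxi b h p + dxi b w p * h p)"
      by (simp only: dxi_mult[OF w h])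
    also have "\<dots> = (\<lambda>p. dxi b (\<lambda>p. w p * dxi b h p) p + dxi b (\<lambda>p. dxi b w p * h p) p)"
      unfolding dxi_def by (intro dirderiv_add smooth_fun_differentiable smooth_fun_mult smooth_fun_dirderiv w h)
    finally show ?thesis by (simp add: dxi_mult smooth_fun_dxi w h)
  qed
  then show ?thesis unfolding lapx_def by (simp add: sum.distrib sum_distrib_left sum_distrib_right)
qed

context
  fixes \<phi> :: "'a::euclidean_space \<Rightarrow> real" and \<eta> :: "real \<Rightarrow> real"
  assumes \<phi>: "smooth_fun \<phi>" and \<eta>: "smooth_fun \<eta>"
begin

lemma smooth_fun_separated: "smooth_fun (\<lambda>p. \<phi> (fst p) * \<eta> (snd p))"
  by (intro smooth_fun_mult smooth_fun_linear_compose[OF \<phi> bounded_linear_fst]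
      smooth_fun_linear_compose[OF \<eta> bounded_linear_snd])

lemma dirderiv_separated:
  "dirderiv v (\<lambda>p. \<phi> (fst p) * \<eta> (snd p)) = (\<lambda>p. \<phi> (fst p) * dirderiv (snd v) \<eta> (snd p)
      + dirderiv (fst v) \<phi> (fst p) * \<eta> (snd p))"
  unfolding dirderiv_mult[OF smooth_fun_differentiable[OF smooth_fun_linear_compose[OF \<phi> bounded_linear_fst]]
      smooth_fun_differentiable[OF smooth_fun_linear_compose[OF \<eta> bounded_linear_snd]]]
    dirderiv_linear_compose[OF \<phi> bounded_linear_fst] dirderiv_linear_compose[OF \<eta> bounded_linear_snd] ..

lemma dt_separated: "dt (\<lambda>p. \<phi> (fst p) * \<eta> (snd p)) = (\<lambda>p. \<phi> (fst p) * deriv \<eta> (snd p))"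
  unfolding dt_def dirderiv_separated
  using linear_0[OF linear_dirderiv[OF smooth_fun_differentiable[OF \<phi>]]] by (simp add: dirderiv_1_eq_deriv \<eta>)

lemma dxi_separated: "dxi b (\<lambda>p. \<phi> (fst p) * \<eta> (snd p)) = (\<lambda>p. dirderiv b \<phi> (fst p) * \<eta> (snd p))"
  unfolding dxi_def dirderiv_separated
  using linear_0[OF linear_dirderiv[OF smooth_fun_differentiable[OF \<eta>]]] by simp

end

lemma lapx_separated:
  assumes \<phi>: "smooth_fun \<phi>" and \<eta>: "smooth_fun \<eta>"
  shows "lapx (\<lambda>p. \<phi> (fst p) * \<eta> (snd p)) = (\<lambda>p. lap \<phi> (fst p) * \<eta> (snd p))"
  unfolding lapx_def[abs_def] lap_def dxi_separated[OF \<phi> \<eta>] dxi_separated[OF smooth_fun_dirderiv[OF \<phi>] \<eta>]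
  by (simp add: sum_distrib_right)

lemma supported_in_separated:
  assumes "supported_in \<Omega> \<phi>" "supported_in (tint T) \<eta>"
  shows "supported_in (cyl \<Omega> T) (\<lambda>p. \<phi> (fst p) * \<eta> (snd p))"
proof -
  obtain K J where K: "compact K" "K \<subseteq> \<Omega>" "\<And>x. x \<notin> K \<Longrightarrow> \<phi> x = 0"
    and J: "compact J" "J \<subseteq> tint T" "\<And>t. t \<notin> J \<Longrightarrow> \<eta> t = 0"
    using assms unfolding supported_in_def by metis
  show ?thesis
  proof (rule supported_inI)
    show "compact (K \<times> J)" "K \<times> J \<subseteq> cyl \<Omega> T" using K J by (auto simp: cyl_def intro: compact_Times)
    show "\<phi> (fst p) * \<eta> (snd p) = 0" if "p \<notin> K \<times> J" for p
      using that K(3) J(3) by (cases p) auto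
  qed
qed

lemma test_fun_separated:
  "test_fun \<Omega> \<phi> \<Longrightarrow> test_fun (tint T) \<eta> \<Longrightarrow> test_fun (cyl \<Omega> T) (\<lambda>p. \<phi> (fst p) * \<eta> (snd p))"
  unfolding test_fun_iff by (blast intro: smooth_fun_separated supported_in_separated)

lemma tint_Icc_subset: "0 < t1 \<Longrightarrow> t2 \<in> tint T \<Longrightarrow> {t1..t2} \<subseteq> tint T"
  unfolding tint_def by (auto intro: le_less_trans[of "ereal _" "ereal t2"])

lemma tint_extend:
  assumes "t \<in> tint T"
  obtains N where "0 < N" "t + 1 / N \<in> tint T"
proof -
  have "ereal t < T" "0 < t" using assms by (auto simp: tint_def)
  then obtain s where s: "ereal t < ereal s" "ereal s < T" using ereal_dense2[of "ereal t" T] by auto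
  show ?thesis
    by (rule that[of "1 / (s - t)"]) (use s \<open>0 < t\<close> in \<open>auto simp: tint_def\<close>)
qed

lemma tint_nonempty:
  assumes "0 < T"
  obtains s where "0 < s" "s \<in> tint T"
  using ereal_dense2[OF assms] by (auto simp: tint_def zero_ereal_def)

lemma open_tint: "open (tint T)"
proof -
  have "tint T = {0<..} \<inter> ereal -` {..<T}" by (auto simp: tint_def)
  moreover have "open (ereal -` {..<T})" by (rule open_ereal_vimage[OF open_lessThan])
  ultimately show ?thesis by (simp add: open_Int)
qed

definition time_weight :: "ereal \<Rightarrow> (real \<Rightarrow> real) \<Rightarrow> bool" where
  "time_weight T \<eta> \<longleftrightarrow> \<eta> \<in> borel_measurable borel \<and> (\<exists>B. \<forall>t. \<bar>\<eta> t\<bar> \<le> B) \<and> supported_in (tint T) \<eta>"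

lemma time_weight_Cc_fun: "Cc_fun (tint T) \<eta> \<Longrightarrow> time_weight T \<eta>"
  unfolding time_weight_def by (metis Cc_fun_measurable Cc_fun_iff Cc_fun_bounded)

lemma time_weight_indicator:
  assumes "A \<in> sets borel" "A \<subseteq> {t1..t2}" "0 < t1" "t2 \<in> tint T"
  shows "time_weight T (indicator A)"
  unfolding time_weight_def
proof (intro conjI exI[of _ 1] allI)
  show "supported_in (tint T) (indicator A)"
    by (rule supported_inI[OF compact_Icc tint_Icc_subset[OF assms(3,4)]])
      (use assms(2) in \<open>auto simp: indicator_def\<close>)
qed (use assms(1) in \<open>auto simp: indicator_def\<close>)

definition pairing :: "('a::euclidean_space \<times> real \<Rightarrow> real) \<Rightarrow> ('a \<Rightarrow> real) \<Rightarrow> (real \<Rightarrow> real) \<Rightarrow> real" where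
  "pairing F \<phi> \<eta> = (\<integral>p. F p * (\<phi> (fst p) * \<eta> (snd p)) \<partial>lebesgue)"

lemma pairing_integrable:
  assumes F: "locally_integrable (cyl \<Omega> T) F" and \<phi>: "Cc_fun \<Omega> \<phi>" and \<eta>: "time_weight T \<eta>"
  shows "integrable lebesgue (\<lambda>p. F p * (\<phi> (fst p) * \<eta> (snd p)))"
proof -
  obtain A where A: "0 < A" "\<And>x. \<bar>\<phi> x\<bar> \<le> A" by (rule Cc_fun_bounded[OF \<phi>]) blast
  obtain B where B: "\<And>t. \<bar>\<eta> t\<bar> \<le> B" using \<eta> by (auto simp: time_weight_def)
  show ?thesis
    using F
  proof (rule integrable_mult_locally_integrable)
    have [measurable]: "\<phi> \<in> borel_measurable borel" "\<eta> \<in> borel_measurable borel"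
      using Cc_fun_measurable[OF \<phi>] \<eta> by (auto simp: time_weight_def)
    have "(\<lambda>p. \<phi> (fst p) * \<eta> (snd p)) \<in> borel_measurable (borel \<Otimes>\<^sub>M borel)" by measurable
    then show "(\<lambda>p. \<phi> (fst p) * \<eta> (snd p)) \<in> borel_measurable lebesgue"
      by (intro measurable_completion) (simp add: borel_prod)
    show "\<bar>\<phi> (fst p) * \<eta> (snd p)\<bar> \<le> A * B" for p
      unfolding abs_mult using A by (intro mult_mono B) auto
    show "supported_in (cyl \<Omega> T) (\<lambda>p. \<phi> (fst p) * \<eta> (snd p))"
      using \<phi> \<eta> by (auto simp: Cc_fun_iff time_weight_def intro: supported_in_separated)
  qed
qed

lemma pairing_zero: "pairing F (\<lambda>x. 0) \<eta> = 0"
  by (simp add: pairing_def)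

lemma pairing_cmult: "pairing F (\<lambda>x. c * \<phi> x) \<eta> = c * pairing F \<phi> \<eta>"
  unfolding pairing_def by (simp add: mult.left_commute mult.assoc)

lemma pairing_nonneg: "(\<And>p. 0 \<le> F p) \<Longrightarrow> (\<And>x. 0 \<le> \<phi> x) \<Longrightarrow> (\<And>t. 0 \<le> \<eta> t) \<Longrightarrow> 0 \<le> pairing F \<phi> \<eta>"
  unfolding pairing_def by (intro integral_nonneg_AE AE_I2 mult_nonneg_nonneg)

context
  fixes \<Omega> :: "'a::euclidean_space set" and T :: ereal and \<eta> :: "real \<Rightarrow> real"
  assumes \<eta>: "time_weight T \<eta>"
begin

lemma pairing_add:
  assumes "locally_integrable (cyl \<Omega> T) F" "Cc_fun \<Omega> \<phi>" "Cc_fun \<Omega> \<psi>"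
  shows "pairing F (\<lambda>x. \<phi> x + \<psi> x) \<eta> = pairing F \<phi> \<eta> + pairing F \<psi> \<eta>"
  unfolding pairing_def using pairing_integrable[OF assms(1) _ \<eta>] assms(2,3)
  by (simp add: distrib_left distrib_right)

lemma pairing_sum:
  assumes F: "locally_integrable (cyl \<Omega> T) F" and \<psi>: "\<And>i. i \<in> I \<Longrightarrow> Cc_fun \<Omega> (\<psi> i)"
  shows "pairing F (\<lambda>x. \<Sum>i\<in>I. \<psi> i x) \<eta> = (\<Sum>i\<in>I. pairing F (\<psi> i) \<eta>)"
  using \<psi>
  by (induction I rule: infinite_finite_induct) (auto simp: pairing_zero pairing_add[OF F] Cc_fun_sum)

lemma pairing_fun_add:
  assumes "locally_integrable (cyl \<Omega> T) F" "locally_integrable (cyl \<Omega> T) G" "Cc_fun \<Omega> \<phi>"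
  shows "pairing (\<lambda>p. F p + G p) \<phi> \<eta> = pairing F \<phi> \<eta> + pairing G \<phi> \<eta>"
  unfolding pairing_def
  using pairing_integrable[OF assms(1,3) \<eta>] pairing_integrable[OF assms(2,3) \<eta>]
  by (simp add: distrib_right)

lemma pairing_fun_sum:
  assumes F: "\<And>i. i \<in> I \<Longrightarrow> locally_integrable (cyl \<Omega> T) (F i)" and \<phi>: "Cc_fun \<Omega> \<phi>"
  shows "pairing (\<lambda>p. \<Sum>i\<in>I. F i p) \<phi> \<eta> = (\<Sum>i\<in>I. pairing (F i) \<phi> \<eta>)"
  using F
proof (induction I rule: infinite_finite_induct)
  case (insert i I)
  then show ?case using pairing_fun_add[OF _ locally_integrable_sum \<phi>, of "F i" I F] by simp
qed (simp_all add: pairing_def)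

context
  assumes \<eta>_nonneg: "\<And>t. 0 \<le> \<eta> t"
begin

lemma pairing_mono:
  assumes "locally_integrable (cyl \<Omega> T) F" "\<And>p. 0 \<le> F p" "Cc_fun \<Omega> \<phi>" "Cc_fun \<Omega> \<psi>" "\<And>x. \<phi> x \<le> \<psi> x"
  shows "pairing F \<phi> \<eta> \<le> pairing F \<psi> \<eta>"
  unfolding pairing_def
  by (intro integral_mono pairing_integrable[OF assms(1,3) \<eta>] pairing_integrable[OF assms(1,4) \<eta>]
      mult_left_mono mult_right_mono assms \<eta>_nonneg)

lemma pairing_fun_mono:
  assumes "locally_integrable (cyl \<Omega> T) F" "locally_integrable (cyl \<Omega> T) G" "Cc_fun \<Omega> \<phi>"
    "\<And>p. F p \<le> G p" "\<And>x. 0 \<le> \<phi> x"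
  shows "pairing F \<phi> \<eta> \<le> pairing G \<phi> \<eta>"
  unfolding pairing_def
  by (intro integral_mono pairing_integrable[OF assms(1,3) \<eta>] pairing_integrable[OF assms(2,3) \<eta>]
      mult_right_mono mult_nonneg_nonneg assms \<eta>_nonneg)

end

end

lemma pairing_tendsto:
  assumes F: "locally_integrable (cyl \<Omega> T) F" and \<phi>: "Cc_fun \<Omega> \<phi>"
    and \<eta>: "time_weight T \<eta>" "\<And>k. time_weight T (\<eta>' k)" "\<And>t. (\<lambda>k. \<eta>' k t) \<longlonglongrightarrow> \<eta> t"
    and bound: "time_weight T w" "\<And>k t. \<bar>\<eta>' k t\<bar> \<le> w t"
  shows "(\<lambda>k. pairing F \<phi> (\<eta>' k)) \<longlonglongrightarrow> pairing F \<phi> \<eta>"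
  unfolding pairing_def
proof (rule integral_dominated_convergence)
  show "integrable lebesgue (\<lambda>p. \<bar>F p\<bar> * (\<bar>\<phi> (fst p)\<bar> * w (snd p)))"
    by (rule pairing_integrable[OF locally_integrable_abs[OF F] Cc_fun_abs[OF \<phi>] bound(1)])
  show "AE p in lebesgue. norm (F p * (\<phi> (fst p) * \<eta>' k (snd p))) \<le> \<bar>F p\<bar> * (\<bar>\<phi> (fst p)\<bar> * w (snd p))" for k
    using bound(2) by (auto simp: abs_mult intro!: mult_left_mono)
  show "AE p in lebesgue. (\<lambda>k. F p * (\<phi> (fst p) * \<eta>' k (snd p))) \<longlonglongrightarrow> F p * (\<phi> (fst p) * \<eta> (snd p))"
    by (intro AE_I2 tendsto_intros \<eta>(3))
qed (use pairing_integrable[OF F \<phi>] \<eta>(1,2) in auto)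

section \<open>Nonnegative solutions\<close>

text \<open>Taking u to be the absolute value of a weak solution makes it nonnegative everywhere.\<close>

locale hj_solution =
  fixes q :: real and \<Omega> :: "'a::euclidean_space set" and T :: ereal
    and u :: "'a \<times> real \<Rightarrow> real" and g :: "'a \<times> real \<Rightarrow> 'a"
  assumes q: "0 < q" "q \<le> 1" and open_domain: "open \<Omega>" and T_pos: "0 < T"
    and u_nonneg: "0 \<le> u p"
    and slice_integrable: "t \<in> tint T \<Longrightarrow> locally_integrable \<Omega> (\<lambda>x. u (x, t))"
    and slice_continuous: "compact K \<Longrightarrow> K \<subseteq> \<Omega> \<Longrightarrow> t \<in> tint T \<Longrightarrow>
      ((\<lambda>s. LINT x:K|lebesgue. \<bar>u (x, s) - u (x, t)\<bar>) \<longlongrightarrow> 0) (at t within tint T)"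
    and u_integrable: "locally_integrable (cyl \<Omega> T) u"
    and gradient_integrable: "locally_integrable (cyl \<Omega> T) (\<lambda>p. g p \<bullet> b)"
    and absorption_integrable: "locally_integrable (cyl \<Omega> T) (\<lambda>p. norm (g p) powr q)"
    and gradient_identity: "test_fun (cyl \<Omega> T) w \<Longrightarrow> b \<in> Basis \<Longrightarrow>
      (\<integral>p. u p * dxi b w p \<partial>lebesgue) = - (\<integral>p. (g p \<bullet> b) * w p \<partial>lebesgue)"
    and equation: "test_fun (cyl \<Omega> T) w \<Longrightarrow>
      (\<integral>p. u p * dt w p \<partial>lebesgue) + (\<integral>p. u p * lapx w p \<partial>lebesgue) = (\<integral>p. norm (g p) powr q * w p \<partial>lebesgue)"

lemma set_integral_eq_integral:
  fixes F :: "'a \<Rightarrow> real"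
  assumes "\<And>p. p \<notin> S \<Longrightarrow> F p = 0"
  shows "(LINT p:S|M. F p) = (LINT p|M. F p)"
  unfolding set_lebesgue_integral_def
  by (rule Bochner_Integration.integral_cong[OF refl]) (use assms in \<open>auto simp: indicator_def\<close>)

lemma AE_nonneg_on_compact:
  fixes u :: "'a::euclidean_space \<Rightarrow> real \<Rightarrow> real"
  assumes nonneg: "\<And>t. t \<in> tint T \<Longrightarrow> AE x in lebesgue. x \<in> \<Omega> \<longrightarrow> 0 \<le> u x t"
    and K: "K \<subseteq> cyl \<Omega> T" "set_integrable lebesgue K (\<lambda>(x, t). u x t)"
  shows "AE p in lebesgue. p \<in> K \<longrightarrow> \<bar>u (fst p) (snd p)\<bar> = u (fst p) (snd p)"
proof -
  let ?F = "\<lambda>p. indicator K p * u (fst p) (snd p)"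
  have F [measurable]: "?F \<in> borel_measurable lebesgue"
    using borel_measurable_integrable[OF K(2)[unfolded set_integrable_def]] by (simp add: split_beta')
  have "AE p in lebesgue. \<bar>?F p\<bar> = ?F p"
  proof (rule AE_lebesgue_eq_if_slices_eq)
    fix t
    show "AE x in lebesgue. \<bar>?F (x, t)\<bar> = ?F (x, t)"
    proof (cases "t \<in> tint T")
      case True
      show ?thesis
        using nonneg[OF True] by (rule eventually_mono) (use K(1) in \<open>auto simp: indicator_def cyl_def\<close>)
    next
      case False
      then have "(x, t) \<notin> K" for x using K(1) by (auto simp: cyl_def)
      then show ?thesis by simp
    qed
  qed measurable
  then show ?thesis by (rule eventually_mono) (auto simp: indicator_def)
qed

lemma tendsto_set_integral_abs_diff:
  fixes v :: "'t::topological_space \<Rightarrow> 'a::euclidean_space \<Rightarrow> real"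
  assumes v: "\<And>s. s \<in> I \<Longrightarrow> set_integrable lebesgue K (v s)" and t: "t \<in> I"
    and lim: "((\<lambda>s. LINT x:K|lebesgue. \<bar>v s x - v t x\<bar>) \<longlongrightarrow> 0) (at t within I)"
  shows "((\<lambda>s. LINT x:K|lebesgue. \<bar>\<bar>v s x\<bar> - \<bar>v t x\<bar>\<bar>) \<longlongrightarrow> 0) (at t within I)"
proof (rule Lim_null_comparison[OF _ lim])
  have "norm (LINT x:K|lebesgue. \<bar>\<bar>v s x\<bar> - \<bar>v t x\<bar>\<bar>) \<le> (LINT x:K|lebesgue. \<bar>v s x - v t x\<bar>)" if s: "s \<in> I" for s
  proof -
    have "0 \<le> (LINT x:K|lebesgue. \<bar>\<bar>v s x\<bar> - \<bar>v t x\<bar>\<bar>)"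
      unfolding set_lebesgue_integral_def by (intro integral_nonneg_AE AE_I2) auto
    moreover have "(LINT x:K|lebesgue. \<bar>\<bar>v s x\<bar> - \<bar>v t x\<bar>\<bar>) \<le> (LINT x:K|lebesgue. \<bar>v s x - v t x\<bar>)"
      by (intro set_integral_mono set_integrable_abs set_integral_diff v s t abs_triangle_ineq3)
    ultimately show ?thesis by simp
  qed
  then show "\<forall>\<^sub>F s in at t within I. norm (LINT x:K|lebesgue. \<bar>\<bar>v s x\<bar> - \<bar>v t x\<bar>\<bar>)
      \<le> (LINT x:K|lebesgue. \<bar>v s x - v t x\<bar>)"
    unfolding eventually_at_filter by (auto intro!: always_eventually)
qed

lemma integral_abs_mult_test_fun:
  fixes u :: "'a::euclidean_space \<Rightarrow> real \<Rightarrow> real"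
  assumes nonneg: "\<And>t. t \<in> tint T \<Longrightarrow> AE x in lebesgue. x \<in> \<Omega> \<longrightarrow> 0 \<le> u x t"
    and u: "locally_integrable (cyl \<Omega> T) (\<lambda>p. u (fst p) (snd p))" and w: "test_fun (cyl \<Omega> T) w"
  shows "(\<integral>p. \<bar>u (fst p) (snd p)\<bar> * w p \<partial>lebesgue) = (\<integral>p. u (fst p) (snd p) * w p \<partial>lebesgue)"
proof (rule integral_cong_AE)
  have "AE p in lebesgue. p \<in> tsupport w \<longrightarrow> \<bar>u (fst p) (snd p)\<bar> = u (fst p) (snd p)"
    using u w by (intro AE_nonneg_on_compact[OF nonneg]) (auto simp: test_fun_def locally_integrable_def split_beta')
  then show "AE p in lebesgue. \<bar>u (fst p) (snd p)\<bar> * w p = u (fst p) (snd p) * w p"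
    by (rule eventually_mono) (metis not_in_tsupport mult_zero_right)
qed (use integrable_mult_Cc_fun[OF u test_fun_imp_Cc_fun[OF w]]
    integrable_mult_Cc_fun[OF locally_integrable_abs[OF u] test_fun_imp_Cc_fun[OF w]] in auto)

lemma weak_solutionE:
  fixes \<Omega> :: "'a::euclidean_space set"
  assumes sol: "weak_solution q \<Omega> T u"
  obtains (weak_gradient) g where "\<And>t. t \<in> tint T \<Longrightarrow> locally_integrable \<Omega> (\<lambda>x. u x t)"
    "\<And>K t. compact K \<Longrightarrow> K \<subseteq> \<Omega> \<Longrightarrow> t \<in> tint T \<Longrightarrow>
      ((\<lambda>s. LINT x:K|lebesgue. \<bar>u x s - u x t\<bar>) \<longlongrightarrow> 0) (at t within tint T)"
    "locally_integrable (cyl \<Omega> T) (\<lambda>p. u (fst p) (snd p))" "\<And>b. locally_integrable (cyl \<Omega> T) (\<lambda>p. g p \<bullet> b)"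
    "locally_integrable (cyl \<Omega> T) (\<lambda>p. norm (g p) powr q)"
    "\<And>w b. test_fun (cyl \<Omega> T) w \<Longrightarrow> b \<in> Basis \<Longrightarrow>
      (\<integral>p. u (fst p) (snd p) * dxi b w p \<partial>lebesgue) = - (\<integral>p. (g p \<bullet> b) * w p \<partial>lebesgue)"
    "\<And>w. test_fun (cyl \<Omega> T) w \<Longrightarrow>
      (\<integral>p. - u (fst p) (snd p) * dt w p - u (fst p) (snd p) * lapx w p + norm (g p) powr q * w p \<partial>lebesgue) = 0"
proof -
  let ?u = "\<lambda>p. u (fst p) (snd p)"
  have slices: "locally_integrable \<Omega> (\<lambda>x. u x t)"
    "\<And>K. compact K \<Longrightarrow> K \<subseteq> \<Omega> \<Longrightarrow> ((\<lambda>s. LINT x:K|lebesgue. \<bar>u x s - u x t\<bar>) \<longlongrightarrow> 0) (at t within tint T)"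
    if "t \<in> tint T" for t
    using sol that unfolding weak_solution_def locally_integrable_def by blast+
  obtain g' where integrable: "\<forall>C. compact C \<and> C \<subseteq> cyl \<Omega> T \<longrightarrow> set_integrable lebesgue C (\<lambda>(x, t). u x t)
        \<and> set_integrable lebesgue C (\<lambda>(x, t). g' x t) \<and> set_integrable lebesgue C (\<lambda>(x, t). norm (g' x t) powr q)"
    and test: "\<forall>w. test_fun (cyl \<Omega> T) w \<longrightarrow>
        (\<forall>b\<in>Basis. (LINT p:cyl \<Omega> T|lebesgue. ?u p * dxi b w p)
            = - (LINT p:cyl \<Omega> T|lebesgue. (g' (fst p) (snd p) \<bullet> b) * w p))
        \<and> (LINT p:cyl \<Omega> T|lebesgue. - ?u p * dt w p - ?u p * lapx w p + norm (g' (fst p) (snd p)) powr q * w p) = 0"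
    using sol unfolding weak_solution_def by (elim conjE exE) (rule that)
  define g where "g p = g' (fst p) (snd p)" for p
  have local: "locally_integrable (cyl \<Omega> T) ?u" "locally_integrable (cyl \<Omega> T) (\<lambda>p. g p \<bullet> b)"
    "locally_integrable (cyl \<Omega> T) (\<lambda>p. norm (g p) powr q)" for b
    using integrable integrable_inner_left[of b lebesgue]
    unfolding locally_integrable_def set_integrable_def g_def
    by (auto simp: split_beta' inner_scaleR_left[symmetric] simp del: inner_scaleR_left)
  have outside: "w p = 0" if "test_fun (cyl \<Omega> T) w" "p \<notin> cyl \<Omega> T" for w p
    using that supported_in_eq_0 by (auto simp: test_fun_iff)
  show ?thesis
  proof (rule that[of g, OF slices local])
    fix w :: "'a \<times> real \<Rightarrow> real" and b :: 'a assume w: "test_fun (cyl \<Omega> T) w"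
    note outside = outside[OF w] outside[OF test_fun_dxi[OF w]] outside[OF test_fun_dt[OF w]]
      outside[OF test_fun_lapx[OF w]]
    show "(\<integral>p. ?u p * dxi b w p \<partial>lebesgue) = - (\<integral>p. (g p \<bullet> b) * w p \<partial>lebesgue)" if "b \<in> Basis"
      using test[THEN spec, THEN mp, OF w] that outside unfolding g_def by (simp add: set_integral_eq_integral)
    show "(\<integral>p. - ?u p * dt w p - ?u p * lapx w p + norm (g p) powr q * w p \<partial>lebesgue) = 0"
      using test[THEN spec, THEN mp, OF w] outside unfolding g_def by (simp add: set_integral_eq_integral)
  qed auto
qed

lemma hj_solution_of_weak_solution:
  fixes \<Omega> :: "'a::euclidean_space set"
  assumes "0 < q" "q \<le> 1" "open \<Omega>" "0 < T"
    and sol: "weak_solution q \<Omega> T u"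
    and nonneg: "\<And>t. t \<in> tint T \<Longrightarrow> AE x in lebesgue. x \<in> \<Omega> \<longrightarrow> 0 \<le> u x t"
  obtains g where "hj_solution q \<Omega> T (\<lambda>p. \<bar>u (fst p) (snd p)\<bar>) g"
  using sol
proof (cases rule: weak_solutionE)
  case (weak_gradient g)
  note slice = weak_gradient(1) and slice_lim = weak_gradient(2) and u = weak_gradient(3) and g = weak_gradient(4)
    and f = weak_gradient(5) and gradient = weak_gradient(6) and equation = weak_gradient(7)
  let ?u = "\<lambda>p. u (fst p) (snd p)"
  have abs_eq: "(\<integral>p. \<bar>?u p\<bar> * w p \<partial>lebesgue) = (\<integral>p. ?u p * w p \<partial>lebesgue)" if "test_fun (cyl \<Omega> T) w" for w
    by (rule integral_abs_mult_test_fun[OF nonneg u that])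
  have "hj_solution q \<Omega> T (\<lambda>p. \<bar>?u p\<bar>) g"
  proof
    fix t assume t: "t \<in> tint T"
    show "locally_integrable \<Omega> (\<lambda>x. \<bar>?u (x, t)\<bar>)" using locally_integrable_abs[OF slice[OF t]] by simp
    fix K assume K: "compact K" "K \<subseteq> \<Omega>"
    have "set_integrable lebesgue K (\<lambda>x. u x s)" if "s \<in> tint T" for s
      using slice[OF that] K by (simp add: locally_integrable_def)
    from tendsto_set_integral_abs_diff[where v="\<lambda>s x. u x s", OF this t slice_lim[OF K t]]
    show "((\<lambda>s. LINT x:K|lebesgue. \<bar>\<bar>?u (x, s)\<bar> - \<bar>?u (x, t)\<bar>\<bar>) \<longlongrightarrow> 0) (at t within tint T)" by simp
  next
    fix w :: "'a \<times> real \<Rightarrow> real" and b :: 'a assume w: "test_fun (cyl \<Omega> T) w"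
    show "(\<integral>p. \<bar>?u p\<bar> * dxi b w p \<partial>lebesgue) = - (\<integral>p. (g p \<bullet> b) * w p \<partial>lebesgue)" if "b \<in> Basis"
      using gradient[OF w that] by (simp only: abs_eq[OF test_fun_dxi[OF w]])
    show "(\<integral>p. \<bar>?u p\<bar> * dt w p \<partial>lebesgue) + (\<integral>p. \<bar>?u p\<bar> * lapx w p \<partial>lebesgue)
        = (\<integral>p. norm (g p) powr q * w p \<partial>lebesgue)"
      unfolding abs_eq[OF test_fun_dt[OF w]] abs_eq[OF test_fun_lapx[OF w]]
      using equation[OF w] integrable_mult_Cc_fun[OF u test_fun_imp_Cc_fun[OF test_fun_dt[OF w]]]
        integrable_mult_Cc_fun[OF u test_fun_imp_Cc_fun[OF test_fun_lapx[OF w]]]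
        integrable_mult_Cc_fun[OF f test_fun_imp_Cc_fun[OF w]] by simp
  qed (use assms u g f in \<open>auto intro: locally_integrable_abs\<close>)
  then show ?thesis by (rule that)
qed

context hj_solution
begin

definition absorption :: "'a \<times> real \<Rightarrow> real" where
  "absorption p = norm (g p) powr q"

definition mass :: "('a \<Rightarrow> real) \<Rightarrow> real \<Rightarrow> real" where
  "mass \<phi> t = indicator (tint T) t * (\<integral>x. u (x, t) * \<phi> x \<partial>lebesgue)"

lemma absorption_nonneg: "0 \<le> absorption p"
  by (simp add: absorption_def)

lemma locally_integrable_absorption: "locally_integrable (cyl \<Omega> T) absorption"
  unfolding absorption_def[abs_def] by (rule absorption_integrable)

lemmas integrable_u_mult = integrable_mult_Cc_fun[OF u_integrable test_fun_imp_Cc_fun]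
  and integrable_gradient_mult = integrable_mult_Cc_fun[OF gradient_integrable test_fun_imp_Cc_fun]
  and integrable_absorption_mult = integrable_mult_Cc_fun[OF locally_integrable_absorption test_fun_imp_Cc_fun]

lemma mass_integrable: "Cc_fun \<Omega> \<phi> \<Longrightarrow> t \<in> tint T \<Longrightarrow> integrable lebesgue (\<lambda>x. u (x, t) * \<phi> x)"
  by (rule integrable_mult_Cc_fun[OF slice_integrable])

lemma mass_nonneg: "(\<And>x. 0 \<le> \<phi> x) \<Longrightarrow> 0 \<le> mass \<phi> t"
  unfolding mass_def by (intro mult_nonneg_nonneg integral_nonneg_AE AE_I2 u_nonneg) auto

lemma mass_zero: "mass (\<lambda>x. 0) t = 0"
  by (simp add: mass_def)

lemma mass_cmult: "mass (\<lambda>x. c * \<phi> x) t = c * mass \<phi> t"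
  unfolding mass_def by (simp add: mult.left_commute)

lemma mass_add:
  "Cc_fun \<Omega> \<phi> \<Longrightarrow> Cc_fun \<Omega> \<psi> \<Longrightarrow> mass (\<lambda>x. \<phi> x + \<psi> x) t = mass \<phi> t + mass \<psi> t"
  unfolding mass_def using mass_integrable by (cases "t \<in> tint T") (auto simp: distrib_left)

lemma mass_diff:
  "Cc_fun \<Omega> \<phi> \<Longrightarrow> Cc_fun \<Omega> \<psi> \<Longrightarrow> mass (\<lambda>x. \<phi> x - \<psi> x) t = mass \<phi> t - mass \<psi> t"
  using mass_add[OF _ Cc_fun_cmult[of \<Omega> \<psi> "-1"]] mass_cmult[of "-1" \<psi>] by simp

lemma mass_sum:
  "(\<And>i. i \<in> I \<Longrightarrow> Cc_fun \<Omega> (\<psi> i)) \<Longrightarrow> mass (\<lambda>x. \<Sum>i\<in>I. \<psi> i x) t = (\<Sum>i\<in>I. mass (\<psi> i) t)"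
  by (induction I rule: infinite_finite_induct) (auto simp: mass_zero mass_add Cc_fun_sum)

lemma mass_mono:
  assumes "Cc_fun \<Omega> \<phi>" "Cc_fun \<Omega> \<psi>" "\<And>x. \<phi> x \<le> \<psi> x"
  shows "mass \<phi> t \<le> mass \<psi> t"
  using mass_nonneg[of "\<lambda>x. \<psi> x - \<phi> x"] mass_diff[OF assms(2,1)] assms(3) by simp

lemma mass_continuous_on:
  assumes \<phi>: "Cc_fun \<Omega> \<phi>"
  shows "continuous_on (tint T) (mass \<phi>)"
  unfolding continuous_on_def
proof
  fix t assume t: "t \<in> tint T"
  obtain B where B: "0 < B" "\<And>x. \<bar>\<phi> x\<bar> \<le> B" by (rule Cc_fun_bounded[OF \<phi>]) blast
  let ?K = "tsupport \<phi>" and ?I = "\<lambda>s. LINT x:tsupport \<phi>|lebesgue. \<bar>u (x, s) - u (x, t)\<bar>"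
  have K: "compact ?K" "?K \<subseteq> \<Omega>" using \<phi> by (auto simp: Cc_fun_def)
  have bound: "norm (mass \<phi> s - mass \<phi> t) \<le> ?I s * B" if s: "s \<in> tint T" for s
  proof -
    have "set_integrable lebesgue ?K (\<lambda>x. \<bar>u (x, s) - u (x, t)\<bar>)"
      using slice_integrable[OF s] slice_integrable[OF t] K
      by (intro set_integrable_abs set_integral_diff) (auto simp: locally_integrable_def)
    moreover have "\<bar>u (x, s) * \<phi> x - u (x, t) * \<phi> x\<bar> \<le> indicator ?K x *\<^sub>R \<bar>u (x, s) - u (x, t)\<bar> * B" for x
      using B(2)[of x] not_in_tsupport[of x \<phi>]
      by (auto simp: indicator_def abs_mult mult_left_mono simp flip: left_diff_distrib)
    ultimately have "\<bar>\<integral>x. u (x, s) * \<phi> x - u (x, t) * \<phi> x \<partial>lebesgue\<bar>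
        \<le> (\<integral>x. indicator ?K x *\<^sub>R \<bar>u (x, s) - u (x, t)\<bar> * B \<partial>lebesgue)"
      unfolding set_integrable_def
      by (intro order_trans[OF integral_abs_bound integral_mono'] integrable_mult_left) (use B(1) in auto)
    then show ?thesis
      using mass_integrable[OF \<phi> s] mass_integrable[OF \<phi> t] s t by (simp add: mass_def set_lebesgue_integral_def)
  qed
  have "((\<lambda>s. mass \<phi> s - mass \<phi> t) \<longlongrightarrow> 0) (at t within tint T)"
  proof (rule Lim_null_comparison)
    show "\<forall>\<^sub>F s in at t within tint T. norm (mass \<phi> s - mass \<phi> t) \<le> ?I s * B"
      unfolding eventually_at_filter using bound by (auto intro!: always_eventually)
    show "((\<lambda>s. ?I s * B) \<longlongrightarrow> 0) (at t within tint T)"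
      by (rule tendsto_mult_left_zero[OF slice_continuous[OF K t]])
  qed
  then show "(mass \<phi> \<longlongrightarrow> mass \<phi> t) (at t within tint T)" by (rule LIM_zero_cancel)
qed

lemma mass_measurable:
  assumes "Cc_fun \<Omega> \<phi>"
  shows "mass \<phi> \<in> borel_measurable borel"
proof -
  have "(\<lambda>t. indicator (tint T) t *\<^sub>R mass \<phi> t) \<in> borel_measurable borel"
    by (rule borel_measurable_continuous_on_indicator[OF _ mass_continuous_on[OF assms]])
      (simp add: open_tint borel_open)
  moreover have "(\<lambda>t. indicator (tint T) t *\<^sub>R mass \<phi> t) = mass \<phi>"
    by (auto simp: mass_def indicator_def)
  ultimately show ?thesis by simp
qed

lemma
  assumes \<phi>: "Cc_fun \<Omega> \<phi>" and \<eta>: "time_weight T \<eta>"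
  shows pairing_u_eq: "pairing u \<phi> \<eta> = (\<integral>t. mass \<phi> t * \<eta> t \<partial>lborel)"
    and mass_mult_integrable: "integrable lborel (\<lambda>t. mass \<phi> t * \<eta> t)"
proof -
  have \<eta>0: "\<eta> t = 0" if "t \<notin> tint T" for t
    using \<eta> that supported_in_eq_0 by (auto simp: time_weight_def)
  have slice: "(\<lambda>x. u (x, t) * (\<phi> x * \<eta> t)) \<in> borel_measurable lebesgue"
    and slice_eq: "(\<integral>x. u (x, t) * (\<phi> x * \<eta> t) \<partial>lebesgue) = mass \<phi> t * \<eta> t" for t
    using integrable_mult_left[OF mass_integrable[OF \<phi>, of t], of "\<eta> t"] \<eta>0[of t]
    by (cases "t \<in> tint T"; simp add: mass_def mult.assoc[symmetric] borel_measurable_integrable)+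
  have "(\<lambda>t. mass \<phi> t * \<eta> t) \<in> borel_measurable borel"
    using mass_measurable[OF \<phi>] \<eta> by (auto simp: time_weight_def)
  with slice slice_eq show "pairing u \<phi> \<eta> = (\<integral>t. mass \<phi> t * \<eta> t \<partial>lborel)" "integrable lborel (\<lambda>t. mass \<phi> t * \<eta> t)"
    unfolding pairing_def
    using lebesgue_integral_slices[OF pairing_integrable[OF u_integrable \<phi> \<eta>], of "\<lambda>t. mass \<phi> t * \<eta> t"]
      integrable_lebesgue_slices[OF pairing_integrable[OF u_integrable \<phi> \<eta>], of "\<lambda>t. mass \<phi> t * \<eta> t"]
    by simp_all
qed

lemma gradient_pairing_parametrix:
  assumes \<zeta>: "test_fun (cyl \<Omega> T) \<zeta>" and b: "b \<in> Basis" and \<theta>: "smooth_fun \<theta>" and W: "smooth_fun W"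
    and V: "smooth_fun V"
    and parametrix: "\<And>p. dt W p + lapx W p = V p - dxi b \<theta> p"
  shows "(\<integral>p. (g p \<bullet> b) * (\<zeta> p * \<theta> p) \<partial>lebesgue) =
    - (\<integral>p. u p * (\<zeta> p * V p) \<partial>lebesgue) - (\<integral>p. u p * (dxi b \<zeta> p * \<theta> p) \<partial>lebesgue)
    + (\<integral>p. absorption p * (\<zeta> p * W p) \<partial>lebesgue) - (\<integral>p. u p * (dt \<zeta> p * W p) \<partial>lebesgue)
    + (\<integral>p. u p * (lapx \<zeta> p * W p) \<partial>lebesgue)
    + 2 * (\<Sum>a\<in>Basis. \<integral>p. (g p \<bullet> a) * (dxi a \<zeta> p * W p) \<partial>lebesgue)"
proof -
  note \<zeta>_smooth = test_fun_smooth[OF \<zeta>]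
  have \<zeta>W: "test_fun (cyl \<Omega> T) (\<lambda>p. \<zeta> p * W p)" and \<zeta>\<theta>: "test_fun (cyl \<Omega> T) (\<lambda>p. \<zeta> p * \<theta> p)"
    and \<zeta>V: "test_fun (cyl \<Omega> T) (\<lambda>p. \<zeta> p * V p)"
    and d\<zeta>W: "test_fun (cyl \<Omega> T) (\<lambda>p. dxi a \<zeta> p * W p)" and d\<zeta>\<theta>: "test_fun (cyl \<Omega> T) (\<lambda>p. dxi b \<zeta> p * \<theta> p)"
    and dt\<zeta>W: "test_fun (cyl \<Omega> T) (\<lambda>p. dt \<zeta> p * W p)" and lap\<zeta>W: "test_fun (cyl \<Omega> T) (\<lambda>p. lapx \<zeta> p * W p)" for a
    by (intro test_fun_mult \<zeta> test_fun_dxi test_fun_dt test_fun_lapx W \<theta> V)+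
  have sum_eq: "(\<Sum>a\<in>Basis. dxi a (\<lambda>p. dxi a \<zeta> p * W p) p) = (\<Sum>a\<in>Basis. dxi a \<zeta> p * dxi a W p) + lapx \<zeta> p * W p" for p
    unfolding dxi_mult[OF smooth_fun_dxi[OF \<zeta>_smooth] W] by (simp add: lapx_def sum.distrib sum_distrib_right)
  have dxi_eq: "dxi b (\<lambda>p. \<zeta> p * \<theta> p) p = \<zeta> p * V p + dxi b \<zeta> p * \<theta> p
      - (dt (\<lambda>p. \<zeta> p * W p) p + lapx (\<lambda>p. \<zeta> p * W p) p)
      + dt \<zeta> p * W p - lapx \<zeta> p * W p + 2 * (\<Sum>a\<in>Basis. dxi a (\<lambda>p. dxi a \<zeta> p * W p) p)" for p
    unfolding sum_eq dt_mult[OF \<zeta>_smooth W] lapx_mult[OF \<zeta>_smooth W] dxi_mult[OF \<zeta>_smooth \<theta>]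
    unfolding eq_diff_eq[THEN iffD1, OF parametrix, symmetric] by (simp add: algebra_simps)
  have "u p * dxi b (\<lambda>p. \<zeta> p * \<theta> p) p = u p * (\<zeta> p * V p) + u p * (dxi b \<zeta> p * \<theta> p)
      - (u p * dt (\<lambda>p. \<zeta> p * W p) p + u p * lapx (\<lambda>p. \<zeta> p * W p) p)
      + u p * (dt \<zeta> p * W p) - u p * (lapx \<zeta> p * W p) + 2 * (\<Sum>a\<in>Basis. u p * dxi a (\<lambda>p. dxi a \<zeta> p * W p) p)" for p
    unfolding dxi_eq by (simp add: algebra_simps sum_distrib_left)
  then have "(\<integral>p. u p * dxi b (\<lambda>p. \<zeta> p * \<theta> p) p \<partial>lebesgue) =
      (\<integral>p. u p * (\<zeta> p * V p) \<partial>lebesgue) + (\<integral>p. u p * (dxi b \<zeta> p * \<theta> p) \<partial>lebesgue)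
      - ((\<integral>p. u p * dt (\<lambda>p. \<zeta> p * W p) p \<partial>lebesgue) + (\<integral>p. u p * lapx (\<lambda>p. \<zeta> p * W p) p \<partial>lebesgue))
      + (\<integral>p. u p * (dt \<zeta> p * W p) \<partial>lebesgue) - (\<integral>p. u p * (lapx \<zeta> p * W p) \<partial>lebesgue)
      + 2 * (\<Sum>a\<in>Basis. \<integral>p. u p * dxi a (\<lambda>p. dxi a \<zeta> p * W p) p \<partial>lebesgue)"
    using integrable_u_mult[OF \<zeta>V] integrable_u_mult[OF d\<zeta>\<theta>] integrable_u_mult[OF test_fun_dt[OF \<zeta>W]]
      integrable_u_mult[OF test_fun_lapx[OF \<zeta>W]] integrable_u_mult[OF dt\<zeta>W] integrable_u_mult[OF lap\<zeta>W]
      integrable_u_mult[OF test_fun_dxi[OF d\<zeta>W]] by simp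
  then show ?thesis
    using gradient_identity[OF \<zeta>\<theta> b] equation[OF \<zeta>W] gradient_identity[OF d\<zeta>W]
    by (simp add: sum_negf absorption_def)
qed

lemma gradient_estimate:
  assumes \<zeta>: "test_fun (cyl \<Omega> T) \<zeta>" and b: "b \<in> Basis" and \<rho>: "0 < \<rho>"
  defines "c \<equiv> gauss_moment TYPE('a)"
  shows "(\<integral>p. \<bar>g p \<bullet> b\<bar> * \<bar>\<zeta> p\<bar> \<partial>lebesgue) \<le>
    (\<integral>p. u p * \<bar>dxi b \<zeta> p\<bar> \<partial>lebesgue) + c / \<rho> * (\<integral>p. u p * \<bar>\<zeta> p\<bar> \<partial>lebesgue)
    + c * \<rho> * ((\<integral>p. absorption p * \<bar>\<zeta> p\<bar> \<partial>lebesgue) + (\<integral>p. u p * \<bar>dt \<zeta> p\<bar> \<partial>lebesgue)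
      + (\<integral>p. u p * \<bar>lapx \<zeta> p\<bar> \<partial>lebesgue) + 2 * (\<Sum>a\<in>Basis. \<integral>p. \<bar>g p \<bullet> a\<bar> * \<bar>dxi a \<zeta> p\<bar> \<partial>lebesgue))"
    (is "_ \<le> ?R")
proof -
  have "(\<integral>p. \<bar>(g p \<bullet> b) * \<zeta> p\<bar> \<partial>lebesgue) \<le> ?R"
  proof (rule integral_abs_le_test_fun[OF integrable_gradient_mult[OF \<zeta>]])
    fix \<theta> :: "'a \<times> real \<Rightarrow> real" assume \<theta>: "test_fun UNIV \<theta>" "\<And>p. \<bar>\<theta> p\<bar> \<le> 1"
    obtain W V where W: "smooth_fun W" and V: "smooth_fun V"
      and W_le: "\<And>p. \<bar>W p\<bar> \<le> c * \<rho>" and V_le: "\<And>p. \<bar>V p\<bar> \<le> c / \<rho>"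
      and parametrix: "\<And>p. dt W p + lapx W p = V p - dxi b \<theta> p"
      unfolding c_def by (rule heat_parametrix[OF b \<theta> \<rho>]) blast
    have u_le: "\<bar>\<integral>p. u p * (w p * m p) \<partial>lebesgue\<bar> \<le> B * (\<integral>p. u p * \<bar>w p\<bar> \<partial>lebesgue)"
      if "test_fun (cyl \<Omega> T) w" "\<And>p. \<bar>m p\<bar> \<le> B" for w m B
      using abs_integral_mult_le[OF integrable_u_mult[OF that(1)] that(2)] by (simp add: u_nonneg)
    have "\<bar>\<integral>p. absorption p * (\<zeta> p * W p) \<partial>lebesgue\<bar> \<le> c * \<rho> * (\<integral>p. absorption p * \<bar>\<zeta> p\<bar> \<partial>lebesgue)"
      using abs_integral_mult_le[OF integrable_absorption_mult[OF \<zeta>] W_le] by (simp add: absorption_nonneg)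
    moreover have "(\<Sum>a\<in>Basis. \<integral>p. (g p \<bullet> a) * (dxi a \<zeta> p * W p) \<partial>lebesgue) \<le>
        c * \<rho> * (\<Sum>a\<in>Basis. \<integral>p. \<bar>g p \<bullet> a\<bar> * \<bar>dxi a \<zeta> p\<bar> \<partial>lebesgue)"
      unfolding sum_distrib_left[of "c * \<rho>"]
      by (rule sum_mono, rule order_trans[OF abs_ge_self],
          rule abs_integral_mult_le[OF integrable_gradient_mult[OF test_fun_dxi[OF \<zeta>]] W_le])
    ultimately have "(\<integral>p. (g p \<bullet> b) * (\<zeta> p * \<theta> p) \<partial>lebesgue) \<le> ?R"
      unfolding gradient_pairing_parametrix[OF \<zeta> b test_fun_smooth[OF \<theta>(1)] W V parametrix] distrib_left
      using u_le[where m=V, OF \<zeta> V_le] u_le[where m=\<theta>, OF test_fun_dxi[OF \<zeta>, of b] \<theta>(2)]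
        u_le[where m=W, OF test_fun_dt[OF \<zeta>] W_le] u_le[where m=W, OF test_fun_lapx[OF \<zeta>] W_le]
      by linarith
    then show "(\<integral>p. (g p \<bullet> b) * \<zeta> p * \<theta> p \<partial>lebesgue) \<le> ?R" by (simp only: mult.assoc)
  qed
  then show ?thesis by (simp add: abs_mult)
qed

abbreviation slab :: "real \<Rightarrow> real \<Rightarrow> ('a \<times> real \<Rightarrow> real) \<Rightarrow> ('a \<Rightarrow> real) \<Rightarrow> real" where
  "slab t1 t2 F \<phi> \<equiv> pairing F \<phi> (indicator {t1<..t2})"

context
  fixes t1 t2 :: real
  assumes t1: "0 < t1" and t12: "t1 \<le> t2" and t2: "t2 \<in> tint T"
begin

lemma time_weight_slab: "time_weight T (indicator {t1<..t2})"
  by (rule time_weight_indicator[OF _ _ t1 t2]) auto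

context
  fixes n :: "nat \<Rightarrow> real" and N :: real
  assumes n: "filterlim n at_top sequentially" "\<And>k. N \<le> n k" and N: "0 < N" "t2 + 1 / N \<in> tint T"
begin

lemma rate_pos: "0 < n k"
  using n(2)[of k] N(1) by linarith

lemma inverse_rate_le: "1 / n k \<le> 1 / N"
  using n(2)[of k] N(1) by (intro frac_le) auto

lemma Cc_fun_time_kernel:
  assumes \<tau>: "\<tau> \<in> {t1..t2}"
  shows "Cc_fun (tint T) (time_kernel (n k) \<tau>)"
  unfolding Cc_fun_iff
proof
  show "supported_in (tint T) (time_kernel (n k) \<tau>)"
    by (rule supported_inI[OF compact_Icc tint_Icc_subset[OF t1 N(2)]])
      (use \<tau> inverse_rate_le[of k] in \<open>auto intro!: time_kernel_eq_0[OF rate_pos]\<close>)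
qed (rule time_kernel_continuous_on)

lemma time_cutoff_support: "t \<notin> {t1..t2 + 1 / N} \<Longrightarrow> time_cutoff (n k) t1 t2 t = 0"
  using inverse_rate_le[of k] by (intro time_cutoff_eq_0[OF rate_pos t12]) auto

lemma test_fun_time_cutoff: "test_fun (tint T) (time_cutoff (n k) t1 t2)"
  unfolding test_fun_iff
  by (auto intro!: smooth_fun_time_cutoff time_cutoff_support
      supported_inI[OF compact_Icc tint_Icc_subset[OF t1 N(2)]])

lemma pairing_time_cutoff_tendsto:
  assumes "locally_integrable (cyl \<Omega> T) F" "Cc_fun \<Omega> \<phi>"
  shows "(\<lambda>k. pairing F \<phi> (time_cutoff (n k) t1 t2)) \<longlonglongrightarrow> slab t1 t2 F \<phi>"
proof (rule pairing_tendsto[OF assms time_weight_slab])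
  show "time_weight T (indicator {t1..t2 + 1 / N})"
    by (rule time_weight_indicator[OF _ _ t1 N(2)]) auto
  show "\<bar>time_cutoff (n k) t1 t2 t\<bar> \<le> indicator {t1..t2 + 1 / N} t" for k t
    using time_cutoff_bounds[OF rate_pos t12, of k t] time_cutoff_support[of t k] by (auto simp: indicator_def)
qed (auto intro: time_weight_Cc_fun test_fun_imp_Cc_fun test_fun_time_cutoff time_cutoff_tendsto n(1) t12)

lemma pairing_time_kernel_tendsto:
  assumes \<phi>: "Cc_fun \<Omega> \<phi>" and \<tau>: "\<tau> \<in> {t1..t2}"
  shows "(\<lambda>k. pairing u \<phi> (time_kernel (n k) \<tau>)) \<longlonglongrightarrow> mass \<phi> \<tau>"
proof -
  have "{\<tau>..\<tau> + 1 / N} \<subseteq> tint T" using tint_Icc_subset[OF t1 N(2)] \<tau> by force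
  then show ?thesis
    unfolding pairing_u_eq[OF \<phi> time_weight_Cc_fun[OF Cc_fun_time_kernel[OF \<tau>]]]
    by (rule integral_mult_time_kernel_tendsto[OF n N(1) mass_measurable[OF \<phi>]
        continuous_on_subset[OF mass_continuous_on[OF \<phi>]]])
qed

lemma energy_identity_cutoff:
  assumes \<phi>: "test_fun \<Omega> \<phi>"
  shows "pairing u \<phi> (time_kernel (n k) t1) - pairing u \<phi> (time_kernel (n k) t2)
    + pairing u (lap \<phi>) (time_cutoff (n k) t1 t2) = pairing absorption \<phi> (time_cutoff (n k) t1 t2)"
proof -
  note \<phi>_smooth = test_fun_smooth[OF \<phi>]
  have kernel: "integrable lebesgue (\<lambda>p. u p * (\<phi> (fst p) * time_kernel (n k) \<tau> (snd p)))" if "\<tau> \<in> {t1..t2}" for \<tau>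
    by (intro pairing_integrable[OF u_integrable test_fun_imp_Cc_fun[OF \<phi>]] time_weight_Cc_fun
      Cc_fun_time_kernel that)
  have "pairing u \<phi> (deriv (time_cutoff (n k) t1 t2)) + pairing u (lap \<phi>) (time_cutoff (n k) t1 t2)
      = pairing absorption \<phi> (time_cutoff (n k) t1 t2)"
    using equation[OF test_fun_separated[OF \<phi> test_fun_time_cutoff]]
    by (simp add: dt_separated[OF \<phi>_smooth smooth_fun_time_cutoff] lapx_separated[OF \<phi>_smooth smooth_fun_time_cutoff]
        pairing_def absorption_def)
  then show ?thesis
    using kernel[of t1] kernel[of t2] t12 by (simp add: deriv_time_cutoff pairing_def right_diff_distrib)
qed

lemma gradient_cutoff:
  fixes k :: nat
  assumes \<phi>: "test_fun \<Omega> \<phi>" "\<And>x. 0 \<le> \<phi> x" and b: "b \<in> Basis" and \<rho>: "0 < \<rho>"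
  defines "c \<equiv> gauss_moment TYPE('a)" and "\<eta> \<equiv> time_cutoff (n k) t1 t2"
  shows "pairing (\<lambda>p. \<bar>g p \<bullet> b\<bar>) \<phi> \<eta> \<le> pairing u (\<lambda>x. \<bar>dirderiv b \<phi> x\<bar>) \<eta> + c / \<rho> * pairing u \<phi> \<eta>
    + c * \<rho> * (pairing absorption \<phi> \<eta> + (pairing u \<phi> (time_kernel (n k) t1) + pairing u \<phi> (time_kernel (n k) t2))
      + pairing u (\<lambda>x. \<bar>lap \<phi> x\<bar>) \<eta> + 2 * (\<Sum>a\<in>Basis. pairing (\<lambda>p. \<bar>g p \<bullet> a\<bar>) (\<lambda>x. \<bar>dirderiv a \<phi> x\<bar>) \<eta>))"
proof -
  note separated = test_fun_smooth[OF \<phi>(1)] smooth_fun_time_cutoff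
  let ?\<zeta> = "\<lambda>p. \<phi> (fst p) * \<eta> (snd p)" and ?k = "time_kernel (n k)"
  have \<zeta>: "test_fun (cyl \<Omega> T) ?\<zeta>"
    unfolding \<eta>_def by (rule test_fun_separated[OF \<phi>(1) test_fun_time_cutoff])
  have \<eta>_abs: "\<bar>\<eta> t\<bar> = \<eta> t" for t
    using time_cutoff_bounds[OF rate_pos t12, of k t] by (simp add: \<eta>_def)
  have kernel: "integrable lebesgue (\<lambda>p. u p * (\<phi> (fst p) * ?k \<tau> (snd p)))" if "\<tau> \<in> {t1..t2}" for \<tau>
    by (intro pairing_integrable[OF u_integrable test_fun_imp_Cc_fun[OF \<phi>(1)]] time_weight_Cc_fun
      Cc_fun_time_kernel that)
  have "(\<integral>p. u p * \<bar>dt ?\<zeta> p\<bar> \<partial>lebesgue) \<le>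
      (\<integral>p. u p * (\<phi> (fst p) * ?k t1 (snd p)) + u p * (\<phi> (fst p) * ?k t2 (snd p)) \<partial>lebesgue)"
  proof (rule integral_mono)
    show "integrable lebesgue (\<lambda>p. u p * \<bar>dt ?\<zeta> p\<bar>)"
      using integrable_abs[OF integrable_u_mult[OF test_fun_dt[OF \<zeta>]]] by (simp add: abs_mult u_nonneg)
    show "integrable lebesgue (\<lambda>p. u p * (\<phi> (fst p) * ?k t1 (snd p)) + u p * (\<phi> (fst p) * ?k t2 (snd p)))"
      using kernel[of t1] kernel[of t2] t12 by simp
    fix p :: "'a \<times> real"
    have "0 \<le> ?k \<tau> (snd p)" for \<tau> by (rule time_kernel_nonneg) (use rate_pos[of k] in simp)
    then have "\<bar>?k t1 (snd p) - ?k t2 (snd p)\<bar> \<le> ?k t1 (snd p) + ?k t2 (snd p)" by (simp add: abs_le_iff)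
    then have "u p * (\<phi> (fst p) * \<bar>?k t1 (snd p) - ?k t2 (snd p)\<bar>)
        \<le> u p * (\<phi> (fst p) * (?k t1 (snd p) + ?k t2 (snd p)))"
      by (intro mult_left_mono u_nonneg \<phi>(2))
    then show "u p * \<bar>dt ?\<zeta> p\<bar> \<le> u p * (\<phi> (fst p) * ?k t1 (snd p)) + u p * (\<phi> (fst p) * ?k t2 (snd p))"
      unfolding \<eta>_def dt_separated[OF separated] deriv_time_cutoff by (simp add: abs_mult \<phi>(2) distrib_left)
  qed
  also have "\<dots> = pairing u \<phi> (?k t1) + pairing u \<phi> (?k t2)"
    using kernel[of t1] kernel[of t2] t12 by (simp add: pairing_def)
  finally have "c * \<rho> * (\<integral>p. u p * \<bar>dt ?\<zeta> p\<bar> \<partial>lebesgue) \<le> c * \<rho> * (pairing u \<phi> (?k t1) + pairing u \<phi> (?k t2))"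
    using \<rho> gauss_moment_nonneg[where 'a='a] by (intro mult_left_mono) (auto simp: c_def)
  moreover have "\<bar>?\<zeta> p\<bar> = \<phi> (fst p) * \<eta> (snd p)" "\<bar>dxi a ?\<zeta> p\<bar> = \<bar>dirderiv a \<phi> (fst p)\<bar> * \<eta> (snd p)"
    "\<bar>lapx ?\<zeta> p\<bar> = \<bar>lap \<phi> (fst p)\<bar> * \<eta> (snd p)" for p a
    using \<eta>_abs \<phi>(2) unfolding \<eta>_def dxi_separated[OF separated] lapx_separated[OF separated] by (auto simp: abs_mult)
  ultimately show ?thesis
    using gradient_estimate[OF \<zeta> b \<rho>] unfolding pairing_def c_def distrib_left by simp
qed

end

lemma cutoff_rate_exists:
  obtains n :: "nat \<Rightarrow> real" and N :: real where "filterlim n at_top sequentially" "\<And>k. N \<le> n k" "0 < N"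
    "t2 + 1 / N \<in> tint T"
proof -
  obtain N where N: "0 < N" "t2 + 1 / N \<in> tint T" by (rule tint_extend[OF t2])
  show ?thesis
    by (rule that[of "\<lambda>k. N + real k" N])
      (use N in \<open>auto intro!: filterlim_tendsto_add_at_top[OF tendsto_const filterlim_real_sequentially]\<close>)
qed

lemma energy_identity:
  assumes \<phi>: "test_fun \<Omega> \<phi>"
  shows "mass \<phi> t1 - mass \<phi> t2 + slab t1 t2 u (lap \<phi>) = slab t1 t2 absorption \<phi>"
proof -
  obtain n N where n: "filterlim n at_top sequentially" "\<And>k. N \<le> n k" "0 < N" "t2 + 1 / N \<in> tint T"
    by (rule cutoff_rate_exists) blast
  note cutoff = pairing_time_cutoff_tendsto[OF n]
    and kernel = pairing_time_kernel_tendsto[OF n test_fun_imp_Cc_fun[OF \<phi>]]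
  show ?thesis
  proof (rule LIMSEQ_unique)
    show "(\<lambda>k. pairing u \<phi> (time_kernel (n k) t1) - pairing u \<phi> (time_kernel (n k) t2)
        + pairing u (lap \<phi>) (time_cutoff (n k) t1 t2)) \<longlonglongrightarrow> mass \<phi> t1 - mass \<phi> t2 + slab t1 t2 u (lap \<phi>)"
      using t12 by (intro tendsto_intros cutoff kernel u_integrable test_fun_imp_Cc_fun test_fun_lap \<phi>) auto
    show "(\<lambda>k. pairing u \<phi> (time_kernel (n k) t1) - pairing u \<phi> (time_kernel (n k) t2)
        + pairing u (lap \<phi>) (time_cutoff (n k) t1 t2)) \<longlonglongrightarrow> slab t1 t2 absorption \<phi>"
      unfolding energy_identity_cutoff[OF n \<phi>]
      by (intro cutoff locally_integrable_absorption test_fun_imp_Cc_fun \<phi>)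
  qed
qed

lemma gradient_slab:
  assumes \<phi>: "test_fun \<Omega> \<phi>" "\<And>x. 0 \<le> \<phi> x" and b: "b \<in> Basis" and \<rho>: "0 < \<rho>"
  defines "c \<equiv> gauss_moment TYPE('a)"
  shows "slab t1 t2 (\<lambda>p. \<bar>g p \<bullet> b\<bar>) \<phi> \<le> slab t1 t2 u (\<lambda>x. \<bar>dirderiv b \<phi> x\<bar>) + c / \<rho> * slab t1 t2 u \<phi>
    + c * \<rho> * (slab t1 t2 absorption \<phi> + (mass \<phi> t1 + mass \<phi> t2) + slab t1 t2 u (\<lambda>x. \<bar>lap \<phi> x\<bar>)
      + 2 * (\<Sum>a\<in>Basis. slab t1 t2 (\<lambda>p. \<bar>g p \<bullet> a\<bar>) (\<lambda>x. \<bar>dirderiv a \<phi> x\<bar>)))"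
proof -
  obtain n N where n: "filterlim n at_top sequentially" "\<And>k. N \<le> n k" "0 < N" "t2 + 1 / N \<in> tint T"
    by (rule cutoff_rate_exists) blast
  note \<phi>_Cc = test_fun_imp_Cc_fun[OF \<phi>(1)]
  have derivs_Cc: "Cc_fun \<Omega> (\<lambda>x. \<bar>dirderiv a \<phi> x\<bar>)" "Cc_fun \<Omega> (\<lambda>x. \<bar>lap \<phi> x\<bar>)" for a
    by (intro Cc_fun_abs test_fun_imp_Cc_fun test_fun_dirderiv test_fun_lap \<phi>(1))+
  have gradient: "locally_integrable (cyl \<Omega> T) (\<lambda>p. \<bar>g p \<bullet> a\<bar>)" for a
    by (rule locally_integrable_abs[OF gradient_integrable])
  note cutoff = pairing_time_cutoff_tendsto[OF n] and kernel = pairing_time_kernel_tendsto[OF n \<phi>_Cc]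
  show ?thesis
    unfolding c_def
    by (rule LIMSEQ_le[OF cutoff[OF gradient \<phi>_Cc] _
          exI[where x=0, OF allI[OF impI[OF gradient_cutoff[OF n \<phi> b \<rho>]]]]],
        intro tendsto_intros cutoff kernel u_integrable locally_integrable_absorption gradient \<phi>_Cc derivs_Cc)
      (use t12 in auto)
qed

end

end

section \<open>Radial weights and their shells\<close>

lemma flat_exp_mono_index:
  assumes "m \<le> n" "y \<le> 1"
  shows "flat_exp m y \<le> flat_exp n y"
proof (cases "0 < y")
  case True
  then have "y ^ n \<le> y ^ m" using assms by (intro power_decreasing) auto
  then show ?thesis using True by (simp add: flat_exp_def frac_le)
qed (simp add: flat_exp_def)

lemma lap_real_compose:
  assumes f: "smooth_fun f" and \<psi>: "smooth_fun \<psi>"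
  shows "lap (\<lambda>x. \<psi> (f x)) x = deriv (deriv \<psi>) (f x) * (\<Sum>b\<in>Basis. (dirderiv b f x)\<^sup>2) + deriv \<psi> (f x) * lap f x"
proof -
  note f_diff = smooth_fun_differentiable[OF f]
  note \<psi>' = smooth_fun_deriv[OF \<psi>]
  have compose: "dirderiv b (\<lambda>x. \<eta> (f x)) = (\<lambda>x. deriv \<eta> (f x) * dirderiv b f x)" if "smooth_fun \<eta>" for \<eta> b
    by (rule dirderiv_real_compose[OF f_diff smooth_fun_DERIV[OF that]])
  have "(\<lambda>x. deriv \<psi> (f x)) differentiable (at x)" for x
    using has_derivative_real_compose[OF f_diff smooth_fun_DERIV[OF \<psi>']] unfolding differentiable_def by blast
  then have "dirderiv b (dirderiv b (\<lambda>x. \<psi> (f x))) x =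
      deriv (deriv \<psi>) (f x) * (dirderiv b f x)\<^sup>2 + deriv \<psi> (f x) * dirderiv b (dirderiv b f) x" for b
    unfolding compose[OF \<psi>]
    by (subst dirderiv_mult) (simp_all add: compose[OF \<psi>'] smooth_fun_differentiable smooth_fun_dirderiv f
      power2_eq_square)
  then show ?thesis unfolding lap_def by (simp add: sum.distrib sum_distrib_left)
qed

lemma dirderiv_ball_depth: "dirderiv b (ball_depth a R) = (\<lambda>x. - 2 / R\<^sup>2 * ((x - a) \<bullet> b))"
proof
  fix x
  have "(ball_depth a R has_derivative (\<lambda>v. - 2 / R\<^sup>2 * ((x - a) \<bullet> v))) (at x)"
    unfolding ball_depth_def[abs_def] divide_inverse
    by (auto intro!: derivative_eq_intros simp: inner_commute)
  then show "dirderiv b (ball_depth a R) x = - 2 / R\<^sup>2 * ((x - a) \<bullet> b)" by (rule has_derivative_imp_dirderiv)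
qed

lemma lap_ball_depth: "lap (ball_depth (a :: 'a::euclidean_space) R) x = - 2 * real DIM('a) / R\<^sup>2"
proof -
  have "dirderiv b (\<lambda>x. - 2 / R\<^sup>2 * ((x - a) \<bullet> b)) x = - 2 / R\<^sup>2 * (b \<bullet> b)" for b
    by (rule has_derivative_imp_dirderiv[where D="\<lambda>v. - 2 / R\<^sup>2 * (v \<bullet> b)"])
      (auto intro!: derivative_eq_intros simp: divide_inverse)
  then show ?thesis unfolding lap_def dirderiv_ball_depth by simp
qed

lemma lap_radial:
  assumes "smooth_fun \<psi>" "0 < R"
  shows "lap (\<lambda>x. \<psi> (ball_depth (a :: 'a::euclidean_space) R x)) x
    = 4 / R\<^sup>2 * (1 - ball_depth a R x) * deriv (deriv \<psi>) (ball_depth a R x)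
      - 2 * real DIM('a) / R\<^sup>2 * deriv \<psi> (ball_depth a R x)"
proof -
  have "(\<Sum>b\<in>Basis. (dirderiv b (ball_depth a R) x)\<^sup>2) = 4 / R\<^sup>2 * (((x - a) \<bullet> (x - a)) / R\<^sup>2)"
    unfolding dirderiv_ball_depth euclidean_inner[of "x - a" "x - a"]
    by (simp add: power_mult_distrib sum_distrib_left sum_divide_distrib power2_eq_square)
  then show ?thesis
    unfolding lap_real_compose[OF smooth_fun_ball_depth assms(1)] lap_ball_depth by (simp add: ball_depth_def mult_ac)
qed

lemma deriv_flat_exp: "deriv (flat_exp n) = (\<lambda>y. flat_exp (n + 2) y - n * flat_exp (n + 1) y)"
  by (rule ext, rule DERIV_imp_deriv[OF DERIV_flat_exp])

lemma deriv_flat_exp_0: "deriv (flat_exp 0) = flat_exp 2"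
  unfolding deriv_flat_exp by (simp add: numeral_2_eq_2)

lemma deriv_flat_exp_2: "deriv (flat_exp 2) = (\<lambda>y. flat_exp 4 y - 2 * flat_exp 3 y)"
  unfolding deriv_flat_exp by (simp add: numeral_eq_Suc)

lemma lap_ball_bump:
  assumes "0 < R"
  shows "lap (ball_bump 0 (a :: 'a::euclidean_space) R) x
    = 4 / R\<^sup>2 * (1 - ball_depth a R x) * (ball_bump 4 a R x - 2 * ball_bump 3 a R x)
      - 2 * real DIM('a) / R\<^sup>2 * ball_bump 2 a R x"
  using lap_radial[OF smooth_fun_flat_exp[OF smooth_fun_ident] assms, of 0 a x]
  unfolding ball_bump_def[abs_def] by (simp only: deriv_flat_exp_0 deriv_flat_exp_2)

lemma quartic_absorption:
  fixes A s :: real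
  shows "2 * (A - 9 / 2) * s\<^sup>2 - 2 * (s ^ 4 - 3 * s ^ 3) \<le> A\<^sup>2"
proof -
  have "2 * A * s\<^sup>2 - s ^ 4 \<le> A\<^sup>2"
    using zero_le_power2[of "s\<^sup>2 - A"] by (simp add: power2_diff power_mult[symmetric] mult.commute)
  moreover have "6 * s ^ 3 - s ^ 4 \<le> 9 * s\<^sup>2"
    using zero_le_power2[of "s\<^sup>2 - 3 * s"]
    by (simp add: power2_eq_square power3_eq_cube power4_eq_xxxx algebra_simps)
  ultimately show ?thesis by (simp add: algebra_simps)
qed

text \<open>Near the boundary of the ball the positive term with ball_bump 4 dominates everything else.\<close>

lemma ball_bump_absorption:
  fixes a :: "'a::euclidean_space"
  assumes R: "0 < R" and C: "0 \<le> C"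
  obtains B where "0 \<le> B" "\<And>x. C * ball_bump 2 a R x - lap (ball_bump 0 a R) x \<le> B * ball_bump 0 a R x"
proof -
  define A where "A = C * R\<^sup>2 / 4 + real DIM('a) / 2 + 9 / 2"
  define B where "B = 2 / R\<^sup>2 * A\<^sup>2"
  show ?thesis
  proof (rule that[of B])
    show "0 \<le> B" by (simp add: B_def)
    fix x
    define y where "y = ball_depth a R x"
    show "C * ball_bump 2 a R x - lap (ball_bump 0 a R) x \<le> B * ball_bump 0 a R x"
    proof (cases "0 < y")
      case False
      then show ?thesis unfolding lap_ball_bump[OF R] by (simp add: ball_bump_def flat_exp_def y_def[symmetric])
    next
      case True
      define s where "s = 1 / y"
      have bump: "ball_bump m a R x = exp (- s) * s ^ m" for m
        using True by (simp add: ball_bump_def flat_exp_def y_def[symmetric] s_def power_one_over)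
      have ys: "1 - y = 1 - 1 / s" "s \<noteq> 0" using True by (auto simp: s_def)
      have "2 / R\<^sup>2 * (2 * (A - 9 / 2) * s\<^sup>2 - 2 * (s ^ 4 - 3 * s ^ 3)) \<le> B"
        unfolding B_def by (intro mult_left_mono quartic_absorption) auto
      moreover have "C * s\<^sup>2 - (4 / R\<^sup>2 * (1 - 1 / s) * (s ^ 4 - 2 * s ^ 3) - 2 * real DIM('a) / R\<^sup>2 * s\<^sup>2)
          = 2 / R\<^sup>2 * (2 * (A - 9 / 2) * s\<^sup>2 - 2 * (s ^ 4 - 3 * s ^ 3)) - 8 / R\<^sup>2 * s\<^sup>2"
        using R ys(2) unfolding A_def by (simp add: field_simps power2_eq_square power3_eq_cube power4_eq_xxxx)
      moreover have "0 \<le> 8 / R\<^sup>2 * s\<^sup>2" by simp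
      ultimately have "C * s\<^sup>2 - (4 / R\<^sup>2 * (1 - 1 / s) * (s ^ 4 - 2 * s ^ 3)
          - 2 * real DIM('a) / R\<^sup>2 * s\<^sup>2) \<le> B" by linarith
      then have "exp (- s) * (C * s\<^sup>2 - (4 / R\<^sup>2 * (1 - 1 / s) * (s ^ 4 - 2 * s ^ 3)
          - 2 * real DIM('a) / R\<^sup>2 * s\<^sup>2)) \<le> exp (- s) * B"
        by (intro mult_left_mono) auto
      then show ?thesis
        unfolding lap_ball_bump[OF R] bump y_def[symmetric] ys(1)
        by (simp add: algebra_simps add_divide_distrib diff_divide_distrib)
    qed
  qed
qed

definition shell :: "nat \<Rightarrow> real set" where
  "shell k = {y. 1 / 2 \<le> 2 ^ k * y \<and> 2 ^ k * y \<le> 2}"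

definition shell_cutoff :: "nat \<Rightarrow> real \<Rightarrow> real" where
  "shell_cutoff k y = smooth_step (2 ^ k * y) - smooth_step (2 ^ k * y / 2)"

definition shell_profile :: "nat \<Rightarrow> real \<Rightarrow> real" where
  "shell_profile k y = flat_exp 0 y * shell_cutoff k y"

definition shell_bump :: "nat \<Rightarrow> 'a::euclidean_space \<Rightarrow> real \<Rightarrow> 'a \<Rightarrow> real" where
  "shell_bump k a R x = shell_profile k (ball_depth a R x)"

lemma shell_pos: "y \<in> shell k \<Longrightarrow> 0 < y"
  using zero_less_mult_pos[of "2 ^ k" y] by (simp add: shell_def)

lemma four_power_shell:
  assumes "y \<in> shell k"
  shows "4 ^ k * y\<^sup>2 \<le> 4" "1 \<le> 4 * (4 ^ k * y\<^sup>2)"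
proof -
  have "4 ^ k * y\<^sup>2 = (2 ^ k * y)\<^sup>2"
    using power_mult_distrib[of "2::real" 2 k] by (simp add: power2_eq_square mult_ac)
  moreover have "(2 ^ k * y)\<^sup>2 \<le> 2\<^sup>2" "(1 / 2)\<^sup>2 \<le> (2 ^ k * y)\<^sup>2"
    using assms by (intro power_mono; simp add: shell_def)+
  ultimately show "4 ^ k * y\<^sup>2 \<le> 4" "1 \<le> 4 * (4 ^ k * y\<^sup>2)" by (simp_all add: power_divide)
qed

lemma sum_shell_le:
  assumes f: "\<And>k. f k \<le> A * indicator (shell k) y" and A: "0 \<le> (A :: real)"
  shows "(\<Sum>k<K. f k) \<le> 3 * A"
proof -
  define S where "S = {k \<in> {..<K}. y \<in> shell k}"
  have "card S \<le> 3"
  proof (cases "S = {}")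
    case False
    define j where "j = Min S"
    have j: "y \<in> shell j" using Min_in[of S] False by (auto simp: j_def S_def)
    have "S \<subseteq> {j..<j + 3}"
    proof
      fix k assume k: "k \<in> S"
      have "2 ^ k * y \<le> 2 ^ (j + 2) * y"
        using k j by (auto simp: S_def shell_def power_add)
      then have "(2::real) ^ k \<le> 2 ^ (j + 2)" using shell_pos[OF j] by simp
      then have "k \<le> j + 2" by (simp only: power_increasing_iff one_less_numeral_iff semiring_norm)
      moreover have "j \<le> k" unfolding j_def using k by (intro Min_le) (auto simp: S_def)
      ultimately show "k \<in> {j..<j + 3}" by simp
    qed
    then show ?thesis using card_mono[of "{j..<j + 3}" S] by simp
  qed simp
  have "(\<Sum>k<K. f k) \<le> (\<Sum>k<K. A * indicator (shell k) y)" by (rule sum_mono[OF f])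
  also have "\<dots> = (\<Sum>k\<in>S. A)"
    by (rule sum.mono_neutral_cong_right) (auto simp: S_def)
  also have "\<dots> = A * real (card S)" by simp
  also have "\<dots> \<le> A * 3" using \<open>card S \<le> 3\<close> A by (intro mult_left_mono) auto
  finally show ?thesis by simp
qed

lemma smooth_fun_shell_cutoff: "smooth_fun (shell_cutoff k)"
  and smooth_fun_shell_profile: "smooth_fun (shell_profile k)"
  unfolding shell_profile_def[abs_def] shell_cutoff_def[abs_def] divide_inverse
  by (intro smooth_fun_intros smooth_fun_smooth_step)+

lemma deriv_deriv_smooth_step_eq_0:
  assumes "x \<le> 1 / 2 \<or> 1 \<le> x"
  shows "deriv (deriv smooth_step) x = 0"
  by (rule DERIV_local_min[OF smooth_fun_DERIV[OF smooth_fun_deriv[OF smooth_step_smooth]] zero_less_one])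
    (simp add: deriv_smooth_step_eq_0[OF assms] deriv_smooth_step_nonneg)

lemma smooth_step_derivs_bounded:
  obtains C where "1 \<le> C" "\<And>x. \<bar>deriv smooth_step x\<bar> \<le> C" "\<And>x. \<bar>deriv (deriv smooth_step) x\<bar> \<le> C"
proof -
  have step': "test_fun UNIV (deriv smooth_step)"
    unfolding test_fun_iff
  proof
    show "supported_in UNIV (deriv smooth_step)"
      by (rule supported_inI[of "{1/2..1}"]) (auto intro: deriv_smooth_step_eq_0)
  qed (rule smooth_fun_deriv[OF smooth_step_smooth])
  obtain C1 where C1: "\<And>x. \<bar>deriv smooth_step x\<bar> \<le> C1" by (rule test_fun_bounded[OF step']) blast
  obtain C2 where C2: "\<And>x. \<bar>deriv (deriv smooth_step) x\<bar> \<le> C2"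
    using test_fun_bounded[OF test_fun_dirderiv[OF step', of 1]]
    unfolding dirderiv_1_eq_deriv[OF test_fun_smooth[OF step']] by blast
  show ?thesis
    using C1 C2 by (intro that[of "max 1 (max C1 C2)"]) (auto simp: le_max_iff_disj)
qed

lemma
  shows deriv_shell_cutoff: "deriv (shell_cutoff k)
      = (\<lambda>y. 2 ^ k * deriv smooth_step (2 ^ k * y) - 2 ^ k / 2 * deriv smooth_step (2 ^ k * y / 2))"
    and deriv_deriv_shell_cutoff: "deriv (deriv (shell_cutoff k)) =
      (\<lambda>y. 4 ^ k * deriv (deriv smooth_step) (2 ^ k * y) - 4 ^ k / 4 * deriv (deriv smooth_step) (2 ^ k * y / 2))"
proof -
  have scale: "((\<lambda>y. h (c * y)) has_real_derivative c * deriv h (c * y)) (at y)" if "smooth_fun h" for h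
    and c y :: real
  proof -
    have "((\<lambda>y. c * y) has_real_derivative c) (at y)" by (auto intro!: derivative_eq_intros)
    from DERIV_chain2[OF smooth_fun_DERIV[OF that] this] show ?thesis by (simp add: mult.commute)
  qed
  note step = scale[OF smooth_step_smooth] and step' = scale[OF smooth_fun_deriv[OF smooth_step_smooth]]
  show first: "deriv (shell_cutoff k) = (\<lambda>y. 2 ^ k * deriv smooth_step (2 ^ k * y)
      - 2 ^ k / 2 * deriv smooth_step (2 ^ k * y / 2))"
    unfolding shell_cutoff_def[abs_def]
    using DERIV_diff[OF step[of "2 ^ k"] step[of "2 ^ k / 2"]] by (auto intro!: DERIV_imp_deriv)
  have four: "(4::real) ^ k = 2 ^ k * 2 ^ k" by (simp flip: power_mult_distrib)
  show "deriv (deriv (shell_cutoff k)) =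
      (\<lambda>y. 4 ^ k * deriv (deriv smooth_step) (2 ^ k * y) - 4 ^ k / 4 * deriv (deriv smooth_step) (2 ^ k * y / 2))"
    unfolding first
    using DERIV_diff[OF DERIV_cmult[OF step'[of "2 ^ k"], of "2 ^ k"]
      DERIV_cmult[OF step'[of "2 ^ k / 2"], of "2 ^ k / 2"]]
    by (auto intro!: DERIV_imp_deriv simp: four mult.assoc)
qed

lemma shell_cutoff_eq_0:
  assumes "y \<notin> shell k"
  shows "shell_cutoff k y = 0" "deriv (shell_cutoff k) y = 0" "deriv (deriv (shell_cutoff k)) y = 0"
proof -
  define x where "x = 2 ^ k * y"
  have "x \<le> 1 / 2 \<or> 1 \<le> x" "x / 2 \<le> 1 / 2 \<or> 1 \<le> x / 2" "x \<le> 1 / 2 \<and> x / 2 \<le> 1 / 2 \<or> 1 \<le> x \<and> 1 \<le> x / 2"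
    using assms by (auto simp: shell_def x_def)
  then show "shell_cutoff k y = 0" "deriv (shell_cutoff k) y = 0" "deriv (deriv (shell_cutoff k)) y = 0"
    unfolding deriv_deriv_shell_cutoff unfolding deriv_shell_cutoff shell_cutoff_def x_def[symmetric]
    by (auto simp: smooth_step_eq_0 smooth_step_eq_1 deriv_smooth_step_eq_0 deriv_deriv_smooth_step_eq_0)
qed

lemma abs_shell_cutoff_le: "\<bar>shell_cutoff k y\<bar> \<le> indicator (shell k) y"
  using shell_cutoff_eq_0(1)[of y k] smooth_step_bounds[of "2 ^ k * y"] smooth_step_bounds[of "2 ^ k * y / 2"]
  by (cases "y \<in> shell k") (auto simp: shell_cutoff_def)

lemma shell_cutoff_derivs_bounded:
  obtains C where "1 \<le> C"
    "\<And>k y. \<bar>y * deriv (shell_cutoff k) y\<bar> \<le> C * indicator (shell k) y"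
    "\<And>k y. \<bar>y\<^sup>2 * deriv (deriv (shell_cutoff k)) y\<bar> \<le> C * indicator (shell k) y"
proof -
  obtain C where C: "1 \<le> C" "\<And>x. \<bar>deriv smooth_step x\<bar> \<le> C" "\<And>x. \<bar>deriv (deriv smooth_step) x\<bar> \<le> C"
    by (rule smooth_step_derivs_bounded) blast
  show ?thesis
  proof (rule that[of "5 * C"])
    show "1 \<le> 5 * C" using C(1) by simp
    fix k y
    show "\<bar>y * deriv (shell_cutoff k) y\<bar> \<le> 5 * C * indicator (shell k) y"
    proof (cases "y \<in> shell k")
      case True
      define z where "z = deriv smooth_step (2 ^ k * y) - deriv smooth_step (2 ^ k * y / 2) / 2"
      have "y * deriv (shell_cutoff k) y = (2 ^ k * y) * z"
        unfolding deriv_shell_cutoff z_def by (simp add: algebra_simps)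
      then have "\<bar>y * deriv (shell_cutoff k) y\<bar> = (2 ^ k * y) * \<bar>z\<bar>"
        using shell_pos[OF True] by (simp add: abs_mult)
      moreover have "\<bar>z\<bar> \<le> C + C / 2"
        using C(2)[of "2 ^ k * y"] C(2)[of "2 ^ k * y / 2"] unfolding z_def by linarith
      then have "(2 ^ k * y) * \<bar>z\<bar> \<le> 2 * (C + C / 2)"
        using True shell_pos[OF True] by (intro mult_mono) (auto simp: shell_def)
      ultimately show ?thesis using True C(1) by simp
    qed (simp add: shell_cutoff_eq_0)
    show "\<bar>y\<^sup>2 * deriv (deriv (shell_cutoff k)) y\<bar> \<le> 5 * C * indicator (shell k) y"
    proof (cases "y \<in> shell k")
      case True
      define z where "z = deriv (deriv smooth_step) (2 ^ k * y) - deriv (deriv smooth_step) (2 ^ k * y / 2) / 4"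
      have "y\<^sup>2 * deriv (deriv (shell_cutoff k)) y = (4 ^ k * y\<^sup>2) * z"
        unfolding deriv_deriv_shell_cutoff z_def by (simp add: algebra_simps)
      then have "\<bar>y\<^sup>2 * deriv (deriv (shell_cutoff k)) y\<bar> = (4 ^ k * y\<^sup>2) * \<bar>z\<bar>"
        by (simp only: abs_mult[of "4 ^ k * y\<^sup>2"]) (simp add: abs_mult)
      moreover have "\<bar>z\<bar> \<le> C + C / 4"
        using C(3)[of "2 ^ k * y"] C(3)[of "2 ^ k * y / 2"] unfolding z_def by linarith
      then have "(4 ^ k * y\<^sup>2) * \<bar>z\<bar> \<le> 4 * (C + C / 4)"
        using four_power_shell(1)[OF True] by (intro mult_mono) auto
      ultimately show ?thesis using True C(1) by simp
    qed (simp add: shell_cutoff_eq_0)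
  qed
qed

lemma
  shows deriv_shell_profile: "deriv (shell_profile k)
      = (\<lambda>y. flat_exp 0 y * deriv (shell_cutoff k) y + flat_exp 2 y * shell_cutoff k y)"
    and deriv_deriv_shell_profile: "deriv (deriv (shell_profile k))
        = (\<lambda>y. flat_exp 0 y * deriv (deriv (shell_cutoff k)) y
      + 2 * (flat_exp 2 y * deriv (shell_cutoff k) y) + (flat_exp 4 y - 2 * flat_exp 3 y) * shell_cutoff k y)"
proof -
  note flat = smooth_fun_DERIV[OF smooth_fun_flat_exp[OF smooth_fun_ident]]
  note cutoff = smooth_fun_DERIV[OF smooth_fun_shell_cutoff]
    smooth_fun_DERIV[OF smooth_fun_deriv[OF smooth_fun_shell_cutoff]]
  show first: "deriv (shell_profile k) = (\<lambda>y. flat_exp 0 y * deriv (shell_cutoff k) y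
      + flat_exp 2 y * shell_cutoff k y)"
    unfolding shell_profile_def[abs_def]
    using DERIV_mult'[OF flat[of 0] cutoff(1)[of k]] by (auto intro!: DERIV_imp_deriv simp: deriv_flat_exp_0)
  show "deriv (deriv (shell_profile k)) = (\<lambda>y. flat_exp 0 y * deriv (deriv (shell_cutoff k)) y
      + 2 * (flat_exp 2 y * deriv (shell_cutoff k) y) + (flat_exp 4 y - 2 * flat_exp 3 y) * shell_cutoff k y)"
    unfolding first
    using DERIV_add[OF DERIV_mult'[OF flat[of 0] cutoff(2)[of k]] DERIV_mult'[OF flat[of 2] cutoff(1)[of k]]]
    by (auto intro!: DERIV_imp_deriv simp: deriv_flat_exp_0 deriv_flat_exp_2 algebra_simps)
qed

lemma abs_flat_exp_mult_le:
  assumes "m + j \<le> n" "y \<le> 1" "\<bar>y ^ j * z\<bar> \<le> C * Z" "0 \<le> C * Z"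
  shows "\<bar>flat_exp m y * z\<bar> \<le> C * (flat_exp n y * Z)"
proof -
  have "flat_exp m y * z = flat_exp (m + j) y * (y ^ j * z)"
    by (simp add: flat_exp_def power_add)
  then have "\<bar>flat_exp m y * z\<bar> = flat_exp (m + j) y * \<bar>y ^ j * z\<bar>"
    by (simp only: abs_mult[of "flat_exp (m + j) y"] abs_of_nonneg[OF flat_exp_nonneg])
  also have "\<dots> \<le> flat_exp n y * (C * Z)"
    using assms by (intro mult_mono flat_exp_mono_index flat_exp_nonneg) auto
  finally show ?thesis by (simp add: mult_ac)
qed

lemma shell_profile_derivs_bounded:
  obtains D where "1 \<le> D"
    "\<And>k y. y \<le> 1 \<Longrightarrow> \<bar>deriv (shell_profile k) y\<bar> \<le> D * (flat_exp 2 y * indicator (shell k) y)"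
    "\<And>k y. y \<le> 1 \<Longrightarrow> \<bar>deriv (deriv (shell_profile k)) y\<bar> \<le> D * (flat_exp 4 y * indicator (shell k) y)"
proof -
  obtain C where C: "1 \<le> C"
    "\<And>k y. \<bar>y * deriv (shell_cutoff k) y\<bar> \<le> C * indicator (shell k) y"
    "\<And>k y. \<bar>y\<^sup>2 * deriv (deriv (shell_cutoff k)) y\<bar> \<le> C * indicator (shell k) y"
    by (rule shell_cutoff_derivs_bounded) blast
  show ?thesis
  proof (rule that[of "3 * C + 3"])
    show "1 \<le> 3 * C + 3" using C(1) by simp
    fix k y assume y: "y \<le> (1::real)"
    define X where "X n = flat_exp n y * indicator (shell k) y" for n
    have cutoff: "\<bar>flat_exp m y * shell_cutoff k y\<bar> \<le> 1 * X n" if "m \<le> n" for m n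
      unfolding X_def by (rule abs_flat_exp_mult_le[where j=0]) (use abs_shell_cutoff_le y that in auto)
    have deriv_cutoff: "\<bar>flat_exp m y * deriv (shell_cutoff k) y\<bar> \<le> C * X n" if "m + 1 \<le> n" for m n
      unfolding X_def by (rule abs_flat_exp_mult_le[where j=1]) (use C y that in auto)
    have "\<bar>flat_exp 0 y * deriv (deriv (shell_cutoff k)) y\<bar> \<le> C * X 4"
      unfolding X_def by (rule abs_flat_exp_mult_le[where j=2]) (use C y in auto)
    then have "\<bar>deriv (deriv (shell_profile k)) y\<bar> \<le> (3 * C + 3) * X 4"
      using cutoff[of 3 4] cutoff[of 4 4] deriv_cutoff[of 2 4]
      unfolding deriv_deriv_shell_profile distrib_right left_diff_distrib mult.assoc by linarith
    then show "\<bar>deriv (deriv (shell_profile k)) y\<bar> \<le> (3 * C + 3) * (flat_exp 4 y * indicator (shell k) y)"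
      by (simp only: X_def)
    have "0 \<le> X 2" "0 \<le> C * X 2" using C(1) by (simp_all add: X_def flat_exp_nonneg)
    then have "\<bar>deriv (shell_profile k) y\<bar> \<le> (3 * C + 3) * X 2"
      using cutoff[of 2 2] deriv_cutoff[of 0 2] unfolding deriv_shell_profile distrib_right mult.assoc by linarith
    then show "\<bar>deriv (shell_profile k) y\<bar> \<le> (3 * C + 3) * (flat_exp 2 y * indicator (shell k) y)"
      by (simp only: X_def)
  qed
qed

lemma shell_bump_eq: "shell_bump k a R x = ball_bump 0 a R x * shell_cutoff k (ball_depth a R x)"
  by (simp add: shell_bump_def shell_profile_def ball_bump_def)

lemma test_fun_shell_bump:
  assumes "0 < R" "cball a R \<subseteq> U"
  shows "test_fun U (shell_bump k a R)"
proof -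
  have "smooth_fun (\<lambda>x. shell_cutoff k (ball_depth a R x))"
    unfolding shell_cutoff_def divide_inverse
    by (intro smooth_fun_intros smooth_fun_smooth_step smooth_fun_ball_depth)
  then show ?thesis unfolding shell_bump_eq[abs_def] by (rule test_fun_mult[OF test_fun_ball_bump[OF assms]])
qed

lemma shell_bump_nonneg: "0 \<le> shell_bump k a R x"
proof -
  have "0 \<le> shell_cutoff k y" for y
  proof (cases "0 \<le> y")
    case True
    then show ?thesis using monoD[OF mono_smooth_step, of "2 ^ k * y / 2" "2 ^ k * y"] by (simp add: shell_cutoff_def)
  next
    case False
    then have "2 ^ k * y \<le> 0" by (simp add: mult_le_0_iff)
    then show ?thesis by (simp add: shell_cutoff_def smooth_step_eq_0)
  qed
  then show ?thesis by (simp add: shell_bump_eq ball_bump_nonneg)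
qed

lemma sum_shell_bump: "(\<Sum>k<Suc K. shell_bump k a R x) = ball_bump 0 a R x * smooth_step (2 ^ K * ball_depth a R x)"
proof (induction K)
  case 0
  show ?case using ball_depth_le_1[of a R x] by (simp add: shell_bump_eq shell_cutoff_def smooth_step_eq_0)
next
  case (Suc K)
  then show ?case by (simp add: shell_bump_eq shell_cutoff_def right_diff_distrib mult.assoc)
qed

lemma sum_shell_bump_le: "(\<Sum>k<K. shell_bump k a R x) \<le> ball_bump 0 a R x"
proof (cases K)
  case (Suc L)
  show ?thesis
    unfolding Suc sum_shell_bump by (rule mult_left_le[OF smooth_step_bounds(2) ball_bump_nonneg])
qed (simp add: ball_bump_nonneg)

lemma ball_bump_le_sum_shell_bump:
  "ball_bump 0 a R x \<le> (\<Sum>k<Suc K. shell_bump k a R x) + (1 / 2) ^ K * ball_bump 1 a R x"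
proof -
  define y where "y = ball_depth a R x"
  have "flat_exp 0 y * (1 - smooth_step (2 ^ K * y)) \<le> (1 / 2) ^ K * flat_exp 1 y"
  proof (cases "2 ^ K * y \<le> 1")
    case True
    have "flat_exp 0 y * (1 - smooth_step (2 ^ K * y)) \<le> flat_exp 0 y"
      by (rule mult_left_le) (simp_all add: flat_exp_nonneg smooth_step_bounds)
    also have "flat_exp 0 y = y * flat_exp 1 y" by (simp add: flat_exp_def)
    also have "\<dots> \<le> (1 / 2) ^ K * flat_exp 1 y"
      using True by (intro mult_right_mono flat_exp_nonneg) (simp add: power_one_over field_simps)
    finally show ?thesis .
  qed (simp add: smooth_step_eq_1 flat_exp_nonneg)
  then show ?thesis unfolding sum_shell_bump ball_bump_def y_def by (simp add: right_diff_distrib)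
qed

lemma dirderiv_shell_bump:
  "dirderiv b (shell_bump k a R) x = deriv (shell_profile k) (ball_depth a R x) * (- 2 / R\<^sup>2 * ((x - a) \<bullet> b))"
  unfolding shell_bump_def[abs_def]
    dirderiv_real_compose[OF smooth_fun_differentiable[OF smooth_fun_ball_depth]
      smooth_fun_DERIV[OF smooth_fun_shell_profile]]
  by (simp add: dirderiv_ball_depth)

lemma dirderiv_shell_bump_le:
  fixes a x :: "'a::euclidean_space" and R :: real
  defines "y \<equiv> ball_depth a R"
  assumes R: "0 < R" and b: "b \<in> Basis"
    and profile: "\<bar>deriv (shell_profile k) (y x)\<bar> \<le> X * indicator (shell k) (y x)"
  shows "\<bar>dirderiv b (shell_bump k a R) x\<bar> \<le> 2 / R * (X * indicator (shell k) (y x))"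
proof (cases "y x \<in> shell k")
  case True
  have "dist a x < R"
    using shell_pos[OF True] ball_depth_pos_iff[OF R, of a x] by (simp add: y_def)
  then have "\<bar>- 2 / R\<^sup>2 * ((x - a) \<bullet> b)\<bar> \<le> 2 / R\<^sup>2 * R"
    unfolding abs_mult using Basis_le_norm[OF b, of "x - a"]
    by (intro mult_mono) (auto simp: dist_norm norm_minus_commute)
  also have "\<dots> = 2 / R" using R by (simp add: power2_eq_square)
  finally have "\<bar>deriv (shell_profile k) (y x) * (- 2 / R\<^sup>2 * ((x - a) \<bullet> b))\<bar>
      \<le> X * indicator (shell k) (y x) * (2 / R)"
    unfolding abs_mult[of "deriv _ _"] using profile abs_ge_zero[of "deriv (shell_profile k) (y x)"]
    by (intro mult_mono) auto
  then show ?thesis unfolding dirderiv_shell_bump y_def by (simp only: mult_ac)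
next
  case False
  then show ?thesis using profile unfolding dirderiv_shell_bump y_def by simp
qed

lemma lap_shell_bump_le:
  fixes a x :: "'a::euclidean_space" and R :: real
  defines "y \<equiv> ball_depth a R"
  assumes R: "0 < R"
    and profile: "\<bar>deriv (shell_profile k) (y x)\<bar> \<le> X * indicator (shell k) (y x)"
      "\<bar>deriv (deriv (shell_profile k)) (y x)\<bar> \<le> X * indicator (shell k) (y x)"
  shows "\<bar>lap (shell_bump k a R) x\<bar> \<le> (4 + 2 * real DIM('a)) / R\<^sup>2 * (X * indicator (shell k) (y x))"
proof -
  let ?X = "X * indicator (shell k) (y x)"
  have "0 \<le> 1 - y x \<and> 1 - y x \<le> 1" if "y x \<in> shell k"
    using shell_pos[OF that] ball_depth_le_1[of a R x] by (simp add: y_def)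
  then have "\<bar>(1 - y x) * deriv (deriv (shell_profile k)) (y x)\<bar> \<le> ?X"
    using profile(2) mult_mono[of "\<bar>1 - y x\<bar>" 1 "\<bar>deriv (deriv (shell_profile k)) (y x)\<bar>" ?X]
    by (cases "y x \<in> shell k") (auto simp: abs_mult)
  then have "4 / R\<^sup>2 * \<bar>(1 - y x) * deriv (deriv (shell_profile k)) (y x)\<bar>
      + 2 * real DIM('a) / R\<^sup>2 * \<bar>deriv (shell_profile k) (y x)\<bar> \<le> 4 / R\<^sup>2 * ?X + 2 * real DIM('a) / R\<^sup>2 * ?X"
    using profile(1) by (intro add_mono mult_left_mono) auto
  also have "\<dots> = (4 + 2 * real DIM('a)) / R\<^sup>2 * ?X" by (simp add: add_divide_distrib distrib_right)
  finally have "\<bar>4 / R\<^sup>2 * (1 - y x) * deriv (deriv (shell_profile k)) (y x)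
      - 2 * real DIM('a) / R\<^sup>2 * deriv (shell_profile k) (y x)\<bar> \<le> (4 + 2 * real DIM('a)) / R\<^sup>2 * ?X"
    by (intro order_trans[OF abs_triangle_ineq4]) (simp only: mult.assoc abs_mult, simp)
  then show ?thesis
    unfolding shell_bump_def[abs_def] lap_radial[OF smooth_fun_shell_profile R] by (simp only: y_def)
qed

lemma shell_bump_derivs_bounded:
  fixes a :: "'a::euclidean_space"
  assumes R: "0 < R"
  obtains D where "1 \<le> D"
    "\<And>k b x. b \<in> Basis \<Longrightarrow>
      \<bar>dirderiv b (shell_bump k a R) x\<bar> \<le> D * (ball_bump 2 a R x * indicator (shell k) (ball_depth a R x))"
    "\<And>k x. \<bar>lap (shell_bump k a R) x\<bar> \<le> D * (ball_bump 4 a R x * indicator (shell k) (ball_depth a R x))"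
proof -
  obtain D where D: "1 \<le> D"
    "\<And>k y. y \<le> 1 \<Longrightarrow> \<bar>deriv (shell_profile k) y\<bar> \<le> D * (flat_exp 2 y * indicator (shell k) y)"
    "\<And>k y. y \<le> 1 \<Longrightarrow> \<bar>deriv (deriv (shell_profile k)) y\<bar> \<le> D * (flat_exp 4 y * indicator (shell k) y)"
    by (rule shell_profile_derivs_bounded) blast
  define E where "E = 1 + 2 / R + (4 + 2 * real DIM('a)) / R\<^sup>2"
  have E: "1 \<le> E" "2 / R \<le> E" "(4 + 2 * real DIM('a)) / R\<^sup>2 \<le> E" using R by (auto simp: E_def)
  show ?thesis
  proof (rule that[of "E * D"])
    show "1 \<le> E * D" using mult_mono[of 1 E 1 D] D(1) E(1) by simp
    fix k x
    define X where "X n = D * ball_bump n a R x * indicator (shell k) (ball_depth a R x)" for n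
    have X: "0 \<le> X n" for n using D(1) by (simp add: X_def ball_bump_nonneg)
    have "ball_bump 2 a R x \<le> ball_bump 4 a R x"
      unfolding ball_bump_def by (rule flat_exp_mono_index) (simp_all add: ball_depth_le_1)
    then have "X 2 \<le> X 4" unfolding X_def using D(1) by (intro mult_right_mono mult_left_mono) auto
    note profile = D(2,3)[OF ball_depth_le_1, of k a R x, folded ball_bump_def mult.assoc]
    show "\<bar>dirderiv b (shell_bump k a R) x\<bar> \<le> E * D * (ball_bump 2 a R x * indicator (shell k) (ball_depth a R x))"
      if "b \<in> Basis" for b
      using dirderiv_shell_bump_le[OF R that profile(1)] mult_right_mono[OF E(2) X[of 2]]
        by (simp add: X_def mult.assoc)
    show "\<bar>lap (shell_bump k a R) x\<bar> \<le> E * D * (ball_bump 4 a R x * indicator (shell k) (ball_depth a R x))"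
      using lap_shell_bump_le[OF R order_trans[OF profile(1)] profile(2)] \<open>X 2 \<le> X 4\<close> mult_right_mono[OF E(3) X[of 4]]
      by (simp add: X_def mult.assoc)
  qed
qed

lemma flat_exp_shell:
  assumes "y \<in> shell k"
  shows "4 ^ k * flat_exp n y \<le> 4 * flat_exp (n + 2) y" "flat_exp (n + 2) y \<le> 4 * (4 ^ k * flat_exp n y)"
proof -
  have "flat_exp n y = y\<^sup>2 * flat_exp (n + 2) y"
    using shell_pos[OF assms] by (simp add: flat_exp_def power_add power2_eq_square)
  then show "4 ^ k * flat_exp n y \<le> 4 * flat_exp (n + 2) y" "flat_exp (n + 2) y \<le> 4 * (4 ^ k * flat_exp n y)"
    using mult_right_mono[OF four_power_shell(1)[OF assms] flat_exp_nonneg[of "n + 2" y]]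
      mult_right_mono[OF four_power_shell(2)[OF assms] flat_exp_nonneg[of "n + 2" y]] by (simp_all add: mult.assoc)
qed

lemma ball_bump_shell:
  fixes k m n :: nat and a x :: "'a::euclidean_space" and R :: real
  defines "i \<equiv> indicator (shell k) (ball_depth a R x)"
  assumes "m = n + 2"
  shows "4 ^ k * (ball_bump n a R x * i) \<le> 4 * ball_bump m a R x * i"
    "(1 / 4) ^ k * (ball_bump m a R x * i) \<le> 4 * ball_bump n a R x * i"
  using flat_exp_shell[of "ball_depth a R x" k n] assms(2)
  by (auto simp: i_def ball_bump_def indicator_def power_one_over field_simps)

lemma weighted_sum_shell_le:
  assumes "\<And>k. 0 \<le> w k" "\<And>k. z k \<le> D * X k" "\<And>k. w k * X k \<le> 4 * Z * indicator (shell k) y" "0 \<le> Z" "0 \<le> (D :: real)"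
  shows "(\<Sum>k<K. w k * z k) \<le> 12 * D * Z"
proof -
  have "w k * z k \<le> 4 * D * Z * indicator (shell k) y" for k
  proof -
    have "w k * z k \<le> D * (w k * X k)"
      using mult_left_mono[OF assms(2,1), of k k] by (simp add: mult_ac)
    also have "\<dots> \<le> D * (4 * Z * indicator (shell k) y)" using assms(3,5) by (intro mult_left_mono) auto
    finally show ?thesis by (simp add: mult_ac)
  qed
  then show ?thesis using sum_shell_le[of "\<lambda>k. w k * z k" "4 * D * Z" y K] assms(4,5) by simp
qed

definition shell_bumps_dominated :: "'a::euclidean_space \<Rightarrow> real \<Rightarrow> real \<Rightarrow> bool" where
  "shell_bumps_dominated a R D \<longleftrightarrow> (\<forall>K x.
    (\<forall>b\<in>Basis. (\<Sum>k<K. \<bar>dirderiv b (shell_bump k a R) x\<bar>) \<le> D * ball_bump 2 a R x) \<and>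
    (\<forall>b\<in>Basis. (\<Sum>k<K. (1 / 4) ^ k * \<bar>dirderiv b (shell_bump k a R) x\<bar>) \<le> D * ball_bump 0 a R x) \<and>
    (\<Sum>k<K. (1 / 4) ^ k * \<bar>lap (shell_bump k a R) x\<bar>) \<le> D * ball_bump 2 a R x \<and>
    (\<Sum>k<K. 4 ^ k * shell_bump k a R x) \<le> D * ball_bump 2 a R x)"

lemma shell_bumps_dominatedD:
  assumes "shell_bumps_dominated a R D"
  shows "b \<in> Basis \<Longrightarrow> (\<Sum>k<K. \<bar>dirderiv b (shell_bump k a R) x\<bar>) \<le> D * ball_bump 2 a R x"
    "b \<in> Basis \<Longrightarrow> (\<Sum>k<K. (1 / 4) ^ k * \<bar>dirderiv b (shell_bump k a R) x\<bar>) \<le> D * ball_bump 0 a R x"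
    "(\<Sum>k<K. (1 / 4) ^ k * \<bar>lap (shell_bump k a R) x\<bar>) \<le> D * ball_bump 2 a R x"
    "(\<Sum>k<K. 4 ^ k * shell_bump k a R x) \<le> D * ball_bump 2 a R x"
  using assms unfolding shell_bumps_dominated_def by blast+

lemma shell_bumps_dominated_exists:
  fixes a :: "'a::euclidean_space"
  assumes R: "0 < R"
  obtains D where "1 \<le> D" "shell_bumps_dominated a R D"
proof -
  let ?i = "\<lambda>k x. indicator (shell k) (ball_depth a R x)"
  obtain D where D: "1 \<le> D"
    "\<And>k b x. b \<in> Basis \<Longrightarrow> \<bar>dirderiv b (shell_bump k a R) x\<bar> \<le> D * (ball_bump 2 a R x * ?i k x)"
    "\<And>k x. \<bar>lap (shell_bump k a R) x\<bar> \<le> D * (ball_bump 4 a R x * ?i k x)"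
    by (rule shell_bump_derivs_bounded[OF R]) blast
  have bump: "shell_bump k a R x \<le> D * (ball_bump 0 a R x * ?i k x)" for k x
  proof -
    have "shell_bump k a R x \<le> 1 * (ball_bump 0 a R x * ?i k x)"
      unfolding shell_bump_eq mult_1 by (intro mult_left_mono ball_bump_nonneg abs_le_D1[OF abs_shell_cutoff_le])
    also have "\<dots> \<le> D * (ball_bump 0 a R x * ?i k x)"
      using D(1) by (intro mult_right_mono) (simp_all add: ball_bump_nonneg)
    finally show ?thesis .
  qed
  have "shell_bumps_dominated a R (12 * D)"
    unfolding shell_bumps_dominated_def
  proof (intro allI conjI ballI)
    fix K x
    show "(\<Sum>k<K. (1 / 4) ^ k * \<bar>lap (shell_bump k a R) x\<bar>) \<le> 12 * D * ball_bump 2 a R x"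
      by (rule weighted_sum_shell_le[OF _ D(3) ball_bump_shell(2)]) (use D(1) in \<open>auto simp: ball_bump_nonneg\<close>)
    show "(\<Sum>k<K. 4 ^ k * shell_bump k a R x) \<le> 12 * D * ball_bump 2 a R x"
      by (rule weighted_sum_shell_le[OF _ bump ball_bump_shell(1)]) (use D(1) in \<open>auto simp: ball_bump_nonneg\<close>)
    fix b :: 'a assume b: "b \<in> Basis"
    show "(\<Sum>k<K. (1 / 4) ^ k * \<bar>dirderiv b (shell_bump k a R) x\<bar>) \<le> 12 * D * ball_bump 0 a R x"
      by (rule weighted_sum_shell_le[OF _ D(2)[OF b] ball_bump_shell(2)]) (use D(1) in \<open>auto simp: ball_bump_nonneg\<close>)
    have "(\<Sum>k<K. 1 * \<bar>dirderiv b (shell_bump k a R) x\<bar>) \<le> 12 * D * ball_bump 2 a R x"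
      by (rule weighted_sum_shell_le[where y="ball_depth a R x", OF _ D(2)[OF b]])
        (use D(1) in \<open>auto simp: ball_bump_nonneg indicator_def\<close>)
    then show "(\<Sum>k<K. \<bar>dirderiv b (shell_bump k a R) x\<bar>) \<le> 12 * D * ball_bump 2 a R x" by simp
  qed
  then show ?thesis using D(1) by (intro that[of "12 * D"]) auto
qed

section \<open>Bounds near the initial time\<close>

lemma scale_exists:
  fixes n c D :: real
  assumes "0 < n" "0 \<le> c" "1 \<le> D"
  obtains \<kappa> where "0 < \<kappa>" "n * c * \<kappa> \<le> 1 / 8" "n * c * \<kappa> * D \<le> 1 / 8"
proof -
  define \<kappa> where "\<kappa> = 1 / (8 * n * (c + 1) * D)"
  have \<kappa>: "0 < \<kappa>" using assms by (simp add: \<kappa>_def)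
  have "n * c * \<kappa> * D = c / (8 * (c + 1))" using assms by (simp add: \<kappa>_def)
  also have "\<dots> \<le> 1 / 8" using assms by (simp add: field_simps)
  finally have scaled: "n * c * \<kappa> * D \<le> 1 / 8" .
  have "n * c * \<kappa> * 1 \<le> n * c * \<kappa> * D" using assms \<kappa> by (intro mult_left_mono) auto
  with scaled show ?thesis using \<kappa> by (intro that[of \<kappa>]) auto
qed

context hj_solution
begin

lemma mass_sum_le:
  assumes "\<And>k. Cc_fun \<Omega> (\<psi> k)" "Cc_fun \<Omega> \<phi>" "\<And>x. (\<Sum>k<K. w k * \<psi> k x) \<le> D * \<phi> x"
  shows "(\<Sum>k<K. w k * mass (\<psi> k) t) \<le> D * mass \<phi> t"
proof -
  have "(\<Sum>k<K. w k * mass (\<psi> k) t) = mass (\<lambda>x. \<Sum>k<K. w k * \<psi> k x) t"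
    by (subst mass_sum) (simp_all add: mass_cmult Cc_fun_cmult assms(1))
  also have "\<dots> \<le> mass (\<lambda>x. D * \<phi> x) t"
    by (rule mass_mono[OF Cc_fun_sum[OF Cc_fun_cmult[OF assms(1)]] Cc_fun_cmult[OF assms(2)] assms(3)])
  finally show ?thesis by (simp only: mass_cmult)
qed

lemma absorption_le: "absorption p \<le> 1 + (\<Sum>b\<in>Basis. \<bar>g p \<bullet> b\<bar>)"
proof -
  have "norm (g p) powr q \<le> 1 + norm (g p)"
  proof (cases "norm (g p) \<le> 1")
    case True
    then have "norm (g p) powr q \<le> 1" using q powr_mono2[of q "norm (g p)" 1] by simp
    then show ?thesis by (simp add: add_increasing2)
  next
    case False
    then show ?thesis using q powr_mono[of q 1 "norm (g p)"] by simp
  qed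
  then show ?thesis using norm_le_l1[of "g p"] by (simp add: absorption_def)
qed

context
  fixes t1 t2 :: real
  assumes t1: "0 < t1" and t12: "t1 \<le> t2" and t2: "t2 \<in> tint T"
begin

lemmas slab_mono = pairing_mono[where \<Omega>=\<Omega>, OF time_weight_slab[OF t1 t12 t2] indicator_pos_le]
  and slab_fun_mono = pairing_fun_mono[where \<Omega>=\<Omega>, OF time_weight_slab[OF t1 t12 t2] indicator_pos_le]
  and slab_add = pairing_add[where \<Omega>=\<Omega>, OF time_weight_slab[OF t1 t12 t2]]
  and slab_sum = pairing_sum[where \<Omega>=\<Omega>, OF time_weight_slab[OF t1 t12 t2]]
  and slab_fun_add = pairing_fun_add[where \<Omega>=\<Omega>, OF time_weight_slab[OF t1 t12 t2]]
  and slab_fun_sum = pairing_fun_sum[where \<Omega>=\<Omega>, OF time_weight_slab[OF t1 t12 t2]]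

lemma slab_sum_le:
  assumes F: "locally_integrable (cyl \<Omega> T) F" "\<And>p. 0 \<le> F p"
    and "\<And>k. Cc_fun \<Omega> (\<psi> k)" "Cc_fun \<Omega> \<phi>" "\<And>x. (\<Sum>k<K. w k * \<psi> k x) \<le> D * \<phi> x"
  shows "(\<Sum>k<K. w k * slab t1 t2 F (\<psi> k)) \<le> D * slab t1 t2 F \<phi>"
proof -
  have "(\<Sum>k<K. w k * slab t1 t2 F (\<psi> k)) = slab t1 t2 F (\<lambda>x. \<Sum>k<K. w k * \<psi> k x)"
    by (subst slab_sum[OF F(1)]) (simp_all add: pairing_cmult Cc_fun_cmult assms(3))
  also have "\<dots> \<le> slab t1 t2 F (\<lambda>x. D * \<phi> x)"
    by (rule slab_mono[OF F Cc_fun_sum[OF Cc_fun_cmult[OF assms(3)]] Cc_fun_cmult[OF assms(4)] assms(5)])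
  finally show ?thesis by (simp only: pairing_cmult)
qed

lemma slab_u_le:
  assumes \<phi>: "Cc_fun \<Omega> \<phi>" and M: "\<And>t. t \<in> {t1<..t2} \<Longrightarrow> mass \<phi> t \<le> M"
  shows "slab t1 t2 u \<phi> \<le> (t2 - t1) * M"
proof -
  have "slab t1 t2 u \<phi> = (\<integral>t. mass \<phi> t * indicator {t1<..t2} t \<partial>lborel)"
    by (rule pairing_u_eq[OF \<phi> time_weight_slab[OF t1 t12 t2]])
  also have "\<dots> \<le> (\<integral>t. M * indicator {t1<..t2} t \<partial>lborel)"
  proof (rule integral_mono[OF mass_mult_integrable[OF \<phi> time_weight_slab[OF t1 t12 t2]]])
    show "integrable lborel (\<lambda>t. M * indicator {t1<..t2} t)"
      using t12 by (intro integrable_mult_right integrable_real_indicator) auto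
  qed (use M in \<open>auto simp: indicator_def\<close>)
  also have "\<dots> = (t2 - t1) * M" using t12 by simp
  finally show ?thesis .
qed

lemma slab_const:
  assumes \<phi>: "Cc_fun \<Omega> \<phi>"
  shows "slab t1 t2 (\<lambda>p. 1) \<phi> = (t2 - t1) * (\<integral>x. \<phi> x \<partial>lebesgue)"
proof -
  have "slab t1 t2 (\<lambda>p. 1) \<phi> = (\<integral>t. (\<integral>x. \<phi> x \<partial>lebesgue) * indicator {t1<..t2} t \<partial>lborel)"
    unfolding pairing_def
    using pairing_integrable[OF locally_integrable_const \<phi> time_weight_slab[OF t1 t12 t2], of 1]
      measurable_completion[of \<phi> lborel borel] Cc_fun_measurable[OF \<phi>]
    by (intro lebesgue_integral_slices) (auto intro!: borel_measurable_times)
  also have "\<dots> = (t2 - t1) * (\<integral>x. \<phi> x \<partial>lebesgue)" using t12 by simp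
  finally show ?thesis .
qed

lemma slab_absorption_le:
  assumes \<phi>: "Cc_fun \<Omega> \<phi>" "\<And>x. 0 \<le> \<phi> x"
  shows "slab t1 t2 absorption \<phi> \<le> slab t1 t2 (\<lambda>p. 1) \<phi> + (\<Sum>b\<in>Basis. slab t1 t2 (\<lambda>p. \<bar>g p \<bullet> b\<bar>) \<phi>)"
proof -
  have gradient: "locally_integrable (cyl \<Omega> T) (\<lambda>p. \<bar>g p \<bullet> b\<bar>)" for b
    by (rule locally_integrable_abs[OF gradient_integrable])
  have "slab t1 t2 absorption \<phi> \<le> slab t1 t2 (\<lambda>p. 1 + (\<Sum>b\<in>Basis. \<bar>g p \<bullet> b\<bar>)) \<phi>"
    by (intro slab_fun_mono locally_integrable_absorption locally_integrable_add locally_integrable_const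
        locally_integrable_sum gradient \<phi> absorption_le)
  also have "\<dots> = slab t1 t2 (\<lambda>p. 1) \<phi> + (\<Sum>b\<in>Basis. slab t1 t2 (\<lambda>p. \<bar>g p \<bullet> b\<bar>) \<phi>)"
    unfolding slab_fun_add[OF locally_integrable_const locally_integrable_sum[OF gradient] \<phi>(1)]
      slab_fun_sum[OF gradient \<phi>(1)] ..
  finally show ?thesis .
qed

end

context
  fixes a :: 'a and R :: real
  assumes R: "0 < R" and ball: "cball a R \<subseteq> \<Omega>"
begin

lemma Cc_fun_ball_bump: "Cc_fun \<Omega> (ball_bump n a R)"
  by (rule test_fun_imp_Cc_fun[OF test_fun_ball_bump[OF R ball]])

lemma shell_gradient_le:
  fixes k :: nat
  assumes t: "0 < t1" "t1 \<le> t2" "t2 \<in> tint T" and b: "b \<in> Basis" and \<kappa>: "0 < \<kappa>"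
  defines "c \<equiv> gauss_moment TYPE('a)" and "\<zeta> \<equiv> shell_bump k a R" and "w \<equiv> (1 / 4) ^ k"
  shows "slab t1 t2 (\<lambda>p. \<bar>g p \<bullet> b\<bar>) \<zeta> \<le>
    slab t1 t2 u (\<lambda>x. \<bar>dirderiv b \<zeta> x\<bar>) + c / \<kappa> * (4 ^ k * slab t1 t2 u \<zeta>)
    + c * \<kappa> * (w * slab t1 t2 absorption \<zeta> + (w * mass \<zeta> t1 + w * mass \<zeta> t2) + w * slab t1 t2 u (\<lambda>x. \<bar>lap \<zeta> x\<bar>)
      + 2 * (\<Sum>e\<in>Basis. w * slab t1 t2 (\<lambda>p. \<bar>g p \<bullet> e\<bar>) (\<lambda>x. \<bar>dirderiv e \<zeta> x\<bar>)))"
proof -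
  have "test_fun \<Omega> \<zeta>" "\<And>x. 0 \<le> \<zeta> x" "0 < \<kappa> * w"
    using \<kappa> by (auto simp: \<zeta>_def w_def shell_bump_nonneg intro: test_fun_shell_bump[OF R ball])
  from gradient_slab[OF t this(1,2) b this(3)] show ?thesis
    unfolding c_def sum_distrib_left[symmetric] by (simp add: w_def power_one_over field_simps)
qed

lemma sum_shell_gradient_le:
  assumes t: "0 < t1" "t1 \<le> t2" "t2 \<in> tint T" and b: "b \<in> Basis" and \<kappa>: "0 < \<kappa>"
    and D: "shell_bumps_dominated a R D"
  defines "c \<equiv> gauss_moment TYPE('a)" and "S \<equiv> slab t1 t2 u (ball_bump 2 a R)"
  shows "(\<Sum>k<K. slab t1 t2 (\<lambda>p. \<bar>g p \<bullet> b\<bar>) (shell_bump k a R)) \<le>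
    D * S + c / \<kappa> * (D * S) + c * \<kappa> * (slab t1 t2 absorption (ball_bump 0 a R)
      + (mass (ball_bump 0 a R) t1 + mass (ball_bump 0 a R) t2) + D * S
      + 2 * (\<Sum>e\<in>Basis. D * slab t1 t2 (\<lambda>p. \<bar>g p \<bullet> e\<bar>) (ball_bump 0 a R)))"
proof -
  let ?\<zeta> = "\<lambda>k. shell_bump k a R" and ?\<phi> = "ball_bump 0 a R" and ?w = "\<lambda>k. (1 / 4) ^ k :: real"
  let ?U = "slab t1 t2 u" and ?F = "slab t1 t2 absorption" and ?G = "\<lambda>e. slab t1 t2 (\<lambda>p. \<bar>g p \<bullet> e\<bar>)"
  have \<zeta>: "test_fun \<Omega> (?\<zeta> k)" for k by (rule test_fun_shell_bump[OF R ball])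
  have \<zeta>_Cc: "Cc_fun \<Omega> (?\<zeta> k)" "Cc_fun \<Omega> (\<lambda>x. \<bar>dirderiv e (?\<zeta> k) x\<bar>)" "Cc_fun \<Omega> (\<lambda>x. \<bar>lap (?\<zeta> k) x\<bar>)" for k e
    by (intro Cc_fun_abs test_fun_imp_Cc_fun test_fun_dirderiv test_fun_lap \<zeta>)+
  note D = shell_bumps_dominatedD[OF D]
  have damped_sum: "(\<Sum>k<K. ?w k * ?\<zeta> k x) \<le> 1 * ?\<phi> x" for x
  proof -
    have "(\<Sum>k<K. ?w k * ?\<zeta> k x) \<le> (\<Sum>k<K. ?\<zeta> k x)"
      by (intro sum_mono mult_left_le_one_le shell_bump_nonneg power_le_one) auto
    then show ?thesis using sum_shell_bump_le[of a R x K] by simp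
  qed
  have "(\<Sum>k<K. ?G b (?\<zeta> k)) \<le> (\<Sum>k<K. ?U (\<lambda>x. \<bar>dirderiv b (?\<zeta> k) x\<bar>)) + c / \<kappa> * (\<Sum>k<K. 4 ^ k * ?U (?\<zeta> k))
      + c * \<kappa> * ((\<Sum>k<K. ?w k * ?F (?\<zeta> k)) + ((\<Sum>k<K. ?w k * mass (?\<zeta> k) t1) + (\<Sum>k<K. ?w k * mass (?\<zeta> k) t2))
        + (\<Sum>k<K. ?w k * ?U (\<lambda>x. \<bar>lap (?\<zeta> k) x\<bar>)) + 2 * (\<Sum>e\<in>Basis. \<Sum>k<K. ?w k * ?G e (\<lambda>x. \<bar>dirderiv e (?\<zeta> k) x\<bar>)))"
    using sum_mono[where K="{..<K}", OF shell_gradient_le[OF t b \<kappa>], of "\<lambda>k. k"]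
      unfolding c_def sum.swap[of _ "{..<K}" Basis]
    by (simp only: sum.distrib sum_distrib_left[symmetric])
  also have "\<dots> \<le> D * S + c / \<kappa> * (D * S) + c * \<kappa> * (?F ?\<phi> + (mass ?\<phi> t1 + mass ?\<phi> t2) + D * S
      + 2 * (\<Sum>e\<in>Basis. D * ?G e ?\<phi>))"
  proof (intro add_mono mult_left_mono sum_mono)
    show "(\<Sum>k<K. ?U (\<lambda>x. \<bar>dirderiv b (?\<zeta> k) x\<bar>)) \<le> D * S"
      using slab_sum_le[where K=K and w="\<lambda>k. 1", OF t u_integrable u_nonneg \<zeta>_Cc(2) Cc_fun_ball_bump] D(1)[OF b]
      by (simp add: S_def)
    show "(\<Sum>k<K. 4 ^ k * ?U (?\<zeta> k)) \<le> D * S" "(\<Sum>k<K. ?w k * ?U (\<lambda>x. \<bar>lap (?\<zeta> k) x\<bar>)) \<le> D * S"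
      unfolding S_def by (intro slab_sum_le[OF t u_integrable u_nonneg] \<zeta>_Cc Cc_fun_ball_bump D)+
    show "(\<Sum>k<K. ?w k * ?F (?\<zeta> k)) \<le> ?F ?\<phi>"
      using slab_sum_le[OF t locally_integrable_absorption absorption_nonneg \<zeta>_Cc(1) Cc_fun_ball_bump
        damped_sum] by simp
    show "(\<Sum>k<K. ?w k * mass (?\<zeta> k) t1) \<le> mass ?\<phi> t1" "(\<Sum>k<K. ?w k * mass (?\<zeta> k) t2) \<le> mass ?\<phi> t2"
      using mass_sum_le[OF \<zeta>_Cc(1) Cc_fun_ball_bump damped_sum] by simp_all
    show "(\<Sum>k<K. ?w k * ?G e (\<lambda>x. \<bar>dirderiv e (?\<zeta> k) x\<bar>)) \<le> D * ?G e ?\<phi>" if "e \<in> Basis" for e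
      by (intro slab_sum_le[OF t locally_integrable_abs[OF gradient_integrable] abs_ge_zero] \<zeta>_Cc
        Cc_fun_ball_bump D that)
  qed (use \<kappa> gauss_moment_nonneg[where 'a='a] in \<open>auto simp: c_def\<close>)
  finally show ?thesis .
qed

lemma gradient_ball_bump_le:
  assumes t: "0 < t1" "t1 \<le> t2" "t2 \<in> tint T"
    and Q: "\<And>K. (\<Sum>k<K. slab t1 t2 (\<lambda>p. \<bar>g p \<bullet> b\<bar>) (shell_bump k a R)) \<le> Q"
  shows "slab t1 t2 (\<lambda>p. \<bar>g p \<bullet> b\<bar>) (ball_bump 0 a R) \<le> Q"
proof -
  let ?G = "slab t1 t2 (\<lambda>p. \<bar>g p \<bullet> b\<bar>)"
  have gradient: "locally_integrable (cyl \<Omega> T) (\<lambda>p. \<bar>g p \<bullet> b\<bar>)"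
    by (rule locally_integrable_abs[OF gradient_integrable])
  have \<zeta>: "Cc_fun \<Omega> (shell_bump k a R)" for k
    by (rule test_fun_imp_Cc_fun[OF test_fun_shell_bump[OF R ball]])
  have "?G (ball_bump 0 a R) \<le> Q + (1 / 2) ^ K * ?G (ball_bump 1 a R)" for K
  proof -
    have "?G (ball_bump 0 a R) \<le> ?G (\<lambda>x. (\<Sum>k<Suc K. shell_bump k a R x) + (1 / 2) ^ K * ball_bump 1 a R x)"
      by (intro slab_mono[OF t gradient abs_ge_zero] Cc_fun_add Cc_fun_sum Cc_fun_cmult Cc_fun_ball_bump \<zeta>
          ball_bump_le_sum_shell_bump)
    also have "\<dots> = (\<Sum>k<Suc K. ?G (shell_bump k a R)) + (1 / 2) ^ K * ?G (ball_bump 1 a R)"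
      unfolding slab_add[OF t gradient Cc_fun_sum[OF \<zeta>] Cc_fun_cmult[OF Cc_fun_ball_bump]]
        slab_sum[OF t gradient \<zeta>] pairing_cmult ..
    finally show ?thesis using Q[of "Suc K"] by linarith
  qed
  moreover have "(\<lambda>K. Q + (1 / 2) ^ K * ?G (ball_bump 1 a R)) \<longlonglongrightarrow> Q + 0 * ?G (ball_bump 1 a R)"
    by (intro tendsto_intros LIMSEQ_power_zero) simp
  ultimately show ?thesis using LIMSEQ_le_const[of _ Q] by simp
qed

lemma sum_gradient_ball_bump_le:
  obtains A where "0 \<le> A"
    "\<And>t1 t2. 0 < t1 \<Longrightarrow> t1 \<le> t2 \<Longrightarrow> t2 \<in> tint T \<Longrightarrow>
      (\<Sum>b\<in>Basis. slab t1 t2 (\<lambda>p. \<bar>g p \<bullet> b\<bar>) (ball_bump 0 a R)) \<le> A * slab t1 t2 u (ball_bump 2 a R)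
        + (slab t1 t2 absorption (ball_bump 0 a R) + (mass (ball_bump 0 a R) t1 + mass (ball_bump 0 a R) t2)) / 8
        + (\<Sum>b\<in>Basis. slab t1 t2 (\<lambda>p. \<bar>g p \<bullet> b\<bar>) (ball_bump 0 a R)) / 4"
proof -
  define c where "c = gauss_moment TYPE('a)"
  define n where "n = real DIM('a)"
  have c: "0 \<le> c" unfolding c_def by (rule gauss_moment_nonneg)
  have n: "0 < n" unfolding n_def by simp
  obtain D where D: "1 \<le> D" "shell_bumps_dominated a R D" by (rule shell_bumps_dominated_exists[OF R])
  obtain \<kappa> where \<kappa>: "0 < \<kappa>" and nc: "n * c * \<kappa> \<le> 1 / 8" and ncD: "n * c * \<kappa> * D \<le> 1 / 8"
    by (rule scale_exists[OF n c D(1)])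
  define A where "A = n * (D + c / \<kappa> * D + c * \<kappa> * D)"
  show ?thesis
  proof (rule that[of A])
    show "0 \<le> A" using n c \<kappa> D(1) by (simp add: A_def)
    fix t1 t2 :: real assume t: "0 < t1" "t1 \<le> t2" "t2 \<in> tint T"
    let ?\<phi> = "ball_bump 0 a R" and ?S = "slab t1 t2 u (ball_bump 2 a R)"
    define X where "X = slab t1 t2 absorption ?\<phi> + (mass ?\<phi> t1 + mass ?\<phi> t2)"
    define \<Gamma> where "\<Gamma> = (\<Sum>b\<in>Basis. slab t1 t2 (\<lambda>p. \<bar>g p \<bullet> b\<bar>) ?\<phi>)"
    have nonneg: "0 \<le> X" "0 \<le> \<Gamma>"
      unfolding X_def \<Gamma>_def
      by (intro pairing_nonneg sum_nonneg add_nonneg_nonneg mass_nonneg absorption_nonneg ball_bump_nonneg; simp)+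
    have "slab t1 t2 (\<lambda>p. \<bar>g p \<bullet> b\<bar>) ?\<phi> \<le> D * ?S + c / \<kappa> * (D * ?S) + c * \<kappa> * (X + D * ?S + 2 * (D * \<Gamma>))"
      if "b \<in> Basis" for b
      using gradient_ball_bump_le[OF t sum_shell_gradient_le[OF t that \<kappa> D(2)]]
      unfolding X_def \<Gamma>_def c_def by (simp only: sum_distrib_left)
    then have "\<Gamma> \<le> n * (D * ?S + c / \<kappa> * (D * ?S) + c * \<kappa> * (X + D * ?S + 2 * (D * \<Gamma>)))"
      unfolding \<Gamma>_def n_def by (rule sum_bounded_above)
    also have "\<dots> = A * ?S + n * c * \<kappa> * X + n * c * \<kappa> * D * (2 * \<Gamma>)"
      by (simp add: A_def algebra_simps)
    also have "\<dots> \<le> A * ?S + 1 / 8 * X + 1 / 8 * (2 * \<Gamma>)"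
      using nonneg by (intro add_mono mult_right_mono nc ncD order_refl) auto
    finally show "\<Gamma> \<le> A * ?S + X / 8 + \<Gamma> / 4" by simp
  qed
qed

lemma absorption_ball_bump_le:
  obtains C where "0 \<le> C"
    "\<And>t1 t2. 0 < t1 \<Longrightarrow> t1 \<le> t2 \<Longrightarrow> t2 \<in> tint T \<Longrightarrow> slab t1 t2 absorption (ball_bump 0 a R) \<le>
      C * slab t1 t2 u (ball_bump 2 a R) + 2 * slab t1 t2 (\<lambda>p. 1) (ball_bump 0 a R)
      + (mass (ball_bump 0 a R) t1 + mass (ball_bump 0 a R) t2) / 2"
proof -
  obtain A where A: "0 \<le> A" and gradient_le: "\<And>t1 t2. 0 < t1 \<Longrightarrow> t1 \<le> t2 \<Longrightarrow> t2 \<in> tint T \<Longrightarrow>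
      (\<Sum>b\<in>Basis. slab t1 t2 (\<lambda>p. \<bar>g p \<bullet> b\<bar>) (ball_bump 0 a R)) \<le> A * slab t1 t2 u (ball_bump 2 a R)
        + (slab t1 t2 absorption (ball_bump 0 a R) + (mass (ball_bump 0 a R) t1 + mass (ball_bump 0 a R) t2)) / 8
        + (\<Sum>b\<in>Basis. slab t1 t2 (\<lambda>p. \<bar>g p \<bullet> b\<bar>) (ball_bump 0 a R)) / 4"
    by (rule sum_gradient_ball_bump_le) blast
  show ?thesis
  proof (rule that[of "2 * A"])
    show "0 \<le> 2 * A" using A by simp
    fix t1 t2 :: real assume t: "0 < t1" "t1 \<le> t2" "t2 \<in> tint T"
    let ?\<phi> = "ball_bump 0 a R" and ?S = "slab t1 t2 u (ball_bump 2 a R)"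
      and ?I = "slab t1 t2 (\<lambda>p. 1) (ball_bump 0 a R)"
    define m where "m = mass ?\<phi> t1 + mass ?\<phi> t2"
    have "0 \<le> ?S" "0 \<le> ?I" "0 \<le> m"
      unfolding m_def by (intro pairing_nonneg add_nonneg_nonneg mass_nonneg u_nonneg ball_bump_nonneg; simp)+
    moreover from this(1) A have "0 \<le> A * ?S" by simp
    moreover have "slab t1 t2 absorption ?\<phi> \<le> ?I + (\<Sum>b\<in>Basis. slab t1 t2 (\<lambda>p. \<bar>g p \<bullet> b\<bar>) ?\<phi>)"
      by (intro slab_absorption_le[OF t] Cc_fun_ball_bump ball_bump_nonneg)
    ultimately show "slab t1 t2 absorption ?\<phi> \<le> 2 * A * ?S + 2 * ?I + m / 2"
      using gradient_le[OF t, folded m_def] unfolding mult.assoc by argo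
  qed
qed

lemma mass_ball_bump_le:
  obtains B where "0 \<le> B"
    "\<And>t1 t2. 0 < t1 \<Longrightarrow> t1 \<le> t2 \<Longrightarrow> t2 \<in> tint T \<Longrightarrow> mass (ball_bump 0 a R) t1 \<le>
      3 * mass (ball_bump 0 a R) t2 + 4 * slab t1 t2 (\<lambda>p. 1) (ball_bump 0 a R) + B * slab t1 t2 u (ball_bump 0 a R)"
proof -
  obtain C where C: "0 \<le> C" and absorption_le: "\<And>t1 t2. 0 < t1 \<Longrightarrow> t1 \<le> t2 \<Longrightarrow> t2 \<in> tint T \<Longrightarrow>
      slab t1 t2 absorption (ball_bump 0 a R) \<le> C * slab t1 t2 u (ball_bump 2 a R)
        + 2 * slab t1 t2 (\<lambda>p. 1) (ball_bump 0 a R) + (mass (ball_bump 0 a R) t1 + mass (ball_bump 0 a R) t2) / 2"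
    by (rule absorption_ball_bump_le) blast
  obtain B where B: "0 \<le> B" "\<And>x. C * ball_bump 2 a R x - lap (ball_bump 0 a R) x \<le> B * ball_bump 0 a R x"
    by (rule ball_bump_absorption[OF R C]) blast
  note \<phi> = test_fun_ball_bump[OF R ball, of 0]
  note lap_Cc = test_fun_imp_Cc_fun[OF test_fun_lap[OF \<phi>]]
  show ?thesis
  proof (rule that[of "2 * B"])
    show "0 \<le> 2 * B" using B(1) by simp
    fix t1 t2 :: real assume t: "0 < t1" "t1 \<le> t2" "t2 \<in> tint T"
    have "slab t1 t2 u (\<lambda>x. C * ball_bump 2 a R x + (-1) * lap (ball_bump 0 a R) x)
        \<le> slab t1 t2 u (\<lambda>x. B * ball_bump 0 a R x)"
      using B(2) by (intro slab_mono[OF t u_integrable u_nonneg] Cc_fun_add Cc_fun_cmult Cc_fun_ball_bump lap_Cc) simp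
    then have "C * slab t1 t2 u (ball_bump 2 a R) - slab t1 t2 u (lap (ball_bump 0 a R))
        \<le> B * slab t1 t2 u (ball_bump 0 a R)"
      unfolding slab_add[OF t u_integrable Cc_fun_cmult[OF Cc_fun_ball_bump] Cc_fun_cmult[OF lap_Cc]]
        pairing_cmult by simp
    then show "mass (ball_bump 0 a R) t1 \<le>
        3 * mass (ball_bump 0 a R) t2 + 4 * slab t1 t2 (\<lambda>p. 1) (ball_bump 0 a R) + 2 * B * slab t1 t2 u
          (ball_bump 0 a R)"
      using energy_identity[OF t \<phi>] absorption_le[OF t] by (simp add: field_simps)
  qed
qed

lemma mass_ball_bump_bounded:
  obtains M where "\<forall>\<^sub>F t in at_right 0. mass (ball_bump 0 a R) t \<le> M"
proof -
  let ?m = "mass (ball_bump 0 a R)"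
  obtain B where B: "0 \<le> B" and mass_le: "\<And>t1 t2. 0 < t1 \<Longrightarrow> t1 \<le> t2 \<Longrightarrow> t2 \<in> tint T \<Longrightarrow>
      ?m t1 \<le> 3 * ?m t2 + 4 * slab t1 t2 (\<lambda>p. 1) (ball_bump 0 a R) + B * slab t1 t2 u (ball_bump 0 a R)"
    by (rule mass_ball_bump_le) blast
  obtain T0 where T0: "0 < T0" "T0 \<in> tint T" by (rule tint_nonempty[OF T_pos])
  define t0 where "t0 = min T0 (1 / (2 * (B + 1)))"
  have t0: "0 < t0" "t0 \<le> T0" "t0 \<le> 1 / (2 * (B + 1))" using T0(1) B by (auto simp: t0_def)
  have t0_tint: "t0 \<in> tint T" using tint_Icc_subset[OF t0(1) T0(2)] t0(2) by auto
  have "2 * (B * t0) + 2 * t0 \<le> 1" "0 \<le> B * t0" using t0(1,3) B by (simp_all add: field_simps)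
  then have t0_le: "t0 \<le> 1" "B * t0 \<le> 1 / 2" using t0(1) by linarith+
  define I where "I = (\<integral>x. ball_bump 0 a R x \<partial>lebesgue)"
  have I: "0 \<le> I" unfolding I_def by (intro integral_nonneg_AE AE_I2 ball_bump_nonneg)
  have "?m t \<le> 2 * (3 * ?m t0 + 4 * I)" if t: "0 < t" "t \<le> t0" for t
  proof -
    have "continuous_on {t..t0} ?m"
      by (rule continuous_on_subset[OF mass_continuous_on[OF Cc_fun_ball_bump] tint_Icc_subset[OF t(1) t0_tint]])
    then obtain s where s: "s \<in> {t..t0}" and max: "\<And>r. r \<in> {t..t0} \<Longrightarrow> ?m r \<le> ?m s"
      using continuous_attains_sup[of "{t..t0}" ?m] t by auto
    have s': "0 < s" "s \<le> t0" using s t by auto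
    have m_s: "0 \<le> ?m s" by (rule mass_nonneg[OF ball_bump_nonneg])
    have "slab s t0 (\<lambda>p. 1) (ball_bump 0 a R) \<le> I"
      unfolding slab_const[OF s' t0_tint Cc_fun_ball_bump] I_def[symmetric]
      using I s' t0_le(1) by (intro mult_left_le_one_le) auto
    moreover have "slab s t0 u (ball_bump 0 a R) \<le> (t0 - s) * ?m s"
      by (rule slab_u_le[OF s' t0_tint Cc_fun_ball_bump max]) (use s in auto)
    then have "slab s t0 u (ball_bump 0 a R) \<le> t0 * ?m s"
      by (rule order_trans) (use s' m_s in \<open>auto intro: mult_right_mono\<close>)
    then have "B * slab s t0 u (ball_bump 0 a R) \<le> B * t0 * ?m s"
      unfolding mult.assoc using B by (rule mult_left_mono)
    moreover have "B * t0 * ?m s \<le> 1 / 2 * ?m s" by (rule mult_right_mono[OF t0_le(2) m_s])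
    ultimately have "?m s \<le> 2 * (3 * ?m t0 + 4 * I)" using mass_le[OF s' t0_tint] by argo
    then show ?thesis using max[of t] t by auto
  qed
  then have "\<forall>\<^sub>F t in at_right 0. ?m t \<le> 2 * (3 * ?m t0 + 4 * I)"
    using t0(1) by (auto simp: eventually_at_right_field)
  then show ?thesis by (rule that)
qed

end

lemma mass_bounded:
  assumes \<phi>: "Cc_fun \<Omega> \<phi>"
  obtains M where "\<forall>\<^sub>F t in at_right 0. mass (\<lambda>x. \<bar>\<phi> x\<bar>) t \<le> M"
proof -
  have "compact (tsupport \<phi>)" "tsupport \<phi> \<subseteq> \<Omega>" using \<phi> by (auto simp: Cc_fun_def)
  then obtain A r c where A: "finite A" "\<And>a. a \<in> A \<Longrightarrow> 0 < r a \<and> cball a (r a) \<subseteq> \<Omega>" and c: "0 < c"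
    and cover: "\<And>x. x \<in> tsupport \<phi> \<Longrightarrow> 1 \<le> c * (\<Sum>a\<in>A. ball_bump 0 a (r a) x)"
    by (rule ball_bumps_ge_1_on_compact[OF _ _ open_domain]) blast
  obtain B where B: "0 < B" "\<And>x. \<bar>\<phi> x\<bar> \<le> B" by (rule Cc_fun_bounded[OF \<phi>]) blast
  have bump: "Cc_fun \<Omega> (ball_bump 0 a (r a))" if "a \<in> A" for a
    using A(2)[OF that] by (intro Cc_fun_ball_bump) auto
  have "\<bar>\<phi> x\<bar> \<le> B * c * (\<Sum>a\<in>A. ball_bump 0 a (r a) x)" for x
  proof (cases "x \<in> tsupport \<phi>")
    case True
    have "\<bar>\<phi> x\<bar> \<le> B * 1" using B(2) by simp
    also have "\<dots> \<le> B * (c * (\<Sum>a\<in>A. ball_bump 0 a (r a) x))"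
      using B(1) by (intro mult_left_mono cover True) auto
    finally show ?thesis by (simp only: mult.assoc)
  next
    case False
    then show ?thesis using not_in_tsupport[of x \<phi>] B(1) c by (simp add: sum_nonneg ball_bump_nonneg)
  qed
  from mass_mono[OF Cc_fun_abs[OF \<phi>] Cc_fun_cmult[OF Cc_fun_sum[OF bump]] this]
  have mass_le: "mass (\<lambda>x. \<bar>\<phi> x\<bar>) t \<le> B * c * (\<Sum>a\<in>A. mass (ball_bump 0 a (r a)) t)" for t
    by (simp add: mass_cmult mass_sum bump)
  have "\<forall>a\<in>A. \<exists>M. \<forall>\<^sub>F t in at_right 0. mass (ball_bump 0 a (r a)) t \<le> M"
    using A(2) mass_ball_bump_bounded by metis
  then obtain M where M: "\<forall>a\<in>A. \<forall>\<^sub>F t in at_right 0. mass (ball_bump 0 a (r a)) t \<le> M a" by metis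
  have "\<forall>\<^sub>F t in at_right 0. \<forall>a\<in>A. mass (ball_bump 0 a (r a)) t \<le> M a"
    by (rule eventually_ball_finite[OF A(1) M])
  then have "\<forall>\<^sub>F t in at_right 0. mass (\<lambda>x. \<bar>\<phi> x\<bar>) t \<le> B * c * (\<Sum>a\<in>A. M a)"
  proof (rule eventually_mono)
    fix t assume "\<forall>a\<in>A. mass (ball_bump 0 a (r a)) t \<le> M a"
    then have "B * c * (\<Sum>a\<in>A. mass (ball_bump 0 a (r a)) t) \<le> B * c * (\<Sum>a\<in>A. M a)"
      using B(1) c by (intro mult_left_mono sum_mono) auto
    then show "mass (\<lambda>x. \<bar>\<phi> x\<bar>) t \<le> B * c * (\<Sum>a\<in>A. M a)" using mass_le[of t] by linarith
  qed
  then show ?thesis by (rule that)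
qed

end

section \<open>The initial trace\<close>

lemma tendsto_if_nearly_constant:
  fixes f :: "'b \<Rightarrow> real"
  assumes near: "\<And>e. 0 < e \<Longrightarrow> \<exists>L. \<forall>\<^sub>F t in F. \<bar>f t - L\<bar> \<le> e"
  obtains L where "(f \<longlongrightarrow> L) F"
proof -
  have "cauchy_filter (filtermap f F)"
    unfolding cauchy_filter_metric_filtermap
  proof (intro allI impI)
    fix e :: real assume "0 < e"
    then obtain L where L: "\<forall>\<^sub>F t in F. \<bar>f t - L\<bar> \<le> e / 3" using near[of "e / 3"] by auto
    show "\<exists>P. eventually P F \<and> (\<forall>x y. P x \<and> P y \<longrightarrow> dist (f x) (f y) < e)"
      using L \<open>0 < e\<close> by (intro exI[of _ "\<lambda>t. \<bar>f t - L\<bar> \<le> e / 3"]) (auto simp: dist_real_def abs_if split: if_splits)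
  qed
  then obtain L where "filtermap f F \<le> nhds L"
    unfolding convergent_filter_iff_cauchy[symmetric] convergent_filter_iff by blast
  then show ?thesis by (intro that) (simp add: filterlim_def)
qed

context hj_solution
begin

lemma eventually_tint: "\<forall>\<^sub>F t in at_right 0. t \<in> tint T"
proof -
  obtain s where s: "0 < s" "s \<in> tint T" by (rule tint_nonempty[OF T_pos])
  then show ?thesis using tint_Icc_subset[OF _ s(2)] by (force simp: eventually_at_right_field)
qed

lemma mass_abs_diff_le:
  assumes "Cc_fun \<Omega> \<phi>" "Cc_fun \<Omega> \<psi>" "Cc_fun \<Omega> \<xi>" "\<And>x. \<bar>\<phi> x - \<psi> x\<bar> \<le> \<xi> x"
  shows "\<bar>mass \<phi> t - mass \<psi> t\<bar> \<le> mass \<xi> t"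
proof -
  have "mass \<phi> t \<le> mass (\<lambda>x. \<psi> x + \<xi> x) t" "mass \<psi> t \<le> mass (\<lambda>x. \<phi> x + \<xi> x) t"
    using assms by (auto intro!: mass_mono Cc_fun_add simp: abs_le_iff algebra_simps)
  then show ?thesis by (simp add: mass_add assms abs_le_iff)
qed

lemma mass_le_linear_growth:
  assumes t: "0 < t1" "t1 \<le> t2" "t2 \<in> tint T" and \<phi>: "test_fun \<Omega> \<phi>" "\<And>x. 0 \<le> \<phi> x"
    and M: "\<And>t. t \<in> {t1<..t2} \<Longrightarrow> mass (\<lambda>x. \<bar>lap \<phi> x\<bar>) t \<le> M"
  shows "mass \<phi> t2 \<le> mass \<phi> t1 + M * (t2 - t1)"
proof -
  note lap_Cc = test_fun_imp_Cc_fun[OF test_fun_lap[OF \<phi>(1)]]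
  have "slab t1 t2 u (lap \<phi>) \<le> slab t1 t2 u (\<lambda>x. \<bar>lap \<phi> x\<bar>)"
    by (intro slab_mono[OF t u_integrable u_nonneg] lap_Cc Cc_fun_abs) simp
  also have "\<dots> \<le> (t2 - t1) * M" by (rule slab_u_le[OF t Cc_fun_abs[OF lap_Cc] M])
  finally have "slab t1 t2 u (lap \<phi>) \<le> M * (t2 - t1)" by (simp only: mult.commute)
  moreover have "0 \<le> slab t1 t2 absorption \<phi>"
    by (intro pairing_nonneg absorption_nonneg \<phi>(2)) simp
  ultimately show ?thesis using energy_identity[OF t \<phi>(1)] by linarith
qed

lemma mass_tendsto_nonneg_test_fun:
  assumes \<phi>: "test_fun \<Omega> \<phi>" "\<And>x. 0 \<le> \<phi> x"
  obtains L where "(mass \<phi> \<longlongrightarrow> L) (at_right 0)"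
proof -
  obtain M where M: "\<forall>\<^sub>F t in at_right 0. mass (\<lambda>x. \<bar>lap \<phi> x\<bar>) t \<le> M"
    by (rule mass_bounded[OF test_fun_imp_Cc_fun[OF test_fun_lap[OF \<phi>(1)]]])
  obtain M' where "\<forall>\<^sub>F t in at_right 0. mass (\<lambda>x. \<bar>\<phi> x\<bar>) t \<le> M'"
    by (rule mass_bounded[OF test_fun_imp_Cc_fun[OF \<phi>(1)]])
  with M eventually_tint
  have "\<forall>\<^sub>F t in at_right 0. t \<in> tint T \<and> mass (\<lambda>x. \<bar>lap \<phi> x\<bar>) t \<le> M \<and> mass \<phi> t \<le> M'"
    by eventually_elim (simp add: \<phi>(2))
  then obtain t0 where t0: "0 < t0"
    and bounds: "\<And>t. 0 < t \<Longrightarrow> t < t0 \<Longrightarrow> t \<in> tint T \<and> mass (\<lambda>x. \<bar>lap \<phi> x\<bar>) t \<le> M \<and> mass \<phi> t \<le> M'"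
    unfolding eventually_at_right_field by blast
  define N where "N t = M * t - mass \<phi> t" for t
  have "(N \<longlongrightarrow> Inf (N ` ({0<..} \<inter> {..<t0}))) (at 0 within ({0<..} \<inter> {..<t0}))"
  proof (rule Lim_right_bound)
    fix s t assume st: "s \<in> {..<t0}" "t \<in> {..<t0}" "0 < s" "s \<le> t"
    have "mass \<phi> t \<le> mass \<phi> s + M * (t - s)"
      using st bounds by (intro mass_le_linear_growth \<phi>) auto
    then show "N s \<le> N t" by (simp add: N_def algebra_simps)
  next
    fix t assume t: "t \<in> {..<t0}" "0 < t"
    then have "0 \<le> M" using bounds[of t] mass_nonneg[of "\<lambda>x. \<bar>lap \<phi> x\<bar>" t] by simp
    then have "0 \<le> M * t" using t(2) by simp
    then show "- M' \<le> N t" using bounds[of t] t by (simp add: N_def)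
  qed
  moreover have "at 0 within ({0<..} \<inter> {..<t0}) = at_right 0"
    by (rule at_within_nhd[of _ "{..<t0}"]) (use t0 in auto)
  ultimately have "((\<lambda>t. M * t - N t) \<longlongrightarrow> M * 0 - Inf (N ` ({0<..} \<inter> {..<t0}))) (at_right 0)"
    by (intro tendsto_intros) simp
  then show ?thesis by (intro that) (simp add: N_def)
qed

lemma mass_tendsto_test_fun:
  assumes \<phi>: "test_fun \<Omega> \<phi>"
  obtains L where "(mass \<phi> \<longlongrightarrow> L) (at_right 0)"
proof -
  have "compact (tsupport \<phi>)" "tsupport \<phi> \<subseteq> \<Omega>" using \<phi> by (auto simp: test_fun_def)
  then obtain \<eta> V where \<eta>: "test_fun \<Omega> \<eta>" "\<And>x. 0 \<le> \<eta> x"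
    and V: "tsupport \<phi> \<subseteq> V" "\<And>x. x \<in> V \<Longrightarrow> \<eta> x = 1"
    by (rule test_fun_cutoff[OF _ _ open_domain]) blast
  obtain B where B: "\<And>x. \<bar>\<phi> x\<bar> \<le> B" by (rule test_fun_bounded[OF \<phi>]) blast
  then have B_nonneg: "0 \<le> B" by (meson abs_ge_zero order_trans)
  have "0 \<le> \<phi> x + B * \<eta> x" for x
    using B[of x] V \<eta>(2)[of x] B_nonneg not_in_tsupport[of x \<phi>] by (cases "x \<in> tsupport \<phi>") auto
  then obtain L1 where L1: "(mass (\<lambda>x. \<phi> x + B * \<eta> x) \<longlongrightarrow> L1) (at_right 0)"
    using mass_tendsto_nonneg_test_fun[OF test_fun_add[OF \<phi> test_fun_cmult[OF \<eta>(1)]]] by blast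
  obtain L2 where L2: "(mass \<eta> \<longlongrightarrow> L2) (at_right 0)" by (rule mass_tendsto_nonneg_test_fun[OF \<eta>])
  have "mass \<phi> = (\<lambda>t. mass (\<lambda>x. \<phi> x + B * \<eta> x) t - B * mass \<eta> t)"
    using \<phi> \<eta>(1) by (simp add: mass_add mass_cmult Cc_fun_cmult test_fun_imp_Cc_fun)
  then have "(mass \<phi> \<longlongrightarrow> L1 - B * L2) (at_right 0)"
    by (simp only:) (intro tendsto_intros L1 L2)
  then show ?thesis by (rule that)
qed

lemma mass_tendsto:
  assumes \<psi>: "Cc_fun \<Omega> \<psi>"
  obtains L where "(mass \<psi> \<longlongrightarrow> L) (at_right 0)"
proof (rule tendsto_if_nearly_constant[of "mass \<psi>" "at_right 0"])
  fix e :: real assume e: "0 < e"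
  have "compact (tsupport \<psi>)" "tsupport \<psi> \<subseteq> \<Omega>" using \<psi> by (auto simp: Cc_fun_def)
  then obtain \<eta> V where \<eta>: "test_fun \<Omega> \<eta>" "\<And>x. 0 \<le> \<eta> x"
    and V: "open V" "tsupport \<psi> \<subseteq> V" "\<And>x. x \<in> V \<Longrightarrow> \<eta> x = 1"
    by (rule test_fun_cutoff[OF _ _ open_domain]) blast
  note \<eta>_Cc = test_fun_imp_Cc_fun[OF \<eta>(1)]
  obtain M where M: "\<forall>\<^sub>F t in at_right 0. mass (\<lambda>x. \<bar>\<eta> x\<bar>) t \<le> M" by (rule mass_bounded[OF \<eta>_Cc])
  define d where "d = e / (2 * (\<bar>M\<bar> + 1))"
  have d: "0 < d" using e by (simp add: d_def)
  have "d * M \<le> d * (\<bar>M\<bar> + 1)" using d by (intro mult_left_mono) auto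
  also have "\<dots> = e / 2" using add_nonneg_pos[OF abs_ge_zero zero_less_one, of M] by (simp add: d_def divide_simps)
  finally have dM: "d * M \<le> e / 2" .
  have "Cc_fun V \<psi>" using \<psi> V(2) by (auto simp: Cc_fun_def)
  then obtain \<theta> where \<theta>: "test_fun V \<theta>" "\<And>x. \<bar>\<theta> x - \<psi> x\<bar> \<le> d"
    using test_fun_dense[OF _ V(1) d] by blast
  have "V \<subseteq> \<Omega>" using V(3) \<eta>(1) supported_in_eq_0[of \<Omega> \<eta>] by (force simp: test_fun_iff)
  then have \<theta>_test: "test_fun \<Omega> \<theta>" by (rule test_fun_mono[OF \<theta>(1)])
  obtain L where "(mass \<theta> \<longlongrightarrow> L) (at_right 0)" by (rule mass_tendsto_test_fun[OF \<theta>_test])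
  then have "\<forall>\<^sub>F t in at_right 0. dist (mass \<theta> t) L < e / 2" using e by (intro tendstoD) auto
  with M have "\<forall>\<^sub>F t in at_right 0. \<bar>mass \<psi> t - L\<bar> \<le> e"
  proof eventually_elim
    case (elim t)
    have "\<bar>\<psi> x - \<theta> x\<bar> \<le> d * \<eta> x" for x
    proof (cases "x \<in> V")
      case True
      then show ?thesis using \<theta>(2)[of x] V(3) by (simp add: abs_minus_commute)
    next
      case False
      then have "\<theta> x = 0" "\<psi> x = 0"
        using \<theta>(1) V(2) supported_in_eq_0[of V \<theta>] not_in_tsupport[of x \<psi>] by (auto simp: test_fun_iff)
      then show ?thesis using \<eta>(2)[of x] d by simp
    qed
    then have "\<bar>mass \<psi> t - mass \<theta> t\<bar> \<le> mass (\<lambda>x. d * \<eta> x) t"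
      by (intro mass_abs_diff_le \<psi> test_fun_imp_Cc_fun \<theta>_test Cc_fun_cmult \<eta>(1))
    also have "\<dots> \<le> d * M" using elim(1) d \<eta>(2) by (simp add: mass_cmult)
    finally show ?case using elim(2) dM unfolding dist_real_def by linarith
  qed
  then show "\<exists>L. \<forall>\<^sub>F t in at_right 0. \<bar>mass \<psi> t - L\<bar> \<le> e" ..
qed (rule that)

lemma trace_exists:
  obtains u0 where "radon_on \<Omega> u0" "\<And>\<psi>. Cc_fun \<Omega> \<psi> \<Longrightarrow> (mass \<psi> \<longlongrightarrow> (\<integral>x. \<psi> x \<partial>u0)) (at_right 0)"
proof -
  define \<Lambda> where "\<Lambda> \<psi> = Lim (at_right 0) (mass \<psi>)" for \<psi>
  have lim: "(mass \<psi> \<longlongrightarrow> \<Lambda> \<psi>) (at_right 0)" if \<psi>: "Cc_fun \<Omega> \<psi>" for \<psi>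
    by (rule mass_tendsto[OF \<psi>]) (auto simp: \<Lambda>_def tendsto_Lim)
  interpret positive_functional \<Omega> \<Lambda>
  proof
    show "open \<Omega>" by (rule open_domain)
    fix \<phi> \<psi> :: "'a \<Rightarrow> real" and c :: real assume \<phi>: "Cc_fun \<Omega> \<phi>"
    show "\<Lambda> (\<lambda>x. c * \<phi> x) = c * \<Lambda> \<phi>"
      using lim[OF Cc_fun_cmult[OF \<phi>, of c]] tendsto_mult_left[OF lim[OF \<phi>], of c]
      unfolding mass_cmult[abs_def] by (rule tendsto_unique[rotated]) simp
    show "0 \<le> \<Lambda> \<phi>" if "\<And>x. 0 \<le> \<phi> x"
      by (rule tendsto_lowerbound[OF lim[OF \<phi>]]) (simp_all add: mass_nonneg that)
    assume \<psi>: "Cc_fun \<Omega> \<psi>"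
    show "\<Lambda> (\<lambda>x. \<phi> x + \<psi> x) = \<Lambda> \<phi> + \<Lambda> \<psi>"
      using lim[OF Cc_fun_add[OF \<phi> \<psi>]] tendsto_add[OF lim[OF \<phi>] lim[OF \<psi>]]
      unfolding mass_add[OF \<phi> \<psi>, abs_def] by (rule tendsto_unique[rotated]) simp
  qed
  obtain u0 where "radon_on \<Omega> u0" "\<And>\<psi>. Cc_fun \<Omega> \<psi> \<Longrightarrow> (\<integral>x. \<psi> x \<partial>u0) = \<Lambda> \<psi>"
    using riesz_representation by blast
  then show ?thesis using lim by (intro that) auto
qed

end

lemma set_integral_mult_eq_abs:
  fixes v \<psi> :: "'a::euclidean_space \<Rightarrow> real"
  assumes "integrable lebesgue (\<lambda>x. \<bar>v x\<bar> * \<psi> x)" and nonneg: "AE x in lebesgue. x \<in> S \<longrightarrow> 0 \<le> v x"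
    and outside: "\<And>x. x \<notin> S \<Longrightarrow> \<psi> x = 0"
  shows "(LINT x:S|lebesgue. v x * \<psi> x) = (\<integral>x. \<bar>v x\<bar> * \<psi> x \<partial>lebesgue)"
proof -
  have "AE x in lebesgue. \<bar>v x\<bar> * \<psi> x = indicator S x *\<^sub>R (v x * \<psi> x)"
    using nonneg by (rule eventually_mono) (auto simp: indicator_def outside)
  moreover have "(\<lambda>x. \<bar>v x\<bar> * \<psi> x) \<in> borel_measurable lebesgue"
    using assms(1) by (rule borel_measurable_integrable)
  ultimately show ?thesis
    unfolding set_lebesgue_integral_def
    by (intro integral_cong_AE[symmetric]) (auto intro: borel_measurable_AE)
qed

theorem theorem1p7:
  fixes q :: real and \<Omega> :: "'a::euclidean_space set" and T :: ereal
    and u :: "'a \<Rightarrow> real \<Rightarrow> real"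
  assumes "0 < q" "q \<le> 1"
    and "open \<Omega>" "connected \<Omega>" "\<Omega> \<noteq> {}"
    and "0 < T"
    and "weak_solution q \<Omega> T u"
    and "\<forall>t\<in>tint T. AE x in lebesgue. x \<in> \<Omega> \<longrightarrow> 0 \<le> u x t"
  shows "\<exists>u0 :: 'a measure. radon_on \<Omega> u0 \<and>
           (\<forall>\<psi>. Cc_fun \<Omega> \<psi> \<longrightarrow>
              ((\<lambda>t. LINT x:\<Omega>|lebesgue. u x t * \<psi> x) \<longlongrightarrow> (LINT x|u0. \<psi> x)) (at_right 0))"
proof -
  obtain g where "hj_solution q \<Omega> T (\<lambda>p. \<bar>u (fst p) (snd p)\<bar>) g"
    by (rule hj_solution_of_weak_solution[OF assms(1-3,6,7)]) (use assms(8) in auto)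
  then interpret hj_solution q \<Omega> T "\<lambda>p. \<bar>u (fst p) (snd p)\<bar>" g .
  obtain u0 where u0: "radon_on \<Omega> u0" "\<And>\<psi>. Cc_fun \<Omega> \<psi> \<Longrightarrow> (mass \<psi> \<longlongrightarrow> (\<integral>x. \<psi> x \<partial>u0)) (at_right 0)"
    by (rule trace_exists) blast
  have "((\<lambda>t. LINT x:\<Omega>|lebesgue. u x t * \<psi> x) \<longlongrightarrow> (LINT x|u0. \<psi> x)) (at_right 0)" if \<psi>: "Cc_fun \<Omega> \<psi>" for \<psi>
  proof (rule Lim_transform_eventually[OF u0(2)[OF \<psi>]])
    have "(LINT x:\<Omega>|lebesgue. u x t * \<psi> x) = mass \<psi> t" if t: "t \<in> tint T" for t
      using set_integral_mult_eq_abs[of "\<lambda>x. u x t"] mass_integrable[OF \<psi> t] assms(8) t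
        supported_in_eq_0[of \<Omega> \<psi>] \<psi> by (simp add: mass_def Cc_fun_iff)
    with eventually_tint show "\<forall>\<^sub>F t in at_right 0. mass \<psi> t = (LINT x:\<Omega>|lebesgue. u x t * \<psi> x)"
      by (auto elim: eventually_mono)
  qed
  with u0(1) show ?thesis by blast
qed

end
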